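(* Let $\mu$ be a composition of $n$ and $\pi,\tau\in\mathcal{I}_\mu$ with $\pi\lessdot^\mu\tau$. Then \[ \mathcal{A}_\mu(\tau)=\{wt_{ij}: w\in\mathcal{A}_\mu(\pi),\ t^\mu_{ij}(\pi)=\tau,\ \ell(wt_{ij})=\ell(w)+1\}. \]
   Context: Permutations are in one-line notation; $\mathrm{std}$ is standardization; $t_{ij}$ is the transposition $(i,j)$. $\ell$ is Coxeter length, $s_i=(i,i{+}1)$, $e$ the identity, and the 0--Hecke product is $w\circ s_i=ws_i$ if $\ell(ws_i)>\ell(w)$, else $w$ (similarly on the left). For a composition $\mu=(\mu_1,\dots,\mu_k)$ of $n$, $\pi\in S_n$ and $m_r=\mu_1+\dots+\mu_{r-1}$, the $r$th block is $B_r=\pi(m_r{+}1)\cdots\pi(m_r{+}\mu_r)$; $\pi$ is a $\mu$--involution ($\pi\in\mathcal{I}_\mu$) if each $\mathrm{std}(B_r)$ is an involution. For $\pi\in\mathcal{I}_\mu$, $i\in[n-1]$: if values $i,i{+}1$ are in different blocks, $\pi\circ_\mu s_i=s_i\circ\pi$; if in the same block $B$, replace $B$ by the word on the same values with standardization $s_r\circ\mathrm{std}(B)\circ s_r$, where $i$ is the $r$th smallest value of $B$. This extends to a right action of the 0--Hecke monoid. A reduced $\mu$--word for $\pi$ is a shortest $(a_1,\dots,a_p)$ with $\pi=e\circ_\mu s_{a_1}\circ_\mu\cdots\circ_\mu s_{a_p}$; $\ell_\mu(\pi)=p$ and $\mathcal{R}_\mu(\pi)$ is the set of these. $\mathcal{A}_\mu(\pi)=\{w\in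 S_n:e\circ_\mu w=\pi,\ \ell(w)=\ell_\mu(\pi)\}$. $\mu$--Bruhat order on $\mathcal{I}_\mu$: $\pi\le^\mu\tau$ iff every word in $\mathcal{R}_\mu(\tau)$ has a subword in $\mathcal{R}_\mu(\pi)$; $\lessdot^\mu$ denotes its cover relation. The operator $t^\mu_{ij}$: $t^\mu_{ij}(\pi)=\tau$ if there exist $v\in\mathcal{A}_\mu(\pi)$ and $\tau\in\mathcal{I}_\mu$ with $\ell(vt_{ij})=\ell(v)+1$ and $vt_{ij}\in\mathcal{A}_\mu(\tau)$ (this is well defined); otherwise $t^\mu_{ij}(\pi)=\pi$. *)

theory Defs
  imports "HOL-Combinatorics.Permutations" "HOL-Library.Sublist"
begin

text \<open>
  \<open>S\<^sub>n\<close> is the set of all \<open>w :: nat \<Rightarrow> nat\<close> with \<open>w permutes {1..n}\<close>. The product \<open>u w\<close> is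
  \<open>u \<circ> w\<close>, so \<open>w s\<^sub>i\<close> exchanges the entries in positions \<open>i, i+1\<close> of the one-line notation of \<open>w\<close>,
  and \<open>s\<^sub>i w\<close> exchanges the values \<open>i, i+1\<close>.
\<close>

section \<open>Coxeter length and the 0-Hecke product\<close>

definition simple_refl :: "nat \<Rightarrow> nat \<Rightarrow> nat" where
  "simple_refl i = transpose i (Suc i)"

definition word_prod :: "nat list \<Rightarrow> nat \<Rightarrow> nat" where
  "word_prod a = foldr (\<lambda>i w. simple_refl i \<circ> w) a id"

definition cox_length :: "nat \<Rightarrow> (nat \<Rightarrow> nat) \<Rightarrow> nat" where
  "cox_length n w = (LEAST p. \<exists>a. set a \<subseteq> {1..<n} \<and> length a = p \<and> word_prod a = w)"

definition reduced_word :: "nat \<Rightarrow> (nat \<Rightarrow> nat) \<Rightarrow> nat list \<Rightarrow> bool" where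
  "reduced_word n w a \<longleftrightarrow>
     set a \<subseteq> {1..<n} \<and> word_prod a = w \<and> length a = cox_length n w"

definition hecke_right :: "nat \<Rightarrow> (nat \<Rightarrow> nat) \<Rightarrow> nat \<Rightarrow> nat \<Rightarrow> nat" where
  "hecke_right n w i =
     (if cox_length n (w \<circ> simple_refl i) > cox_length n w then w \<circ> simple_refl i else w)"

definition hecke_left :: "nat \<Rightarrow> nat \<Rightarrow> (nat \<Rightarrow> nat) \<Rightarrow> nat \<Rightarrow> nat" where
  "hecke_left n i w =
     (if cox_length n (simple_refl i \<circ> w) > cox_length n w then simple_refl i \<circ> w else w)"

section \<open>Standardization\<close>

definition rank_in :: "nat set \<Rightarrow> nat \<Rightarrow> nat" where
  "rank_in V x = card {y \<in> V. y \<le> x}"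

definition standardization :: "nat list \<Rightarrow> nat \<Rightarrow> nat" where
  "standardization b =
     (\<lambda>i. if i \<in> {1..length b} then rank_in (set b) (b ! (i - 1)) else i)"

definition word_on :: "nat set \<Rightarrow> (nat \<Rightarrow> nat) \<Rightarrow> nat list" where
  "word_on V \<sigma> = map (\<lambda>q. sorted_list_of_set V ! (\<sigma> q - 1)) [1..<Suc (card V)]"

lemma sorted_list_of_set_nth_image:
  assumes "finite V"
  shows "(!) (sorted_list_of_set V) ` {..<card V} = V"
proof -
  have "set (sorted_list_of_set V) = (!) (sorted_list_of_set V) ` {..<card V}"
    by (auto simp: set_conv_nth)
  then show ?thesis using assms by simp
qed

lemma rank_in_sorted_list_of_set:
  assumes "finite V" "k < card V"
  shows "rank_in V (sorted_list_of_set V ! k) = Suc k"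
proof -
  let ?f = "(!) (sorted_list_of_set V)"
  have less: "?f i < ?f j" if "i < j" "j < card V" for i j
    using sorted_wrt_nth_less[OF strict_sorted_list_of_set, of i j V] that by simp
  have mono: "?f i \<le> ?f j \<longleftrightarrow> i \<le> j" if "i < card V" "j < card V" for i j
    using less[of i j] less[of j i] that by (cases i j rule: linorder_cases) auto
  have "{y \<in> V. y \<le> ?f k} = {y \<in> ?f ` {..<card V}. y \<le> ?f k}"
    by (simp only: sorted_list_of_set_nth_image[OF assms(1)])
  also have "\<dots> = ?f ` {..k}"
    using mono assms(2) by auto
  finally have "{y \<in> V. y \<le> ?f k} = ?f ` {..k}" .
  moreover have "inj_on ?f {..k}"
    using mono assms(2) by (intro inj_onI) (metis atMost_iff le_antisym le_less_trans order_refl)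
  ultimately show ?thesis
    by (simp add: rank_in_def card_image)
qed

lemma
  assumes "finite V" and \<sigma>: "\<sigma> permutes {1..card V}"
  shows set_word_on: "set (word_on V \<sigma>) = V"
    and standardization_word_on: "standardization (word_on V \<sigma>) = \<sigma>"
proof -
  have ran: "\<sigma> ` {1..card V} = {1..card V}"
    using \<sigma> by (rule permutes_image)
  have shift: "(\<lambda>q. q - 1) ` {1..card V} = {..<card V}"
  proof -
    have "{1..card V} = Suc ` {..<card V}"
      by (simp add: image_Suc_lessThan)
    then show ?thesis by (simp add: image_image)
  qed
  have "set (word_on V \<sigma>) = (!) (sorted_list_of_set V) ` (\<lambda>q. q - 1) ` \<sigma> ` {1..card V}"
    by (simp add: word_on_def image_image atLeastLessThanSuc_atLeastAtMost del: upt_Suc)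
  then show S: "set (word_on V \<sigma>) = V"
    by (simp only: ran shift sorted_list_of_set_nth_image[OF assms(1)])
  have len: "length (word_on V \<sigma>) = card V"
    by (simp add: word_on_def)
  show "standardization (word_on V \<sigma>) = \<sigma>"
  proof
    fix i
    show "standardization (word_on V \<sigma>) i = \<sigma> i"
    proof (cases "i \<in> {1..card V}")
      case True
      then have si: "\<sigma> i \<in> {1..card V}" using ran by blast
      have "word_on V \<sigma> ! (i - 1) = sorted_list_of_set V ! (\<sigma> i - 1)"
        using True by (subst word_on_def, subst nth_map) (auto simp del: upt_Suc)
      then show ?thesis
        using True si S len rank_in_sorted_list_of_set[OF assms(1), of "\<sigma> i - 1"]
        by (auto simp: standardization_def)
    next
      case False
      then show ?thesis
        using False permutes_not_in[OF \<sigma> False] len by (auto simp: standardization_def)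
    qed
  qed
qed

section \<open>\<open>\<mu>\<close>-involutions\<close>

definition composition :: "nat list \<Rightarrow> nat \<Rightarrow> bool" where
  "composition \<mu> n \<longleftrightarrow> (\<forall>k \<in> set \<mu>. 0 < k) \<and> sum_list \<mu> = n"

text \<open>Blocks are indexed from 0: block \<open>r\<close> occupies the positions
  \<open>offset \<mu> r + 1, \<dots>, offset \<mu> r + \<mu> ! r\<close>.\<close>

definition offset :: "nat list \<Rightarrow> nat \<Rightarrow> nat" where
  "offset \<mu> r = sum_list (take r \<mu>)"

definition block :: "nat list \<Rightarrow> (nat \<Rightarrow> nat) \<Rightarrow> nat \<Rightarrow> nat list" where
  "block \<mu> \<pi> r = map (\<lambda>q. \<pi> (offset \<mu> r + q)) [1..<Suc (\<mu> ! r)]"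

definition mu_involutions :: "nat list \<Rightarrow> (nat \<Rightarrow> nat) set" where
  "mu_involutions \<mu> =
     {\<pi>. \<pi> permutes {1..sum_list \<mu>} \<and>
         (\<forall>r < length \<mu>. standardization (block \<mu> \<pi> r) \<circ> standardization (block \<mu> \<pi> r) = id)}"

definition block_of :: "nat list \<Rightarrow> (nat \<Rightarrow> nat) \<Rightarrow> nat \<Rightarrow> nat" where
  "block_of \<mu> \<pi> v = (THE r. r < length \<mu> \<and> v \<in> set (block \<mu> \<pi> r))"

definition replace_block ::
    "nat list \<Rightarrow> (nat \<Rightarrow> nat) \<Rightarrow> nat \<Rightarrow> nat list \<Rightarrow> nat \<Rightarrow> nat" where
  "replace_block \<mu> \<pi> r b =
     (\<lambda>q. if q \<in> {offset \<mu> r + 1..offset \<mu> r + \<mu> ! r} then b ! (q - offset \<mu> r - 1) else \<pi> q)"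

definition mu_step :: "nat list \<Rightarrow> (nat \<Rightarrow> nat) \<Rightarrow> nat \<Rightarrow> nat \<Rightarrow> nat" where
  "mu_step \<mu> \<pi> i =
     (if block_of \<mu> \<pi> i \<noteq> block_of \<mu> \<pi> (Suc i) then hecke_left (sum_list \<mu>) i \<pi>
      else
        let r = block_of \<mu> \<pi> i; B = block \<mu> \<pi> r; k = \<mu> ! r; j = rank_in (set B) i
        in replace_block \<mu> \<pi> r
             (word_on (set B) (hecke_right k (hecke_left k j (standardization B)) j)))"

definition mu_word_act :: "nat list \<Rightarrow> (nat \<Rightarrow> nat) \<Rightarrow> nat list \<Rightarrow> nat \<Rightarrow> nat" where
  "mu_word_act \<mu> \<pi> a = foldl (mu_step \<mu>) \<pi> a"

text \<open>The action of \<open>w \<in> S\<^sub>n\<close>, as an element of the 0-Hecke monoid, is the action of any reduced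
  word of \<open>w\<close>; on \<open>\<mu>\<close>-involutions the result does not depend on the word chosen.\<close>

definition mu_act :: "nat list \<Rightarrow> (nat \<Rightarrow> nat) \<Rightarrow> (nat \<Rightarrow> nat) \<Rightarrow> nat \<Rightarrow> nat" where
  "mu_act \<mu> \<pi> w = mu_word_act \<mu> \<pi> (SOME a. reduced_word (sum_list \<mu>) w a)"

definition mu_length :: "nat list \<Rightarrow> (nat \<Rightarrow> nat) \<Rightarrow> nat" where
  "mu_length \<mu> \<pi> =
     (LEAST p. \<exists>a. set a \<subseteq> {1..<sum_list \<mu>} \<and> length a = p \<and> mu_word_act \<mu> id a = \<pi>)"

definition reduced_mu_words :: "nat list \<Rightarrow> (nat \<Rightarrow> nat) \<Rightarrow> nat list set" where
  "reduced_mu_words \<mu> \<pi> =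
     {a. set a \<subseteq> {1..<sum_list \<mu>} \<and> mu_word_act \<mu> id a = \<pi> \<and> length a = mu_length \<mu> \<pi>}"

definition atoms :: "nat list \<Rightarrow> (nat \<Rightarrow> nat) \<Rightarrow> (nat \<Rightarrow> nat) set" where
  "atoms \<mu> \<pi> =
     {w. w permutes {1..sum_list \<mu>} \<and> mu_act \<mu> id w = \<pi> \<and>
         cox_length (sum_list \<mu>) w = mu_length \<mu> \<pi>}"

section \<open>\<open>\<mu>\<close>-Bruhat order and the operators \<open>t\<^sup>\<mu>\<close>\<close>

definition mu_bruhat_le :: "nat list \<Rightarrow> (nat \<Rightarrow> nat) \<Rightarrow> (nat \<Rightarrow> nat) \<Rightarrow> bool" where
  "mu_bruhat_le \<mu> \<pi> \<tau> \<longleftrightarrow>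
     \<pi> \<in> mu_involutions \<mu> \<and> \<tau> \<in> mu_involutions \<mu> \<and>
     (\<forall>b \<in> reduced_mu_words \<mu> \<tau>. \<exists>a \<in> reduced_mu_words \<mu> \<pi>. subseq a b)"

definition mu_bruhat_covers :: "nat list \<Rightarrow> (nat \<Rightarrow> nat) \<Rightarrow> (nat \<Rightarrow> nat) \<Rightarrow> bool" where
  "mu_bruhat_covers \<mu> \<pi> \<tau> \<longleftrightarrow>
     mu_bruhat_le \<mu> \<pi> \<tau> \<and> \<pi> \<noteq> \<tau> \<and>
     (\<forall>\<rho>. mu_bruhat_le \<mu> \<pi> \<rho> \<and> mu_bruhat_le \<mu> \<rho> \<tau> \<longrightarrow> \<rho> = \<pi> \<or> \<rho> = \<tau>)"

definition mu_transp_rel ::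
    "nat list \<Rightarrow> nat \<Rightarrow> nat \<Rightarrow> (nat \<Rightarrow> nat) \<Rightarrow> (nat \<Rightarrow> nat) \<Rightarrow> bool" where
  "mu_transp_rel \<mu> i j \<pi> \<tau> \<longleftrightarrow>
     \<tau> \<in> mu_involutions \<mu> \<and>
     (\<exists>v \<in> atoms \<mu> \<pi>.
        cox_length (sum_list \<mu>) (v \<circ> transpose i j) = cox_length (sum_list \<mu>) v + 1 \<and>
        v \<circ> transpose i j \<in> atoms \<mu> \<tau>)"

definition mu_transp :: "nat list \<Rightarrow> nat \<Rightarrow> nat \<Rightarrow> (nat \<Rightarrow> nat) \<Rightarrow> nat \<Rightarrow> nat" where
  "mu_transp \<mu> i j \<pi> =
     (if \<exists>\<tau>. mu_transp_rel \<mu> i j \<pi> \<tau> then THE \<tau>. mu_transp_rel \<mu> i j \<pi> \<tau> else \<pi>)"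

end

theory Submission
  imports Defs "HOL-Library.Product_Lexorder"
begin

text \<open>A \<open>\<mu>\<close>-involution \<open>\<pi>\<close> is encoded by the block \<open>\<beta> v\<close> of each value \<open>v\<close> and an involution \<open>y\<close> of
  the values which preserves the blocks. As for ordinary involutions, its atoms are the permutations
  \<open>w\<close> which respect the blocks and satisfy conditions on the cycles of \<open>y\<close>, each involving at most two
  cycles. Any two atoms of \<open>\<pi>\<close> are related by moves which exchange the first two letters \<open>p + 1, p\<close>
  and \<open>p, p + 1\<close> of a reduced word. As these two words act in the same way, all atoms have the same
  length, and \<open>\<pi> \<le> \<tau>\<close> can be tested on a single reduced \<open>\<mu>\<close>-word of \<open>\<tau>\<close>. The lifting property
  follows, so a cover raises the length by one, and a reduced word of an atom of \<open>\<tau>\<close> contains a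
  reduced word of an atom of \<open>\<pi>\<close> with one letter less, which gives one inclusion. For the other one,
  if \<open>w\<close> is an atom of \<open>\<pi>\<close> and \<open>w t\<^sub>i\<^sub>j\<close> has length one more, then whether \<open>w t\<^sub>i\<^sub>j\<close> is an
  atom, and of which \<open>\<mu>\<close>-involution, depends only on \<open>\<beta>\<close>, \<open>y\<close>, \<open>i\<close> and \<open>j\<close>.\<close>

section \<open>Pairs of cycles\<close>

text \<open>The order quantifies over the reduced words of all atoms of \<tau>. Those of one atom
  are settled inside the symmetric group (\<open>Sub_reduced_word\<close>); passing between atoms
  needs one more relation. It holds only at the start of a word, where the action begins at
  \<open>id\<close>: there the letters p and p + 1 in either order give the 2-cycle of p and p + 2,
  if these positions lie in one block. Hence moves between atoms multiply \<open>w\<close> on the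
  left, whereas a step of the action multiplies it on the right.

  The other obstacle is that \<open>mu_transp\<close> asks for one atom \<open>v\<close> of \<pi>,
  while the theorem speaks of every \<open>w\<close>. Inside a block, two configurations of the
  partners of i and j keep the product from being an atom. That they do so for every
  \<open>w\<close> is not visible from two cycles alone; it takes an induction along the moves.

  Arguments of \<open>w\<close> are letters of \<pi> and its values are positions, so
  \<open>w\<close> behaves like \<open>inv \<pi>\<close>. As the conditions compare two cycles at a
  time, the local claims concern the order of a few integers and are isolated here, free of
  permutations.\<close>

text \<open>Lower case letters are points and upper case letters their images under a permutation \<open>w\<close>;
  \<open>(a, b)\<close> and \<open>(c, d)\<close> are cycles of an involution, fixed points being the case \<open>a = b\<close>. Reading
  the points in the order of their images, the conditions say that the larger point of a cycle comes
  first, that no point of one cycle lies between the two points of another one both in size and in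
  position, and that two cycles with \<open>a < c\<close> and \<open>b < d\<close> have \<open>a\<close> before \<open>d\<close>.\<close>

definition cycle_ok :: "int \<Rightarrow> int \<Rightarrow> int \<Rightarrow> int \<Rightarrow> bool" where
  "cycle_ok a b A B \<longleftrightarrow> (a < b \<longrightarrow> B < A) \<and> (b < a \<longrightarrow> A < B) \<and> (a = b \<longrightarrow> A = B)"

definition compat :: "int \<Rightarrow> int \<Rightarrow> int \<Rightarrow> int \<Rightarrow> int \<Rightarrow> int \<Rightarrow> int \<Rightarrow> int \<Rightarrow> bool" where
  "compat a b A B c d C D \<longleftrightarrow>
    (a < c \<and> c < b \<longrightarrow> \<not> (B < C \<and> C < A)) \<and>
    (a < d \<and> d < b \<longrightarrow> \<not> (B < D \<and> D < A)) \<and>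
    (c < a \<and> a < d \<longrightarrow> \<not> (D < A \<and> A < C)) \<and>
    (c < b \<and> b < d \<longrightarrow> \<not> (D < B \<and> B < C)) \<and>
    (a < c \<and> b < d \<longrightarrow> A < D) \<and> (c < a \<and> d < b \<longrightarrow> C < B)"

definition cycles_ok :: "int \<Rightarrow> int \<Rightarrow> int \<Rightarrow> int \<Rightarrow> int \<Rightarrow> int \<Rightarrow> int \<Rightarrow> int \<Rightarrow> bool" where
  "cycles_ok a b A B c d C D \<longleftrightarrow>
    a \<noteq> c \<and> a \<noteq> d \<and> b \<noteq> c \<and> b \<noteq> d \<and> A \<noteq> C \<and> A \<noteq> D \<and> B \<noteq> C \<and> B \<noteq> D \<and>
    (a \<le> b \<and> c \<le> d \<longrightarrow> compat a b A B c d C D) \<and>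
    (a \<le> b \<and> d \<le> c \<longrightarrow> compat a b A B d c D C) \<and>
    (b \<le> a \<and> c \<le> d \<longrightarrow> compat b a B A c d C D) \<and>
    (b \<le> a \<and> d \<le> c \<longrightarrow> compat b a B A d c D C)"

definition not_between :: "int \<Rightarrow> int \<Rightarrow> int \<Rightarrow> int \<Rightarrow> int \<Rightarrow> int \<Rightarrow> bool" where
  "not_between i j I J x X \<longleftrightarrow> \<not> (i < x \<and> x < j \<and> I < X \<and> X < J)"

lemmas ok_defs = not_between_def cycle_ok_def cycles_ok_def compat_def

lemma compat_sym: "compat a b A B c d C D \<Longrightarrow> compat c d C D a b A B"
  unfolding compat_def by blast

lemma cycles_ok_sym: "cycles_ok a b A B c d C D \<Longrightarrow> cycles_ok c d C D a b A B"
  unfolding cycles_ok_def using compat_sym by blast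

lemma cycles_ok_swap: "cycles_ok a b A B c d C D \<Longrightarrow> cycles_ok b a B A c d C D"
  unfolding cycles_ok_def by blast

context
  fixes i j a b I J A B :: int
  assumes ij: "i < j" "I < J"
    and nb: "not_between i j I J a A" "not_between i j I J b B"
    and cyc: "cycle_ok i a I A" "cycle_ok j b J B"
begin

context
  fixes fi fj :: bool and zi zj za zb ZI ZJ ZA ZB :: int
  assumes pair: "cycles_ok i a I A j b J B"
    and good: "\<not> (j < a \<and> b < a)" "\<not> (b < i \<and> b < a)"
    and f: "fi = (i \<le> a \<and> a < j)" "fj = (i < b \<and> b \<le> j)"
    and zi: "zi = (if fi \<and> fj then j else if fj then i else b)"
            "ZI = (if zi = j then I else if zi = i then J else B)"
    and zj: "zj = (if fi \<and> fj then i else if fi then j else a)"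
            "ZJ = (if zj = j then I else if zj = i then J else A)"
    and za: "a \<noteq> i \<Longrightarrow> za = (if i < a \<and> a < j then (if i < b \<and> b < a then b else a) else j)"
            "a \<noteq> i \<Longrightarrow> ZA = (if za = j then I else if za = a then A else B)"
    and zb: "b \<noteq> j \<Longrightarrow> zb = (if i < b \<and> b < j then (if b < a \<and> a < j then a else b) else i)"
            "b \<noteq> j \<Longrightarrow> ZB = (if zb = i then J else if zb = a then A else B)"
begin

text \<open>The points \<open>i\<close> and \<open>j\<close> have exchanged their images, hence
  \<open>J\<close> goes with \<open>i\<close> and \<open>I\<close> with \<open>j\<close>;
  \<open>zi\<close>, \<open>zj\<close>, \<open>za\<close>, \<open>zb\<close> are the new partners as
  computed by \<open>swap_partner\<close>. The equations for \<open>za\<close> and \<open>zb\<close>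
  are conditional because for \<open>a = i\<close> or \<open>b = j\<close> the partner is already
  given by \<open>zi\<close> or \<open>zj\<close>. The assumptions \<open>good\<close> exclude the
  two configurations treated by \<open>bad_swap_not_atom\<close>.\<close>

lemma swap_same_cycle:
  shows "cycle_ok i zi J ZI" "cycle_ok j zj I ZJ"
    "a \<noteq> i \<Longrightarrow> cycle_ok a za A ZA" "b \<noteq> j \<Longrightarrow> cycle_ok b zb B ZB"
  using ij nb cyc pair good f zi zj za zb unfolding ok_defs by (smt (verit))+

lemma swap_same_inner:
  shows "j \<noteq> zi \<Longrightarrow> cycles_ok i zi J ZI j zj I ZJ"
    "a \<noteq> i \<Longrightarrow> a \<noteq> zi \<Longrightarrow> cycles_ok i zi J ZI a za A ZA"
    "b \<noteq> j \<Longrightarrow> b \<noteq> zi \<Longrightarrow> cycles_ok i zi J ZI b zb B ZB"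
    "a \<noteq> i \<Longrightarrow> a \<noteq> zj \<Longrightarrow> cycles_ok j zj I ZJ a za A ZA"
    "b \<noteq> j \<Longrightarrow> b \<noteq> zj \<Longrightarrow> cycles_ok j zj I ZJ b zb B ZB"
    "a \<noteq> i \<Longrightarrow> b \<noteq> j \<Longrightarrow> b \<noteq> za \<Longrightarrow> cycles_ok a za A ZA b zb B ZB"
  using ij nb cyc pair good f zi zj za zb unfolding ok_defs by (smt (verit))+

context
  fixes c d C D :: int
  assumes nb2: "not_between i j I J c C" "not_between i j I J d D"
    and cyc2: "cycle_ok c d C D" "cycles_ok i a I A c d C D" "cycles_ok j b J B c d C D"
begin

text \<open>A cycle \<open>(c, d)\<close> disjoint from \<open>i\<close>, \<open>j\<close>,
  \<open>a\<close>, \<open>b\<close> is compared with the new cycle of each of these four points in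
  turn, so that each order problem stays small.\<close>

lemma swap_same_outer_i: "cycles_ok i zi J ZI c d C D"
  using ij nb cyc pair good nb2 cyc2 f zi unfolding ok_defs by (smt (verit))

lemma swap_same_outer_j: "cycles_ok j zj I ZJ c d C D"
  using ij nb cyc pair good nb2 cyc2 f zj unfolding ok_defs by (smt (verit))

lemma swap_same_outer_a: "a \<noteq> i \<Longrightarrow> cycles_ok a za A ZA c d C D"
  using ij nb cyc pair good nb2 cyc2 za unfolding ok_defs by (smt (verit))

lemma swap_same_outer_b: "b \<noteq> j \<Longrightarrow> cycles_ok b zb B ZB c d C D"
  using ij nb cyc pair good nb2 cyc2 zb unfolding ok_defs by (smt (verit))

end

end

end

context
  fixes i j a I A :: int and fi :: bool and zj za ZJ ZA :: int
  assumes ij: "i < j" "a \<noteq> j" and nb: "i < a \<Longrightarrow> a < j \<Longrightarrow> A < I"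
    and cyc: "cycle_ok i a I A"
    and f: "fi = (i \<le> a \<and> a < j)"
    and zj: "zj = (if fi then j else a)" "ZJ = (if zj = j then I else A)"
    and za: "a \<noteq> i \<Longrightarrow> za = (if i < a \<and> a < j then a else j)" "a \<noteq> i \<Longrightarrow> ZA = (if za = j then I else A)"
begin

text \<open>When the blocks of the two points differ, the block of \<open>i\<close> can be treated
  alone: \<open>j\<close> takes over the image of \<open>i\<close> and joins that block.
  \<open>swap_right_inner\<close> is the mirror image for the block of \<open>j\<close>.\<close>

lemma swap_left_inner:
  shows "cycle_ok j zj I ZJ" "a \<noteq> i \<Longrightarrow> cycle_ok a za A ZA"
    "a \<noteq> i \<Longrightarrow> a \<noteq> zj \<Longrightarrow> cycles_ok j zj I ZJ a za A ZA"
  using ij nb cyc f zj za unfolding ok_defs by (smt (verit))+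

lemma swap_left_outer:
  assumes "c \<noteq> j" "d \<noteq> j" "i < c \<Longrightarrow> c < j \<Longrightarrow> C < I" "i < d \<Longrightarrow> d < j \<Longrightarrow> D < I"
    and "cycle_ok c d C D" "cycles_ok i a I A c d C D"
  shows "cycles_ok j zj I ZJ c d C D" "a \<noteq> i \<Longrightarrow> cycles_ok a za A ZA c d C D"
  using ij nb cyc f zj za assms unfolding ok_defs by (smt (verit))+

end

context
  fixes i j b J B :: int and fj :: bool and zi zb ZI ZB :: int
  assumes ij: "i < j" "b \<noteq> i" and nb: "i < b \<Longrightarrow> b < j \<Longrightarrow> J < B"
    and cyc: "cycle_ok j b J B"
    and f: "fj = (i < b \<and> b \<le> j)"
    and zi: "zi = (if fj then i else b)" "ZI = (if zi = i then J else B)"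
    and zb: "b \<noteq> j \<Longrightarrow> zb = (if i < b \<and> b < j then b else i)" "b \<noteq> j \<Longrightarrow> ZB = (if zb = i then J else B)"
begin

lemma swap_right_inner:
  shows "cycle_ok i zi J ZI" "b \<noteq> j \<Longrightarrow> cycle_ok b zb B ZB"
    "b \<noteq> j \<Longrightarrow> b \<noteq> zi \<Longrightarrow> cycles_ok i zi J ZI b zb B ZB"
  using ij nb cyc f zi zb unfolding ok_defs by (smt (verit))+

lemma swap_right_outer:
  assumes "c \<noteq> i" "d \<noteq> i" "i < c \<Longrightarrow> c < j \<Longrightarrow> J < C" "i < d \<Longrightarrow> d < j \<Longrightarrow> J < D"
    and "cycle_ok c d C D" "cycles_ok j b J B c d C D"
  shows "cycles_ok i zi J ZI c d C D" "b \<noteq> j \<Longrightarrow> cycles_ok b zb B ZB c d C D"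
  using ij nb cyc f zi zb assms unfolding ok_defs by (smt (verit))+

end

text \<open>If \<open>a < b\<close>, then both ends of the cycle of \<open>i\<close> are smaller
  than the corresponding ends of the cycle of \<open>i + 1\<close>. The last clauses of
  \<open>compat\<close> then put the smaller end of the former before the larger end of the latter.
  As larger ends come first, \<open>I < J\<close> would follow.\<close>

lemma descent_partners:
  assumes "cycles_ok i a I A (i + 1) b J B" "J < I" "cycle_ok i a I A" "cycle_ok (i + 1) b J B"
  shows "b < a"
  using assms unfolding ok_defs by (smt (verit))

lemma lower_pair:
  fixes i a b I J A B zi zj ZI ZJ :: int
  assumes desc: "J < I" "b < a" and neq: "a \<noteq> i + 1"
    and cyc: "cycle_ok i a I A" "cycle_ok (i + 1) b J B"
    and pair: "cycles_ok i a I A (i + 1) b J B"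
    and zi: "zi = (if b = i + 1 then i else b)" "ZI = (if zi = i then J else B)"
    and zj: "zj = (if a = i then i + 1 else a)" "ZJ = (if zj = i + 1 then I else A)"
  shows "cycles_ok i zi J ZI (i + 1) zj I ZJ"
  using assms unfolding ok_defs by (smt (verit))

lemma lower_cycle:
  assumes "J < I" "cycle_ok c d C D" "cycles_ok i (i + 1) I J c d C D"
  shows "cycles_ok i i J J c d C D" "cycles_ok (i + 1) (i + 1) I I c d C D"
  using assms unfolding ok_defs by (smt (verit))+

text \<open>Two distinct cycles can have an inverted pair of points only if a partner of one of the
  points stands strictly between them. At adjacent positions there is no room for it, so an inverted
  adjacent pair must be a 2-cycle; this is how \<open>atom_for_adjacent\<close> uses it.\<close>

lemma adjacent_inversion:
  assumes "q < p" "P < Q" "cycle_ok p p' P P'" "cycle_ok q q' Q Q'" "cycles_ok p p' P P' q q' Q Q'"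
    "\<not> (P < P' \<and> P' < Q)" "\<not> (P < Q' \<and> Q' < Q)"
  shows False
  using assms unfolding ok_defs by (smt (verit))

context
  fixes a u c v P V V' :: int
  assumes au: "a < u" "u < c"
    and cyc: "cycle_ok u v P V" and pair: "cycles_ok u v P V a c (P + 2) (P + 1)"
    and v: "V' = (if v = u then P + 2 else V)"
begin

lemma rotate_inner:
  shows "cycle_ok u v (P + 2) V'" "cycles_ok u v (P + 2) V' a c (P + 1) P"
  using au cyc pair v unfolding ok_defs by (smt (verit))+

lemma rotate_outer:
  assumes "C \<notin> {P, P + 1, P + 2}" "D \<notin> {P, P + 1, P + 2}" "cycle_ok x y C D"
    "cycles_ok u v P V x y C D" "cycles_ok a c (P + 2) (P + 1) x y C D"
  shows "cycles_ok u v (P + 2) V' x y C D" "cycles_ok a c (P + 1) P x y C D"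
  using au cyc pair v assms unfolding ok_defs by (smt (verit) insert_iff)+

end

section \<open>Atoms of a pair \<open>(\<beta>, y)\<close>\<close>

definition cyc_at :: "(nat \<Rightarrow> nat) \<Rightarrow> (nat \<Rightarrow> nat) \<Rightarrow> nat \<Rightarrow> bool" where
  "cyc_at y w u \<longleftrightarrow> cycle_ok (int u) (int (y u)) (int (w u)) (int (w (y u)))"

definition cyc_pair :: "(nat \<Rightarrow> nat) \<Rightarrow> (nat \<Rightarrow> nat) \<Rightarrow> nat \<Rightarrow> nat \<Rightarrow> bool" where
  "cyc_pair y w u v \<longleftrightarrow>
     cycles_ok (int u) (int (y u)) (int (w u)) (int (w (y u)))
       (int v) (int (y v)) (int (w v)) (int (w (y v)))"

text \<open>The map \<open>bl\<close> sends a position to its block; later it is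
  \<open>blk \<mu>\<close>, and the local arguments only know that it is monotone. All quantifiers
  range over every natural number, which spares range conditions throughout; outside
  \<open>{1..n}\<close> the maps involved are the identity.\<close>

definition atom_for ::
    "(nat \<Rightarrow> nat) \<Rightarrow> (nat \<Rightarrow> nat) \<Rightarrow> (nat \<Rightarrow> nat) \<Rightarrow> (nat \<Rightarrow> nat) \<Rightarrow> bool" where
  "atom_for bl \<beta> y w \<longleftrightarrow>
     (\<forall>v. bl (w v) = \<beta> v) \<and> (\<forall>u. cyc_at y w u) \<and>
     (\<forall>u v. \<beta> u = \<beta> v \<longrightarrow> v \<noteq> u \<longrightarrow> v \<noteq> y u \<longrightarrow> cyc_pair y w u v)"

definition partner_map :: "(nat \<Rightarrow> nat) \<Rightarrow> (nat \<Rightarrow> nat) \<Rightarrow> bool" where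
  "partner_map \<beta> y \<longleftrightarrow> (\<forall>v. y (y v) = v) \<and> (\<forall>v. \<beta> (y v) = \<beta> v)"

lemma atom_forD:
  assumes "atom_for bl \<beta> y w"
  shows "bl (w v) = \<beta> v" "cyc_at y w u"
    "\<beta> u = \<beta> v \<Longrightarrow> v \<noteq> u \<Longrightarrow> v \<noteq> y u \<Longrightarrow> cyc_pair y w u v"
  using assms by (auto simp: atom_for_def)

lemma partner_mapD:
  assumes "partner_map \<beta> y"
  shows "y (y v) = v" "\<beta> (y v) = \<beta> v" "y u = y v \<longleftrightarrow> u = v"
  using assms by (auto simp: partner_map_def) metis

lemma cyc_pair_sym: "cyc_pair y w u v \<Longrightarrow> cyc_pair y w v u"
  by (simp add: cyc_pair_def cycles_ok_sym)

text \<open>Pairs of cycles outside the closed set \<open>S\<close> inherit their conditions, and by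
  symmetry a mixed pair is checked only with its first member in \<open>S\<close>.\<close>

lemma atom_for_update:
  assumes at: "atom_for bl \<beta> y w" and yy: "\<And>v. y (y v) = v"
    and out: "\<And>u. u \<notin> S \<Longrightarrow> z u = y u" "\<And>u. u \<notin> S \<Longrightarrow> w' u = w u" "\<And>u. u \<notin> S \<Longrightarrow> \<beta>' u = \<beta> u"
    and clos: "\<And>u. u \<in> S \<Longrightarrow> y u \<in> S" "\<And>u. u \<in> S \<Longrightarrow> z (z u) = u"
    and bl: "\<And>u. u \<in> S \<Longrightarrow> bl (w' u) = \<beta>' u"
    and self: "\<And>u. u \<in> S \<Longrightarrow> cyc_at z w' u"
    and inner: "\<And>u v. u \<in> S \<Longrightarrow> v \<in> S \<Longrightarrow> \<beta>' u = \<beta>' v \<Longrightarrow> v \<noteq> u \<Longrightarrow> v \<noteq> z u \<Longrightarrow> cyc_pair z w' u v"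
    and outer: "\<And>u v. u \<in> S \<Longrightarrow> v \<notin> S \<Longrightarrow> y v \<notin> S \<Longrightarrow> \<beta>' u = \<beta> v \<Longrightarrow>
       cycles_ok (int u) (int (z u)) (int (w' u)) (int (w' (z u))) (int v) (int (y v)) (int (w v)) (int (w (y v)))"
  shows "atom_for bl \<beta>' z w'"
proof -
  have y: "y u \<notin> S" if "u \<notin> S" for u
    using clos(1)[of "y u"] yy[of u] that by auto
  have o: "cyc_pair z w' u v" if "u \<in> S" "v \<notin> S" "\<beta>' u = \<beta>' v" for u v
    using outer[OF that(1,2)] that y[of v] out by (simp add: cyc_pair_def)
  show ?thesis
    unfolding atom_for_def
  proof (intro conjI allI impI)
    fix v show "bl (w' v) = \<beta>' v"
      using bl out atom_forD(1)[OF at] by (cases "v \<in> S") auto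
  next
    fix u show "cyc_at z w' u"
      using self[of u] atom_forD(2)[OF at, of u] y[of u] out by (cases "u \<in> S") (auto simp: cyc_at_def)
  next
    fix u v assume *: "\<beta>' u = \<beta>' v" "v \<noteq> u" "v \<noteq> z u"
    show "cyc_pair z w' u v"
    proof (cases "u \<in> S"; cases "v \<in> S")
      assume "u \<notin> S" "v \<notin> S"
      then show ?thesis
        using atom_forD(3)[OF at, of u v] * y[of u] y[of v] out by (auto simp: cyc_pair_def)
    next
      assume "u \<notin> S" "v \<in> S"
      then show ?thesis using o[of v u] * cyc_pair_sym by metis
    qed (use inner o * in auto)
  qed
qed

text \<open>The involution that belongs to \<open>w \<circ> transpose i j\<close> when this permutation covers an atom \<open>w\<close>
  of \<open>y\<close>; \<open>same\<close> tells whether \<open>i\<close> and \<open>j\<close> are in the same block. It does not depend on \<open>w\<close>.\<close>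

definition swap_partner :: "bool \<Rightarrow> (nat \<Rightarrow> nat) \<Rightarrow> nat \<Rightarrow> nat \<Rightarrow> nat \<Rightarrow> nat" where
  "swap_partner same y i j = (\<lambda>v.
     let a = y i; b = y j; fi = (i \<le> a \<and> a < j); fj = (i < b \<and> b \<le> j) in
     if v = i then (if same \<and> fi \<and> fj then j else if fj then i else b)
     else if v = j then (if same \<and> fi \<and> fj then i else if fi then j else a)
     else if v = a then (if i < a \<and> a < j then (if same \<and> i < b \<and> b < a then b else a) else j)
     else if v = b then (if i < b \<and> b < j then (if same \<and> b < a \<and> a < j then a else b) else i)
     else y v)"

section \<open>Bruhat covers of an atom\<close>

lemma block_mono_less:
  assumes "mono (bl :: nat \<Rightarrow> nat)" "bl p < bl q" shows "p < q"
  using assms by (metis leD monoE not_le_imp_less)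

lemma between_blocks:
  assumes "mono (bl :: nat \<Rightarrow> nat)" "p \<le> q" "q \<le> r" "bl p = bl r" shows "bl q = bl r"
  using assms by (metis antisym monoE)

lemma atom_for_swap_same:
  assumes bl: "mono bl" and y: "partner_map \<beta> y" and w: "inj w" and at: "atom_for bl \<beta> y w"
    and ij: "i < j" "w i < w j" and cov: "\<And>v. i < v \<Longrightarrow> v < j \<Longrightarrow> \<not> (w i < w v \<and> w v < w j)"
    and same: "\<beta> i = \<beta> j" and good: "\<not> (j < y i \<and> y j < y i)" "\<not> (y j < i \<and> y j < y i)"
  shows "atom_for bl \<beta> (swap_partner True y i j) (w \<circ> transpose i j)"
    "partner_map \<beta> (swap_partner True y i j)"
proof -
  define z where "z = swap_partner True y i j"
  define w' where "w' = w \<circ> transpose i j"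
  define a where "a = y i"
  define b where "b = y j"
  note D = atom_forD[OF at] and Y = partner_mapD[OF y]
  have ya: "y a = i" "y b = j" "\<beta> a = \<beta> i" "\<beta> b = \<beta> j" using Y by (auto simp: a_def b_def)
  \<comment> \<open>Partners \<open>i < j\<close> would satisfy \<open>w j < w i\<close>, since the
    larger point of a cycle comes first.\<close>
  have "a \<noteq> j"
  proof
    assume "a = j"
    then show False using D(2)[of i] ij by (simp add: cyc_at_def cycle_ok_def a_def)
  qed
  then have aj: "a \<noteq> j" "b \<noteq> i" "a \<noteq> b" using ya ij Y(3)[of i j] by (auto simp: a_def b_def)
  have zz: "z i = (if (i \<le> a \<and> a < j) \<and> (i < b \<and> b \<le> j) then j else if i < b \<and> b \<le> j then i else b)"
    "z j = (if (i \<le> a \<and> a < j) \<and> (i < b \<and> b \<le> j) then i else if i \<le> a \<and> a < j then j else a)"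
    "a \<noteq> i \<Longrightarrow> z a = (if i < a \<and> a < j then (if i < b \<and> b < a then b else a) else j)"
    "b \<noteq> j \<Longrightarrow> z b = (if i < b \<and> b < j then (if b < a \<and> a < j then a else b) else i)"
    "u \<notin> {i, j, a, b} \<Longrightarrow> z u = y u" for u
    using ij aj by (auto simp: z_def swap_partner_def Let_def a_def b_def)
  have w': "w' i = w j" "w' j = w i" "u \<notin> {i, j} \<Longrightarrow> w' u = w u" for u
    using ij by (auto simp: w'_def)
  have wab: "a \<noteq> i \<Longrightarrow> w' a = w a" "b \<noteq> j \<Longrightarrow> w' b = w b"
    using w'(3) aj by auto
  have nb: "not_between (int i) (int j) (int (w i)) (int (w j)) (int x) (int (w x))" for x
    using cov by (simp add: not_between_def)
  have cyc: "cycle_ok (int i) (int a) (int (w i)) (int (w a))" "cycle_ok (int j) (int b) (int (w j)) (int (w b))"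
    using D(2)[of i] D(2)[of j] by (auto simp: cyc_at_def a_def b_def)
  have pair: "cycles_ok (int i) (int a) (int (w i)) (int (w a)) (int j) (int b) (int (w j)) (int (w b))"
    using D(3)[of i j] same aj ij by (auto simp: cyc_pair_def a_def b_def)
  have g: "\<not> (int j < int a \<and> int b < int a)" "\<not> (int b < int i \<and> int b < int a)"
    using good by (auto simp: a_def b_def)
  have zin: "z i \<in> {i, j, b}" "z j \<in> {i, j, a}" "a \<noteq> i \<Longrightarrow> z a \<in> {a, b, j}" "b \<noteq> j \<Longrightarrow> z b \<in> {a, b, i}"
    subgoal unfolding zz(1) by auto
    subgoal unfolding zz(2) by auto
    subgoal using zz(3) by auto
    subgoal using zz(4) by auto
    done
  have eq1: "int (z i) = (if (int i \<le> int a \<and> int a < int j) \<and> (int i < int b \<and> int b \<le> int j) then int j else if int i < int b \<and> int b \<le> int j then int i else int b)"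
    unfolding zz(1) by auto
  have eq2: "int (w' (z i)) = (if int (z i) = int j then int (w i) else if int (z i) = int i then int (w j) else int (w b))"
    using zin(1) w'(1,2) wab(2) by auto
  have eq3: "int (z j) = (if (int i \<le> int a \<and> int a < int j) \<and> (int i < int b \<and> int b \<le> int j) then int i else if int i \<le> int a \<and> int a < int j then int j else int a)"
    unfolding zz(2) by auto
  have eq4: "int (w' (z j)) = (if int (z j) = int j then int (w i) else if int (z j) = int i then int (w j) else int (w a))"
    using zin(2) w'(1,2) wab(1) by auto
  have eq5: "int (z a) = (if int i < int a \<and> int a < int j then (if int i < int b \<and> int b < int a then int b else int a) else int j)"
    if "int a \<noteq> int i" using zz(3) that by simp
  have eq6: "int (w' (z a)) = (if int (z a) = int j then int (w i) else if int (z a) = int a then int (w a) else int (w b))"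
    if "int a \<noteq> int i" using zin(3) w'(1,2) wab that aj by auto
  have eq7: "int (z b) = (if int i < int b \<and> int b < int j then (if int b < int a \<and> int a < int j then int a else int b) else int i)"
    if "int b \<noteq> int j" using zz(4) that by simp
  have eq8: "int (w' (z b)) = (if int (z b) = int i then int (w j) else if int (z b) = int a then int (w a) else int (w b))"
    if "int b \<noteq> int j" using zin(4) w'(1,2) wab that aj by auto
  note eqs = eq1 eq2 eq3 eq4 eq5 eq6 eq7 eq8
  have ijz: "int i < int j" "int (w i) < int (w j)" using ij by auto
  have zinv: "z (z i) = i" "z (z j) = j" "z (z a) = a" "z (z b) = b"
  proof -
    show i: "z (z i) = i"
    proof (cases "i < b \<and> b \<le> j")
      case True
      then show ?thesis using zz(1,2) by (cases "i \<le> a \<and> a < j") simp_all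
    next
      case False
      then have "b \<noteq> j" "\<not> (i < b \<and> b < j)" using ij by auto
      then have "z i = b" "z b = i" using False zz(1,4) by presburger+
      then show ?thesis by simp
    qed
    show j: "z (z j) = j"
    proof (cases "i \<le> a \<and> a < j")
      case True
      then show ?thesis using zz(1,2) by (cases "i < b \<and> b \<le> j") simp_all
    next
      case False
      then have "a \<noteq> i" "\<not> (i < a \<and> a < j)" using ij by auto
      then have "z j = a" "z a = j" using False zz(2,3) by presburger+
      then show ?thesis by simp
    qed
    show "z (z a) = a"
    proof (cases "i < a \<and> a < j")
      case True
      then have "a \<noteq> i" by simp
      show ?thesis
      proof (cases "i < b \<and> b < a")
        case b: True
        then have "b \<noteq> j" "b < j" using True by auto
        then show ?thesis using zz(3,4) \<open>a \<noteq> i\<close> True b by simp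
      next
        case False
        then have "z a = a" using zz(3) \<open>a \<noteq> i\<close> True by presburger
        then show ?thesis by simp
      qed
    next
      case False
      then have "z a = j \<and> z j = a" if "a \<noteq> i"
      proof -
        have n: "\<not> (i \<le> a \<and> a < j)" using False that by auto
        have "z j = a" by (simp only: zz(2) n simp_thms if_False)
        moreover have "z a = j" using zz(3)[OF that] False by (simp only: if_False)
        ultimately show ?thesis by simp
      qed
      then show ?thesis using i by (cases "a = i") simp_all
    qed
    show "z (z b) = b"
    proof (cases "i < b \<and> b < j")
      case True
      then have "b \<noteq> j" by simp
      show ?thesis
      proof (cases "b < a \<and> a < j")
        case a: True
        then have "a \<noteq> i" "i < a" using True by auto
        then show ?thesis using zz(3,4) \<open>b \<noteq> j\<close> True a by simp
      next
        case False
        then have "z b = b" using zz(4) \<open>b \<noteq> j\<close> True by presburger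
        then show ?thesis by simp
      qed
    next
      case False
      then have "z b = i \<and> z i = b" if "b \<noteq> j"
      proof -
        have n: "\<not> (i < b \<and> b \<le> j)" using False that by auto
        have "z i = b" by (simp only: zz(1) n simp_thms if_False)
        moreover have "z b = i" using zz(4)[OF that] False by (simp only: if_False)
        ultimately show ?thesis by simp
      qed
      then show ?thesis using j by (cases "b = j") simp_all
    qed
  qed
  \<comment> \<open>This list follows the assumptions of the contexts around
    \<open>swap_same_cycle\<close>; the two copies of \<open>refl\<close> instantiate
    \<open>fi\<close> and \<open>fj\<close> with their defining conditions.\<close>
  note P = ijz nb nb cyc pair g refl refl eqs
  have "atom_for bl \<beta> z w'"
  proof (rule atom_for_update[where S = "{i, j, a, b}", OF at Y(1)])
    fix u assume u: "u \<in> {i, j, a, b}"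
    show "y u \<in> {i, j, a, b}" using u ya by (auto simp: a_def b_def)
    show "z (z u) = u"
      using u zinv by blast
    show "bl (w' u) = \<beta> u"
      using u w' D(1) same by (cases "u = i"; cases "u = j") auto
    show "cyc_at z w' u"
      using u swap_same_cycle[OF P] w'(1,2) wab
      by (cases "a = i"; cases "b = j") (auto simp: cyc_at_def)
    fix v assume v: "v \<in> {i, j, a, b}" "v \<noteq> u" "v \<noteq> z u"
    note I = swap_same_inner[OF P]
    have I1: "cyc_pair z w' i j" if "j \<noteq> z i"
      unfolding cyc_pair_def w'(1,2) by (rule I(1)) (use that in simp_all)
    have I2: "cyc_pair z w' i a" if "a \<noteq> i" "a \<noteq> z i"
      unfolding cyc_pair_def w'(1) wab(1)[OF that(1)] by (rule I(2)) (use that in simp_all)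
    have I3: "cyc_pair z w' i b" if "b \<noteq> j" "b \<noteq> z i"
      unfolding cyc_pair_def w'(1) wab(2)[OF that(1)] by (rule I(3)) (use that in simp_all)
    have I4: "cyc_pair z w' j a" if "a \<noteq> i" "a \<noteq> z j"
      unfolding cyc_pair_def w'(2) wab(1)[OF that(1)] by (rule I(4)) (use that in simp_all)
    have I5: "cyc_pair z w' j b" if "b \<noteq> j" "b \<noteq> z j"
      unfolding cyc_pair_def w'(2) wab(2)[OF that(1)] by (rule I(5)) (use that in simp_all)
    have I6: "cyc_pair z w' a b" if "a \<noteq> i" "b \<noteq> j" "b \<noteq> z a"
      unfolding cyc_pair_def wab(1)[OF that(1)] wab(2)[OF that(2)] by (rule I(6)) (use that in simp_all)
    have v': "u \<noteq> z v" using v(3) zinv v(1) by auto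
    show "cyc_pair z w' u v"
      using u v v' I1 I2 I3 I4 I5 I6 cyc_pair_sym[of z w'] by (elim insertE emptyE) (simp_all, metis+)
  next
    fix u v assume u: "u \<in> {i, j, a, b}" and v: "v \<notin> {i, j, a, b}" "y v \<notin> {i, j, a, b}" "\<beta> u = \<beta> v"
    show "cycles_ok (int u) (int (z u)) (int (w' u)) (int (w' (z u))) (int v) (int (y v)) (int (w v)) (int (w (y v)))"
    proof -
      have nv: "cycle_ok (int v) (int (y v)) (int (w v)) (int (w (y v)))"
        using D(2)[of v] by (simp add: cyc_at_def)
      have bv: "\<beta> v = \<beta> i" using u v(3) same ya by auto
      have pi: "cycles_ok (int i) (int a) (int (w i)) (int (w a)) (int v) (int (y v)) (int (w v)) (int (w (y v)))"
        using D(3)[of i v] bv v by (simp add: cyc_pair_def a_def)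
      have pj: "cycles_ok (int j) (int b) (int (w j)) (int (w b)) (int v) (int (y v)) (int (w v)) (int (w (y v)))"
        using D(3)[of j v] bv same v by (simp add: cyc_pair_def b_def)
      note O = nb[of v] nb[of "y v"] nv pi pj
      show ?thesis
        using u swap_same_outer_i[OF P O] swap_same_outer_j[OF P O] swap_same_outer_a[OF P O]
          swap_same_outer_b[OF P O] w'(1,2) wab
        by (cases "a = i"; cases "b = j") auto
    qed
  qed (use zz w' in auto)
  then show "atom_for bl \<beta> (swap_partner True y i j) (w \<circ> transpose i j)"
    using same by (simp add: z_def w'_def)
  let ?S = "{i, j, a, b}"
  have yS: "y v \<in> ?S \<longleftrightarrow> v \<in> ?S" for v using ya Y(1)[of v] by (auto simp: a_def b_def)
  have "z (z v) = v \<and> \<beta> (z v) = \<beta> v" for v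
  proof (cases "v \<in> ?S")
    case True
    then have zz': "z (z v) = v" using zinv by blast
    have "z v \<in> ?S"
    proof (rule ccontr)
      assume n: "z v \<notin> ?S"
      then have "y (z v) = v" using zz' zz(5)[OF n] by simp
      then show False using n yS[of "z v"] True by simp
    qed
    moreover have "\<beta> x = \<beta> i" if "x \<in> ?S" for x using that same ya by auto
    ultimately have "\<beta> (z v) = \<beta> v" using True by metis
    then show ?thesis using zz' by simp
  next
    case False
    then have "y v \<notin> ?S" using yS by simp
    then show ?thesis using False zz(5) Y(1,2) by simp
  qed
  then show "partner_map \<beta> (swap_partner True y i j)" by (simp add: partner_map_def z_def)
qed

lemma cyc_at_partner: "z (z u) = u \<Longrightarrow> cyc_at z w u \<Longrightarrow> cyc_at z w (z u)"
  by (auto simp: cyc_at_def cycle_ok_def)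

lemma cyc_pair_partner: "z (z u) = u \<Longrightarrow> cyc_pair z w u v \<Longrightarrow> cyc_pair z w (z u) v"
  by (simp add: cyc_pair_def cycles_ok_swap)

text \<open>The cycles of \<open>i\<close> and \<open>j\<close> lie in different blocks and are
  never compared, so the two sides are independent and no configuration of the partners has to be
  excluded. The two letters exchange blocks, hence the new block map
  \<open>\<beta> \<circ> transpose i j\<close>.\<close>

lemma atom_for_swap_diff:
  assumes bl: "mono bl" and y: "partner_map \<beta> y" and w: "inj w" and at: "atom_for bl \<beta> y w"
    and ij: "i < j" "w i < w j" and cov: "\<And>v. i < v \<Longrightarrow> v < j \<Longrightarrow> \<not> (w i < w v \<and> w v < w j)"
    and diff: "\<beta> i \<noteq> \<beta> j"
  shows "atom_for bl (\<beta> \<circ> transpose i j) (swap_partner False y i j) (w \<circ> transpose i j)"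
    "partner_map (\<beta> \<circ> transpose i j) (swap_partner False y i j)"
proof -
  define z where "z = swap_partner False y i j"
  define w' where "w' = w \<circ> transpose i j"
  define \<beta>' where "\<beta>' = \<beta> \<circ> transpose i j"
  define a where "a = y i"
  define b where "b = y j"
  note D = atom_forD[OF at] and Y = partner_mapD[OF y]
  have wi: "w u = w v \<longleftrightarrow> u = v" for u v using w by (auto simp: inj_eq)
  have ya: "y a = i" "y b = j" "\<beta> a = \<beta> i" "\<beta> b = \<beta> j" using Y by (auto simp: a_def b_def)
  then have aj: "a \<noteq> j" "b \<noteq> i" "a \<noteq> b" using diff by auto
  have less: "\<beta> i < \<beta> j"
    using monoD[OF bl, of "w i" "w j"] ij(2) diff D(1) by simp
  have wl: "w u < w v" if "\<beta> u < \<beta> v" for u v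
    using block_mono_less[OF bl, of "w u" "w v"] that D(1) by simp
  have zz: "z i = (if i < b \<and> b \<le> j then i else b)" "z j = (if i \<le> a \<and> a < j then j else a)"
    "a \<noteq> i \<Longrightarrow> z a = (if i < a \<and> a < j then a else j)"
    "b \<noteq> j \<Longrightarrow> z b = (if i < b \<and> b < j then b else i)"
    "u \<notin> {i, j, a, b} \<Longrightarrow> z u = y u" for u
    using ij aj by (auto simp: z_def swap_partner_def Let_def a_def b_def)
  have w': "w' i = w j" "w' j = w i" "u \<notin> {i, j} \<Longrightarrow> w' u = w u"
    and b': "\<beta>' i = \<beta> j" "\<beta>' j = \<beta> i" "u \<notin> {i, j} \<Longrightarrow> \<beta>' u = \<beta> u" for u
    using ij by (auto simp: w'_def \<beta>'_def)
  have wab: "a \<noteq> i \<Longrightarrow> w' a = w a" "b \<noteq> j \<Longrightarrow> w' b = w b"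
    "a \<noteq> i \<Longrightarrow> \<beta>' a = \<beta> i" "b \<noteq> j \<Longrightarrow> \<beta>' b = \<beta> j"
    using w'(3) b'(3) aj ya by auto
  \<comment> \<open>A letter of the block of \<open>i\<close> stands before \<open>j\<close> anyway,
    so the cover condition becomes one-sided: such a letter of intermediate size must already stand
    before \<open>i\<close>.\<close>
  have nbi: "w u < w i" if "\<beta> u = \<beta> i" "i < u" "u < j" for u
    using cov[OF that(2,3)] wl[of u j] less that wi[of u i] by (metis linorder_neqE_nat nat_neq_iff)
  have nbj: "w j < w u" if "\<beta> u = \<beta> j" "i < u" "u < j" for u
    using cov[OF that(2,3)] wl[of i u] less that wi[of u j] by (metis linorder_neqE_nat nat_neq_iff)
  have cyc: "cycle_ok (int i) (int a) (int (w i)) (int (w a))" "cycle_ok (int j) (int b) (int (w j)) (int (w b))"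
    using D(2)[of i] D(2)[of j] by (auto simp: cyc_at_def a_def b_def)
  have eqj:
    "int (z j) = (if int i \<le> int a \<and> int a < int j then int j else int a)"
    "int (w' (z j)) = (if int (z j) = int j then int (w i) else int (w a))"
    "int a \<noteq> int i \<Longrightarrow> int (z a) = (if int i < int a \<and> int a < int j then int a else int j)"
    "int a \<noteq> int i \<Longrightarrow> int (w' (z a)) = (if int (z a) = int j then int (w i) else int (w a))"
    using zz(2,3) w' wab aj ij by auto
  have eqi:
    "int (z i) = (if int i < int b \<and> int b \<le> int j then int i else int b)"
    "int (w' (z i)) = (if int (z i) = int i then int (w j) else int (w b))"
    "int b \<noteq> int j \<Longrightarrow> int (z b) = (if int i < int b \<and> int b < int j then int b else int i)"
    "int b \<noteq> int j \<Longrightarrow> int (w' (z b)) = (if int (z b) = int i then int (w j) else int (w b))"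
    using zz(1,4) w' wab aj ij by auto
  have nbi': "int i < int u \<Longrightarrow> int u < int j \<Longrightarrow> int (w u) < int (w i)" if "\<beta> u = \<beta> i" for u
    using nbi that by simp
  have nbj': "int i < int u \<Longrightarrow> int u < int j \<Longrightarrow> int (w j) < int (w u)" if "\<beta> u = \<beta> j" for u
    using nbj that by simp
  have ijz: "int i < int j" "int a \<noteq> int j" "int b \<noteq> int i" using ij aj by auto
  note L = ijz(1,2) nbi'[OF ya(3)] cyc(1) refl eqj
  note R = ijz(1,3) nbj'[OF ya(4)] cyc(2) refl eqi
  have ziv: "z i = i \<or> z i = b \<and> b \<noteq> j \<and> z b = i"
  proof (cases "i < b \<and> b \<le> j")
    case True
    then show ?thesis unfolding zz(1) by simp
  next
    case False
    then have "b \<noteq> j" using ij by auto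
    moreover have "\<not> (i < b \<and> b < j)" using False by auto
    then have "z b = i" using zz(4)[OF calculation] by (simp only: if_False)
    ultimately show ?thesis using zz(1) False by presburger
  qed
  have zjv: "z j = j \<or> z j = a \<and> a \<noteq> i \<and> z a = j"
  proof (cases "i \<le> a \<and> a < j")
    case True
    then show ?thesis unfolding zz(2) by simp
  next
    case False
    then have "a \<noteq> i" using ij by auto
    moreover have "\<not> (i < a \<and> a < j)" using False by auto
    then have "z a = j" using zz(3)[OF calculation] by (simp only: if_False)
    ultimately show ?thesis using zz(2) False by presburger
  qed
  have zav: "a = i \<or> z a = a \<or> z j = a \<and> z a = j"
  proof (cases "a = i \<or> i < a \<and> a < j")
    case False
    then have "\<not> (i \<le> a \<and> a < j)" by auto
    then have "z j = a" using zz(2) by (simp only: if_False)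
    moreover have "z a = j" using zz(3) False by (simp only: if_False de_Morgan_disj simp_thms)
    ultimately show ?thesis by blast
  qed (use zz(3) in auto)
  have zbv: "b = j \<or> z b = b \<or> z i = b \<and> z b = i"
  proof (cases "b = j \<or> i < b \<and> b < j")
    case False
    then have "\<not> (i < b \<and> b \<le> j)" by auto
    then have "z i = b" using zz(1) by (simp only: if_False)
    moreover have "z b = i" using zz(4) False by (simp only: if_False de_Morgan_disj simp_thms)
    ultimately show ?thesis by blast
  qed (use zz(4) in auto)
  have zinv: "z (z i) = i" "z (z j) = j" "z (z a) = a" "z (z b) = b"
  proof -
    show i: "z (z i) = i" using ziv by (elim disjE conjE) simp_all
    show j: "z (z j) = j" using zjv by (elim disjE conjE) simp_all
    show "z (z a) = a" using zav i by (elim disjE conjE) simp_all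
    show "z (z b) = b" using zbv j by (elim disjE conjE) simp_all
  qed
  have cls: "(x = j \<or> x = a \<and> a \<noteq> i) \<and> \<beta>' x = \<beta> i \<or> (x = i \<or> x = b \<and> b \<noteq> j) \<and> \<beta>' x = \<beta> j"
    if "x \<in> {i, j, a, b}" for x
    using that b'(1,2) wab(3,4) by (cases "x = i"; cases "x = j"; cases "x = a") auto
  have "atom_for bl \<beta>' z w'"
  proof (rule atom_for_update[where S = "{i, j, a, b}", OF at Y(1)])
    fix u assume u: "u \<in> {i, j, a, b}"
    show "y u \<in> {i, j, a, b}" using u ya by (auto simp: a_def b_def)
    show "z (z u) = u"
      using u zinv by blast
    show "bl (w' u) = \<beta>' u"
      using u w' b' D(1) by (cases "u = i"; cases "u = j") auto
    show "cyc_at z w' u"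
      using u swap_left_inner[OF L] swap_right_inner[OF R] w'(1,2) wab
      by (cases "a = i"; cases "b = j") (auto simp: cyc_at_def)
    fix v assume v: "v \<in> {i, j, a, b}" "\<beta>' u = \<beta>' v" "v \<noteq> u" "v \<noteq> z u"
    have I1: "cyc_pair z w' j a" if "a \<noteq> i" "a \<noteq> z j"
      using swap_left_inner(3)[OF L] w'(2) wab(1)[OF that(1)] that by (simp add: cyc_pair_def)
    have I2: "cyc_pair z w' i b" if "b \<noteq> j" "b \<noteq> z i"
      using swap_right_inner(3)[OF R] w'(1) wab(2)[OF that(1)] that by (simp add: cyc_pair_def)
    have v': "u \<noteq> z v" using v(4) zinv v(1) by auto
    consider "u = j" "v = a" "a \<noteq> i" | "u = a" "v = j" "a \<noteq> i" | "u = i" "v = b" "b \<noteq> j" | "u = b" "v = i" "b \<noteq> j"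
      using cls[OF u] cls[OF v(1)] v(2,3) less by (elim disjE conjE) simp_all
    then show "cyc_pair z w' u v"
    proof cases
      case 1
      then show ?thesis using I1 v(4) by simp
    next
      case 2
      then show ?thesis using I1 v' cyc_pair_sym[of z w' j a] by simp
    next
      case 3
      then show ?thesis using I2 v(4) by simp
    next
      case 4
      then show ?thesis using I2 v' cyc_pair_sym[of z w' i b] by simp
    qed
  next
    fix u v assume u: "u \<in> {i, j, a, b}" and v: "v \<notin> {i, j, a, b}" "y v \<notin> {i, j, a, b}" "\<beta>' u = \<beta> v"
    show "cycles_ok (int u) (int (z u)) (int (w' u)) (int (w' (z u))) (int v) (int (y v)) (int (w v)) (int (w (y v)))"
    proof -
      have nv: "cycle_ok (int v) (int (y v)) (int (w v)) (int (w (y v)))"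
        using D(2)[of v] by (simp add: cyc_at_def)
      have "(u = j \<or> u = a \<and> a \<noteq> i) \<and> \<beta> v = \<beta> i \<or> (u = i \<or> u = b \<and> b \<noteq> j) \<and> \<beta> v = \<beta> j"
        using cls[OF u] v(3) by auto
      then show ?thesis
      proof (elim disjE conjE)
        assume bv: "\<beta> v = \<beta> i"
        have pi: "cycles_ok (int i) (int a) (int (w i)) (int (w a)) (int v) (int (y v)) (int (w v)) (int (w (y v)))"
          using D(3)[of i v] bv v by (simp add: cyc_pair_def a_def)
        have nn: "int v \<noteq> int j" "int (y v) \<noteq> int j" using v by auto
        have byv: "\<beta> (y v) = \<beta> i" using bv Y(2) by simp
        note O = swap_left_outer[OF L nn nbi'[OF bv] nbi'[OF byv] nv pi]
        show ?thesis if "u = j" using O(1) w' that by simp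
        show ?thesis if "u = a" "a \<noteq> i" using O(2) wab that by simp
      next
        assume bv: "\<beta> v = \<beta> j"
        have pj: "cycles_ok (int j) (int b) (int (w j)) (int (w b)) (int v) (int (y v)) (int (w v)) (int (w (y v)))"
          using D(3)[of j v] bv v by (simp add: cyc_pair_def b_def)
        have nn: "int v \<noteq> int i" "int (y v) \<noteq> int i" using v by auto
        have byv: "\<beta> (y v) = \<beta> j" using bv Y(2) by simp
        note O = swap_right_outer[OF R nn nbj'[OF bv] nbj'[OF byv] nv pj]
        show ?thesis if "u = i" using O(1) w' that by simp
        show ?thesis if "u = b" "b \<noteq> j" using O(2) wab that by simp
      qed
    qed
  next
    fix u assume u: "u \<notin> {i, j, a, b}"
    show "z u = y u" by (rule zz(5)[OF u])
  next
    fix u assume u: "u \<notin> {i, j, a, b}"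
    show "w' u = w u" by (rule w'(3)) (use u in simp)
  next
    fix u assume u: "u \<notin> {i, j, a, b}"
    show "\<beta>' u = \<beta> u" by (rule b'(3)) (use u in simp)
  qed
  then show "atom_for bl (\<beta> \<circ> transpose i j) (swap_partner False y i j) (w \<circ> transpose i j)"
    by (simp add: z_def w'_def \<beta>'_def)
  let ?S = "{i, j, a, b}"
  have yS: "y v \<in> ?S \<longleftrightarrow> v \<in> ?S" for v using ya Y(1)[of v] by (auto simp: a_def b_def)
  have b'i: "\<beta>' (z i) = \<beta>' i" "\<beta>' (z j) = \<beta>' j"
    subgoal using ziv b'(1) wab(4) by (elim disjE conjE) simp_all
    subgoal using zjv b'(2) wab(3) by (elim disjE conjE) simp_all
    done
  have b'a: "\<beta>' (z a) = \<beta>' a" "\<beta>' (z b) = \<beta>' b"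
    subgoal using zav b'i by (elim disjE conjE) simp_all
    subgoal using zbv b'i by (elim disjE conjE) simp_all
    done
  have "z (z v) = v \<and> \<beta>' (z v) = \<beta>' v" for v
  proof (cases "v \<in> ?S")
    case True
    then show ?thesis using zinv b'i b'a by blast
  next
    case False
    then have "y v \<notin> ?S" using yS by simp
    then show ?thesis using False zz(5) b'(3) Y(1,2) by simp
  qed
  then show "partner_map (\<beta> \<circ> transpose i j) (swap_partner False y i j)"
    by (simp only: partner_map_def z_def \<beta>'_def) simp
qed

section \<open>Adjacent letters: raising and lowering an atom\<close>

definition flip :: "(nat \<Rightarrow> nat) \<Rightarrow> (nat \<Rightarrow> nat) \<Rightarrow> nat \<Rightarrow> nat \<Rightarrow> nat" where
  "flip \<beta> y m =
     (if \<beta> m = \<beta> (Suc m) \<and> y m \<in> {m, Suc m} \<and> y (Suc m) \<in> {m, Suc m} then simple_refl m \<circ> y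
      else simple_refl m \<circ> y \<circ> simple_refl m)"

text \<open>For an encoded \<pi> this means that the letter \<open>m\<close> stands before
  \<open>Suc m\<close> in its one-line notation, see \<open>encodes_ascent\<close>.\<close>

definition ascent :: "(nat \<Rightarrow> nat) \<Rightarrow> (nat \<Rightarrow> nat) \<Rightarrow> nat \<Rightarrow> bool" where
  "ascent \<beta> y m \<longleftrightarrow> \<beta> m < \<beta> (Suc m) \<or> \<beta> m = \<beta> (Suc m) \<and> y m < y (Suc m)"

lemma swap_partner_adjacent:
  "swap_partner same y m (Suc m) v =
     (if v = m then (if same \<and> y m = m \<and> y (Suc m) = Suc m then Suc m else if y (Suc m) = Suc m then m else y (Suc m))
      else if v = Suc m then (if same \<and> y m = m \<and> y (Suc m) = Suc m then m else if y m = m then Suc m else y m)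
      else if v = y m then Suc m else if v = y (Suc m) then m else y v)"
proof -
  have "(m \<le> y m \<and> y m < Suc m) = (y m = m)" "(m < y (Suc m) \<and> y (Suc m) \<le> Suc m) = (y (Suc m) = Suc m)"
    "(m < y m \<and> y m < Suc m) = False" "(m < y (Suc m) \<and> y (Suc m) < Suc m) = False"
    by auto
  then show ?thesis
    unfolding swap_partner_def Let_def by presburger
qed

lemma swap_partner_flip:
  assumes y: "partner_map \<beta> y" and same: "same \<longleftrightarrow> \<beta> m = \<beta> (Suc m)" and ne: "y m \<noteq> Suc m"
  shows "swap_partner same y m (Suc m) = flip \<beta> y m"
proof
  fix v
  note Y = partner_mapD[OF y]
  have ne': "y (Suc m) \<noteq> m" using Y(1)[of "Suc m"] ne by auto
  have yv: "y v = m \<longleftrightarrow> v = y m" "y v = Suc m \<longleftrightarrow> v = y (Suc m)"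
    using Y(1)[of v] Y(1)[of m] Y(1)[of "Suc m"] by auto
  show "swap_partner same y m (Suc m) v = flip \<beta> y m v"
  proof (cases "same \<and> y m = m \<and> y (Suc m) = Suc m")
    case True
    then show ?thesis
      using same yv by (simp add: swap_partner_adjacent flip_def simple_refl_def transpose_def)
  next
    case False
    then have "flip \<beta> y m v = simple_refl m (y (simple_refl m v))"
      using same ne ne' by (auto simp: flip_def)
    then show ?thesis
      using False ne ne' yv Y(1)
      by (cases "v = m"; cases "v = Suc m") (auto simp add: swap_partner_adjacent simple_refl_def transpose_def)
  qed
qed

text \<open>This is the cover by a transposition of adjacent letters: no letter lies strictly
  between them, so the cover condition is vacuous, and an ascent excludes both bad
  configurations.\<close>

lemma atom_for_raise:
  assumes bl: "mono bl" and y: "partner_map \<beta> y" and w: "inj w" and at: "atom_for bl \<beta> y w"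
    and asc: "ascent \<beta> y m" "w m < w (Suc m)"
  shows "atom_for bl (\<beta> \<circ> simple_refl m) (flip \<beta> y m) (w \<circ> simple_refl m)"
proof -
  note Y = partner_mapD[OF y]
  have ne: "y m \<noteq> Suc m" using asc(1) Y(1,2)[of m] by (auto simp: ascent_def)
  show ?thesis
  proof (cases "\<beta> m = \<beta> (Suc m)")
    case True
    then have "\<beta> \<circ> transpose m (Suc m) = \<beta>" by (auto simp: transpose_def)
    moreover have "atom_for bl \<beta> (swap_partner True y m (Suc m)) (w \<circ> transpose m (Suc m))"
      by (rule atom_for_swap_same(1)[OF bl y w at]) (use True asc in \<open>auto simp: ascent_def\<close>)
    ultimately show ?thesis
      using swap_partner_flip[OF y, of True m] True ne by (simp add: simple_refl_def)
  next
    case False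
    have "atom_for bl (\<beta> \<circ> transpose m (Suc m)) (swap_partner False y m (Suc m)) (w \<circ> transpose m (Suc m))"
      by (rule atom_for_swap_diff(1)[OF bl y w at]) (use False asc in auto)
    then show ?thesis
      using swap_partner_flip[OF y, of False m] False ne by (simp add: simple_refl_def)
  qed
qed

lemma adjacent_swap_outer:
  fixes i a b I J A B c d C D z Z :: int
  assumes "c \<noteq> i" "d \<noteq> i" "c \<noteq> i + 1" "d \<noteq> i + 1"
  shows "b \<noteq> i \<Longrightarrow> cycle_ok (i + 1) b J B \<Longrightarrow> cycle_ok c d C D \<Longrightarrow> cycles_ok (i + 1) b J B c d C D \<Longrightarrow>
      z = (if b = i + 1 then i else b) \<Longrightarrow> Z = (if z = i then J else B) \<Longrightarrow> cycles_ok i z J Z c d C D"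
    "a \<noteq> i + 1 \<Longrightarrow> cycle_ok i a I A \<Longrightarrow> cycle_ok c d C D \<Longrightarrow> cycles_ok i a I A c d C D \<Longrightarrow>
      z = (if a = i then i + 1 else a) \<Longrightarrow> Z = (if z = i + 1 then I else A) \<Longrightarrow> cycles_ok (i + 1) z I Z c d C D"
  using assms unfolding ok_defs by (smt (verit))+

text \<open>The conditions do not change when a letter is replaced by its partner, so one
  representative in \<open>R\<close> of each new cycle is enough.\<close>

lemma atom_for_update_reps:
  assumes at: "atom_for bl \<beta> y w" and yy: "\<And>v. y (y v) = v" and zz: "\<And>v. z (z v) = v"
    and \<beta>z: "\<And>v. \<beta>' (z v) = \<beta>' v"
    and R: "\<And>u. u \<in> R \<Longrightarrow> y u \<in> R \<union> z ` R" "\<And>u. u \<in> R \<Longrightarrow> y (z u) \<in> R \<union> z ` R"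
    and out: "\<And>u. u \<notin> R \<union> z ` R \<Longrightarrow> z u = y u \<and> w' u = w u \<and> \<beta>' u = \<beta> u"
    and bl: "\<And>u. u \<in> R \<union> z ` R \<Longrightarrow> bl (w' u) = \<beta>' u"
    and self: "\<And>u. u \<in> R \<Longrightarrow> cyc_at z w' u"
    and inner: "\<And>u v. u \<in> R \<Longrightarrow> v \<in> R \<Longrightarrow> \<beta>' u = \<beta>' v \<Longrightarrow> v \<noteq> u \<Longrightarrow> v \<noteq> z u \<Longrightarrow> cyc_pair z w' u v"
    and outer: "\<And>u v. u \<in> R \<Longrightarrow> v \<notin> R \<union> z ` R \<Longrightarrow> y v \<notin> R \<union> z ` R \<Longrightarrow> \<beta>' u = \<beta> v \<Longrightarrow>
       cycles_ok (int u) (int (z u)) (int (w' u)) (int (w' (z u))) (int v) (int (y v)) (int (w v)) (int (w (y v)))"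
  shows "atom_for bl \<beta>' z w'"
proof (rule atom_for_update[where S = "R \<union> z ` R", OF at yy])
  fix u assume u: "u \<in> R \<union> z ` R"
  then obtain u0 where u0: "u0 \<in> R" "u = u0 \<or> u = z u0" by auto
  show "y u \<in> R \<union> z ` R" using u R by auto
  show "z (z u) = u" by (rule zz)
  show "bl (w' u) = \<beta>' u" by (rule bl[OF u])
  show "cyc_at z w' u" using u0(2) self[OF u0(1)] cyc_at_partner[of z, OF zz] by auto
  show "cyc_pair z w' u v" if v: "v \<in> R \<union> z ` R" "\<beta>' u = \<beta>' v" "v \<noteq> u" "v \<noteq> z u" for v
  proof -
    obtain v0 where v0: "v0 \<in> R" "v = v0 \<or> v = z v0" using v(1) by auto
    have "\<beta>' u0 = \<beta>' v0" using u0(2) v0(2) v(2) by (auto simp: \<beta>z)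
    then have "cyc_pair z w' u0 v0"
      using u0(2) v0(2) v(3,4) by (intro inner[OF u0(1) v0(1)]) (auto simp: zz)
    then have "cyc_pair z w' u v0" using u0(2) cyc_pair_partner[of z, OF zz] by auto
    then have "cyc_pair z w' v u" using v0(2) cyc_pair_partner[of z, OF zz] cyc_pair_sym by blast
    then show ?thesis by (rule cyc_pair_sym)
  qed
  show "cycles_ok (int u) (int (z u)) (int (w' u)) (int (w' (z u))) (int v) (int (y v)) (int (w v)) (int (w (y v)))"
    if v: "v \<notin> R \<union> z ` R" "y v \<notin> R \<union> z ` R" "\<beta>' u = \<beta> v" for v
  proof -
    have "\<beta>' u0 = \<beta> v" using u0(2) v(3) \<beta>z by auto
    from outer[OF u0(1) v(1,2) this] show ?thesis
      using u0(2) zz by (auto dest: cycles_ok_swap)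
  qed
next
  fix u assume "u \<notin> R \<union> z ` R"
  from out[OF this] show "z u = y u" "w' u = w u" "\<beta>' u = \<beta> u" by auto
qed

lemma simple_refl_simps [simp]:
  "simple_refl m m = Suc m" "simple_refl m (Suc m) = m" "simple_refl m (simple_refl m v) = v"
  by (simp_all add: simple_refl_def)

lemma simple_refl_other: "v \<noteq> m \<Longrightarrow> v \<noteq> Suc m \<Longrightarrow> simple_refl m v = v"
  by (simp add: simple_refl_def transpose_def)

lemma simple_refl_eq [simp]: "simple_refl m u = simple_refl m v \<longleftrightarrow> u = v"
  by (metis simple_refl_simps(3))

lemma simple_refl_comp [simp]: "simple_refl m \<circ> simple_refl m = id"
  "simple_refl m \<circ> (simple_refl m \<circ> f) = f" "f \<circ> simple_refl m \<circ> simple_refl m = f"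
  by (auto simp: fun_eq_iff)

lemma flip_cases [consumes 1]:
  assumes "partner_map \<beta> y"
  obtains (toggle) "\<beta> m = \<beta> (Suc m)" "y m \<in> {m, Suc m}" "y (Suc m) \<in> {m, Suc m}" "y (Suc m) = simple_refl m (y m)"
      "flip \<beta> y m = simple_refl m \<circ> y"
  | (conj) "\<not> (\<beta> m = \<beta> (Suc m) \<and> y m \<in> {m, Suc m} \<and> y (Suc m) \<in> {m, Suc m})"
      "y m \<noteq> Suc m" "y (Suc m) \<noteq> m" "flip \<beta> y m = simple_refl m \<circ> y \<circ> simple_refl m"
proof (cases "\<beta> m = \<beta> (Suc m) \<and> y m \<in> {m, Suc m} \<and> y (Suc m) \<in> {m, Suc m}")
  case True
  note Y = partner_mapD[OF assms]
  have "y (Suc m) = simple_refl m (y m)"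
    using True Y(3)[of m "Suc m"] by auto
  then show ?thesis using True toggle by (simp add: flip_def)
next
  case False
  note Y = partner_mapD[OF assms]
  have "y m \<noteq> Suc m"
  proof
    assume *: "y m = Suc m"
    then have "y (Suc m) = m" "\<beta> m = \<beta> (Suc m)" using Y(1,2)[of m] by auto
    then show False using False * by auto
  qed
  moreover from this have "y (Suc m) \<noteq> m" using Y(1)[of "Suc m"] by auto
  ultimately show ?thesis using False conj by (auto simp: flip_def)
qed

lemma toggle_commute:
  assumes "y m \<in> {m, Suc m}" "y (Suc m) = simple_refl m (y m)" "\<And>v. y (y v) = v"
  shows "y (simple_refl m v) = simple_refl m (y v)"
proof (cases "v \<in> {m, Suc m}")
  case False
  then have "y v \<notin> {m, Suc m}" using assms by (metis insert_iff singletonD simple_refl_simps(1,2))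
  then show ?thesis using False by (simp add: simple_refl_other)
qed (use assms in auto)

lemma partner_map_flip:
  assumes "partner_map \<beta> y"
  shows "partner_map (\<beta> \<circ> simple_refl m) (flip \<beta> y m)"
using assms
proof (cases rule: flip_cases[where m = m])
  case toggle
  note Y = partner_mapD[OF assms]
  have "\<beta> (simple_refl m v) = \<beta> v" for v
    using toggle(1) by (cases "v = m"; cases "v = Suc m") (auto simp: simple_refl_other)
  then show ?thesis
    using toggle_commute[OF toggle(2,4) Y(1)] Y(1,2) by (simp add: partner_map_def toggle(5))
next
  case conj
  then show ?thesis using partner_mapD[OF assms] by (simp add: partner_map_def)
qed

text \<open>Multiplication by the reflection toggles between two fixed points and a 2-cycle;
  otherwise the involution is conjugated. The result falls under the same branch again, so one
  formula describes both a step up and its reversal.\<close>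

lemma flip_flip:
  assumes "partner_map \<beta> y"
  shows "flip (\<beta> \<circ> simple_refl m) (flip \<beta> y m) m = y"
using assms
proof (cases rule: flip_cases[where m = m])
  case toggle
  then have "flip \<beta> y m m \<in> {m, Suc m}" "flip \<beta> y m (Suc m) \<in> {m, Suc m}" by auto
  then show ?thesis using toggle by (auto simp: flip_def fun_eq_iff)
next
  case conj
  have "\<not> (\<beta> m = \<beta> (Suc m) \<and> flip \<beta> y m m \<in> {m, Suc m} \<and> flip \<beta> y m (Suc m) \<in> {m, Suc m})"
  proof
    assume *: "\<beta> m = \<beta> (Suc m) \<and> flip \<beta> y m m \<in> {m, Suc m} \<and> flip \<beta> y m (Suc m) \<in> {m, Suc m}"
    then have "y m \<in> {m, Suc m} \<and> y (Suc m) \<in> {m, Suc m}"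
      using conj(4) by (auto simp: simple_refl_def transpose_def split: if_splits)
    then show False using conj(1) * by blast
  qed
  then have "flip (\<beta> \<circ> simple_refl m) (flip \<beta> y m) m = simple_refl m \<circ> flip \<beta> y m \<circ> simple_refl m"
    by (auto simp: flip_def)
  also have "\<dots> = y" unfolding conj(4) by (simp add: fun_eq_iff)
  finally show ?thesis .
qed

lemma ascent_flip:
  assumes "partner_map \<beta> y"
  shows "ascent (\<beta> \<circ> simple_refl m) (flip \<beta> y m) m \<longleftrightarrow> \<not> ascent \<beta> y m"
using assms
proof (cases rule: flip_cases[where m = m])
  case toggle
  then show ?thesis by (auto simp: ascent_def)
next
  case conj
  note Y = partner_mapD[OF assms]
  have "y m \<noteq> y (Suc m)" using Y(3) by simp
  moreover have "\<beta> m = \<beta> (Suc m) \<Longrightarrow> simple_refl m (y m) < simple_refl m (y (Suc m)) \<longleftrightarrow> y m < y (Suc m)"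
  proof -
    assume "\<beta> m = \<beta> (Suc m)"
    then have "y m \<notin> {m, Suc m} \<or> y (Suc m) \<notin> {m, Suc m}" using conj(1) by blast
    then show ?thesis using conj(2,3) \<open>y m \<noteq> y (Suc m)\<close>
      by (cases "y m = m"; cases "y (Suc m) = Suc m") (auto simp: simple_refl_other)
  qed
  ultimately show ?thesis
    unfolding ascent_def conj(4) by (cases "\<beta> m = \<beta> (Suc m)") (auto simp: not_less less_le)
qed

text \<open>Between blocks this is the monotonicity of \<open>bl\<close>, inside a block it is
  \<open>descent_partners\<close>. Read contrapositively, an ascent of the involution is an ascent
  of each of its atoms, so the action never raises the involution without raising the atom.\<close>

lemma atom_for_descent:
  assumes bl: "mono bl" and y: "partner_map \<beta> y" and at: "atom_for bl \<beta> y w"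
    and desc: "w (Suc m) < w m"
  shows "\<not> ascent \<beta> y m"
proof
  assume asc: "ascent \<beta> y m"
  note D = atom_forD[OF at] and Y = partner_mapD[OF y]
  have "\<beta> (Suc m) \<le> \<beta> m" using monoD[OF bl, of "w (Suc m)" "w m"] desc D(1) by simp
  then have b: "\<beta> m = \<beta> (Suc m)" "y m < y (Suc m)" using asc by (auto simp: ascent_def)
  then have ne: "Suc m \<noteq> y m" using Y(1)[of m] by auto
  show False
    using descent_partners[of "int m" "int (y m)" "int (w m)" "int (w (y m))" "int (y (Suc m))" "int (w (Suc m))" "int (w (y (Suc m)))"]
      D(2)[of m] D(2)[of "Suc m"] D(3)[of m "Suc m"] b ne desc
    by (auto simp: cyc_at_def cyc_pair_def add.commute)
qed

text \<open>By \<open>atom_for_descent\<close> the pair \<open>(\<beta>, y)\<close> descends at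
  \<open>m\<close> as well, so in the toggle case the letters \<open>m\<close> and
  \<open>Suc m\<close> form a 2-cycle, which splits into two fixed points. This allows induction on
  the last letter of a reduced word of an atom.\<close>

lemma atom_for_lower:
  assumes bl: "mono bl" and y: "partner_map \<beta> y" and at: "atom_for bl \<beta> y w"
    and desc: "w (Suc m) < w m"
  shows "atom_for bl (\<beta> \<circ> simple_refl m) (flip \<beta> y m) (w \<circ> simple_refl m)"
proof -
  define z where "z = flip \<beta> y m"
  define w' where "w' = w \<circ> simple_refl m"
  define \<beta>' where "\<beta>' = \<beta> \<circ> simple_refl m"
  note D = atom_forD[OF at] and Y = partner_mapD[OF y]
  have Z: "z (z v) = v" "\<beta>' (z v) = \<beta>' v" for v
    using partner_mapD[OF partner_map_flip[OF y, of m]] by (auto simp: z_def \<beta>'_def)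
  have bw: "bl (w' v) = \<beta>' v" for v using D(1) by (simp add: w'_def \<beta>'_def)
  have w': "w' m = w (Suc m)" "w' (Suc m) = w m" "v \<noteq> m \<Longrightarrow> v \<noteq> Suc m \<Longrightarrow> w' v = w v"
    and b': "\<beta>' m = \<beta> (Suc m)" "\<beta>' (Suc m) = \<beta> m" "v \<noteq> m \<Longrightarrow> v \<noteq> Suc m \<Longrightarrow> \<beta>' v = \<beta> v" for v
    by (auto simp: w'_def \<beta>'_def simple_refl_other)
  have cv: "cycle_ok (int v) (int (y v)) (int (w v)) (int (w (y v)))" for v
    using D(2)[of v] by (simp add: cyc_at_def)
  have pv: "\<beta> u = \<beta> v \<Longrightarrow> v \<noteq> u \<Longrightarrow> v \<noteq> y u \<Longrightarrow>
      cycles_ok (int u) (int (y u)) (int (w u)) (int (w (y u))) (int v) (int (y v)) (int (w v)) (int (w (y v)))" for u v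
    using D(3)[of u v] by (simp add: cyc_pair_def)
  have nasc: "\<not> ascent \<beta> y m" by (rule atom_for_descent[OF bl y at desc])
  have "atom_for bl \<beta>' z w'"
    using y
  proof (cases rule: flip_cases[where m = m])
    case toggle
    then have ym: "y m = Suc m" "y (Suc m) = m" using nasc by (auto simp: ascent_def)
    have z: "z m = m" "z (Suc m) = Suc m"
      using toggle(5) ym by (simp_all add: z_def)
    have z3: "z v = y v" if "v \<noteq> m" "v \<noteq> Suc m" for v
    proof -
      have "y v \<noteq> m" "y v \<noteq> Suc m" using that ym Y(1)[of v] by auto
      then show ?thesis using toggle(5) by (simp add: z_def simple_refl_other)
    qed
    have J: "int (w (Suc m)) < int (w m)" using desc by simp
    show ?thesis
    proof (rule atom_for_update_reps[where R = "{m, Suc m}" and z = z and \<beta>' = \<beta>', OF at Y(1) Z])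
      fix u v assume u: "u \<in> {m, Suc m}" and v: "v \<notin> {m, Suc m} \<union> z ` {m, Suc m}" "\<beta>' u = \<beta> v"
      have p: "cycles_ok (int m) (int m + 1) (int (w m)) (int (w (Suc m))) (int v) (int (y v)) (int (w v)) (int (w (y v)))"
        using pv[of m v] v u b' toggle(1) ym by (auto simp: add.commute)
      show "cycles_ok (int u) (int (z u)) (int (w' u)) (int (w' (z u))) (int v) (int (y v)) (int (w v)) (int (w (y v)))"
        using lower_cycle(1,2)[OF J cv p] u z w' by (auto simp: add.commute)
    next
      fix u v assume "u \<in> {m, Suc m}" "v \<in> {m, Suc m}" "v \<noteq> u"
      then show "cyc_pair z w' u v"
        using desc by (auto simp: cyc_pair_def z w' ok_defs)
    next
      fix u assume "u \<in> {m, Suc m}"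
      then show "y u \<in> {m, Suc m} \<union> z ` {m, Suc m}" "y (z u) \<in> {m, Suc m} \<union> z ` {m, Suc m}" "cyc_at z w' u"
        using ym z(1,2) by (auto simp: cyc_at_def cycle_ok_def)
    next
      fix u assume "u \<notin> {m, Suc m} \<union> z ` {m, Suc m}"
      then show "z u = y u \<and> w' u = w u \<and> \<beta>' u = \<beta> u"
        using z3 w'(3) b'(3) by blast
    qed (rule bw)
  next
    case conj
    define a where "a = y m"
    define b where "b = y (Suc m)"
    have ya: "y a = m" "y b = Suc m" using Y(1) by (auto simp: a_def b_def)
    have ne: "a \<noteq> Suc m" "b \<noteq> m" "a \<noteq> b" using conj(2,3) Y(3) by (auto simp: a_def b_def)
    have z: "z m = (if b = Suc m then m else b)" "z (Suc m) = (if a = m then Suc m else a)"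
      "v \<notin> {m, Suc m, a, b} \<Longrightarrow> z v = y v" for v
      using ne ya Y(1)[of v] by (auto simp: z_def conj(4) a_def b_def simple_refl_def transpose_def)
    have SR: "{m, Suc m} \<union> z ` {m, Suc m} = {m, Suc m, a, b}"
      using z(1,2) by auto
    have wz: "w' (z m) = (if z m = m then w (Suc m) else w b)" "w' (z (Suc m)) = (if z (Suc m) = Suc m then w m else w a)"
      using z(1,2) w' ne by auto
    have eqi: "int (z m) = (if int b = int m + 1 then int m else int b)"
      "int (w' (z m)) = (if int (z m) = int m then int (w (Suc m)) else int (w b))"
      using z(1) wz by auto
    have eqj: "int (z (Suc m)) = (if int a = int m then int m + 1 else int a)"
      "int (w' (z (Suc m))) = (if int (z (Suc m)) = int m + 1 then int (w m) else int (w a))"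
      using z(2) wz by auto
    have ca: "cycle_ok (int m) (int a) (int (w m)) (int (w a))"
      and cb: "cycle_ok (int m + 1) (int b) (int (w (Suc m))) (int (w b))"
      using cv[of m] cv[of "Suc m"] by (auto simp: a_def b_def add.commute)
    have an: "int a \<noteq> int m + 1" "int b \<noteq> int m" using ne by auto
    have self: "cycle_ok (int m) (int (z m)) (int (w (Suc m))) (int (w' (z m)))"
       "cycle_ok (int m + 1) (int (z (Suc m))) (int (w m)) (int (w' (z (Suc m))))"
      using ca cb an unfolding eqi eqj by (auto simp: cycle_ok_def)
    have zc: "cyc_at z w' m" "cyc_at z w' (Suc m)"
      using self w'(1,2) by (simp_all add: cyc_at_def add.commute)
    have zy: "y (z m) \<in> {m, Suc m, a, b}" "y (z (Suc m)) \<in> {m, Suc m, a, b}"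
    proof -
      have "y m = a" "y (Suc m) = b" by (simp_all add: a_def b_def)
      then show "y (z m) \<in> {m, Suc m, a, b}" "y (z (Suc m)) \<in> {m, Suc m, a, b}"
        using ya unfolding z(1,2) by auto
    qed
    show ?thesis
    proof (rule atom_for_update_reps[where R = "{m, Suc m}" and z = z and \<beta>' = \<beta>', OF at Y(1) Z])
      fix u assume u: "u \<in> {m, Suc m}"
      show "y u \<in> {m, Suc m} \<union> z ` {m, Suc m}"
        unfolding SR using u by (auto simp: a_def b_def)
      show "y (z u) \<in> {m, Suc m} \<union> z ` {m, Suc m}"
        unfolding SR using u zy by blast
      show "cyc_at z w' u" using u zc by blast
    next
      fix u v assume u: "u \<in> {m, Suc m}" "v \<in> {m, Suc m}" "\<beta>' u = \<beta>' v" "v \<noteq> u" "v \<noteq> z u"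
      then have b: "\<beta> m = \<beta> (Suc m)" using b' by auto
      have ba: "int b < int a"
        using nasc b Y(3)[of m "Suc m"] by (auto simp: ascent_def a_def b_def)
      have p: "cycles_ok (int m) (int a) (int (w m)) (int (w a)) (int m + 1) (int b) (int (w (Suc m))) (int (w b))"
        using pv[of m "Suc m"] b ne by (auto simp: a_def b_def add.commute)
      have J: "int (w (Suc m)) < int (w m)" using desc by simp
      have "cyc_pair z w' m (Suc m)"
        using lower_pair[OF J ba an(1) ca cb p eqi eqj] w' by (simp add: cyc_pair_def add.commute)
      then show "cyc_pair z w' u v" using u cyc_pair_sym by auto
    next
      fix u v assume u: "u \<in> {m, Suc m}" and v: "v \<notin> {m, Suc m} \<union> z ` {m, Suc m}" "y v \<notin> {m, Suc m} \<union> z ` {m, Suc m}" "\<beta>' u = \<beta> v"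
      note v = v[unfolded SR]
      have nn: "int v \<noteq> int m" "int (y v) \<noteq> int m" "int v \<noteq> int m + 1" "int (y v) \<noteq> int m + 1"
        using v by auto
      have 1: "cycles_ok (int m) (int a) (int (w m)) (int (w a)) (int v) (int (y v)) (int (w v)) (int (w (y v)))"
        if "\<beta> m = \<beta> v" using pv[OF that] v by (auto simp: a_def)
      have 2: "cycles_ok (int m + 1) (int b) (int (w (Suc m))) (int (w b)) (int v) (int (y v)) (int (w v)) (int (w (y v)))"
        if "\<beta> (Suc m) = \<beta> v" using pv[OF that] v by (auto simp: b_def add.commute)
      have z1: "cycles_ok (int m) (int (z m)) (int (w (Suc m))) (int (w' (z m))) (int v) (int (y v)) (int (w v)) (int (w (y v)))"
        if "\<beta> (Suc m) = \<beta> v"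
        by (rule adjacent_swap_outer(1)[OF nn an(2) cb cv 2[OF that] eqi])
      have z2: "cycles_ok (int m + 1) (int (z (Suc m))) (int (w m)) (int (w' (z (Suc m)))) (int v) (int (y v)) (int (w v)) (int (w (y v)))"
        if "\<beta> m = \<beta> v"
        by (rule adjacent_swap_outer(2)[OF nn an(1) ca cv 1[OF that] eqj])
      show "cycles_ok (int u) (int (z u)) (int (w' u)) (int (w' (z u))) (int v) (int (y v)) (int (w v)) (int (w (y v)))"
        using u v(3) b' w' z1 z2 by (auto simp: add.commute)
    next
      fix u assume "u \<notin> {m, Suc m} \<union> z ` {m, Suc m}"
      then show "z u = y u \<and> w' u = w u \<and> \<beta>' u = \<beta> u"
        unfolding SR using z(3) w'(3) b'(3) by blast
    qed (rule bw)
  qed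
  then show ?thesis by (simp add: z_def w'_def \<beta>'_def)
qed

section \<open>Order consequences for nested cycles and for covers\<close>

lemma between_encloses:
  fixes a b A B e f E F :: int
  assumes "a < b" "cycle_ok a b A B" "cycle_ok e f E F" "cycles_ok a b A B e f E F" "B < E" "E < A"
  shows "(e < a \<and> b < f \<and> B < F \<and> E < A) \<or> (f < a \<and> b < e \<and> B < E \<and> F < A)"
  using assms unfolding ok_defs by (smt (verit))

text \<open>Here \<open>u\<close> stands directly before \<open>b\<close>, and the inner cycle
  \<open>(c, d)\<close> has \<open>d\<close> even further ahead. In the second alternative
  \<open>(u, v)\<close> also encloses \<open>(c, d)\<close> in the wrong order, with a smaller image
  than \<open>(a, b)\<close>; the minimal choice in \<open>nested_pattern\<close> rules it
  out.\<close>

lemma before_outer: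
  fixes a b c d u v A B C D U V :: int
  assumes "a < c" "c \<le> d" "d < b" "A = B + 1" "U = B - 1" "D < U"
    and "cycle_ok a b A B" "cycle_ok c d C D" "cycle_ok u v U V"
    and "cycles_ok a b A B c d C D" "cycles_ok a b A B u v U V" "cycles_ok c d C D u v U V"
  shows "a < u \<and> u < b \<or> (u < c \<and> d < v \<and> D < V)"
  using assms unfolding ok_defs by (smt (verit))

text \<open>For cycles that are not nested the conditions fix the order of all points. For nested
  ones both points of the inner cycle stay out of the stretch between the outer two, and the
  hypotheses on minima decide on which side they stand.\<close>

lemma canonical_order:
  fixes u v c d U V C D X Y Z W :: int
  assumes "cycle_ok u v U V" "cycle_ok c d C D" "cycle_ok u v X Y" "cycle_ok c d Z W"
    and "cycles_ok u v U V c d C D" "cycles_ok u v X Y c d Z W"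
    and "min u v < min c d \<Longrightarrow> max c d < max u v \<Longrightarrow> min U V < min C D \<and> min X Y < min Z W"
    and "min c d < min u v \<Longrightarrow> max u v < max c d \<Longrightarrow> min C D < min U V \<and> min Z W < min X Y"
    and "U < C"
  shows "X < Z"
  using assms unfolding ok_defs min_def max_def by (smt (verit))

lemma bad_left1:
  fixes i a j e I A J E :: int
  assumes "i < j" "j < a" "J < I" "A + 1 = J"
    and "cycle_ok i e I E" "cycle_ok j a J A" "cycles_ok j a J A i e I E"
  shows "a < e \<and> J < E \<and> E < I"
  using assms unfolding ok_defs by (smt (verit))

lemma bad_left2:
  fixes i a j b e f I A J B E F :: int
  assumes "i < j" "j < a" "b < a" "A + 1 = I" "a < e" "I < E" "E < J"
    and "cycle_ok i a I A" "cycle_ok j b J B" "cycle_ok e f E F"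
    and "cycles_ok i a I A j b J B" "cycles_ok i a I A e f E F" "cycles_ok j b J B e f E F"
    and "not_between i j I J f F" "not_between i j I J b B"
  shows "f < i \<and> E < F \<and> F < J"
  using assms unfolding ok_defs by (smt (verit))

lemma bad_right1:
  fixes i b j f I B J F :: int
  assumes "i < j" "b < i" "J < I" "B = I + 1"
    and "cycle_ok j f J F" "cycle_ok i b I B" "cycles_ok i b I B j f J F"
  shows "f < b \<and> J < F \<and> F < I"
  using assms unfolding ok_defs by (smt (verit))

lemma bad_right2:
  fixes i a j b e f I A J B E F :: int
  assumes "i < j" "b < i" "b < a" "B = J + 1" "f < b" "I < F" "F < J"
    and "cycle_ok i a I A" "cycle_ok j b J B" "cycle_ok e f E F"
    and "cycles_ok i a I A j b J B" "cycles_ok i a I A e f E F" "cycles_ok j b J B e f E F"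
    and "not_between i j I J e E" "not_between i j I J a A"
  shows "j < e \<and> I < E \<and> E < F"
  using assms unfolding ok_defs by (smt (verit))

lemma atom_for_adjacent:
  assumes "partner_map \<beta> y" and at: "atom_for bl \<beta> y w" and "\<beta> a = \<beta> c" "a < c" "w a = Suc (w c)"
  shows "y c = a"
proof (rule ccontr)
  assume ne: "y c \<noteq> a"
  note D = atom_forD[OF at]
  show False
    by (rule adjacent_inversion[of "int a" "int c" "int (w c)" "int (w a)" "int (y c)" "int (w (y c))" "int (y a)" "int (w (y a))"])
      (use assms(3-5) ne D(2)[of c] D(2)[of a] D(3)[of c a] in \<open>auto simp: cyc_at_def cyc_pair_def\<close>)
qed

section \<open>The atoms of one involution are connected\<close>

text \<open>In the one-line notation of the inverse, replacing \<open>w\<close> by \<open>rot p \<circ> w\<close> turns \<open>b c a\<close> at the positions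
  \<open>p, p + 1, p + 2\<close> into \<open>c a b\<close>.\<close>

definition rot :: "nat \<Rightarrow> nat \<Rightarrow> nat" where
  "rot p q = (if q = p then p + 2 else if q = p + 1 then p else if q = p + 2 then p + 1 else q)"

lemma rot_eq_simple_refl:
  "rot p = simple_refl p \<circ> simple_refl (Suc p) \<circ> simple_refl p \<circ> simple_refl (Suc p)"
  by (auto simp: fun_eq_iff rot_def simple_refl_def transpose_def)

lemma rot_range: "p \<le> q \<and> q \<le> p + 2 \<longleftrightarrow> p \<le> rot p q \<and> rot p q \<le> p + 2"
  by (auto simp: rot_def)

lemma rot_outside: "\<not> (p \<le> q \<and> q \<le> p + 2) \<Longrightarrow> rot p q = q"
  by (auto simp: rot_def)

text \<open>The adjacent inverted letters \<open>c\<close> and \<open>a\<close> form a 2-cycle by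
  \<open>atom_for_adjacent\<close>, and the move carries \<open>u\<close> from directly before this
  pair to directly behind it. The three positions lie in one block because the outer two do.\<close>

lemma atom_for_rot:
  assumes bl: "mono bl" and y: "partner_map \<beta> y" and w: "inj w" and at: "atom_for bl \<beta> y w"
    and pos: "w c = Suc (w u)" "w a = Suc (Suc (w u))" and less: "a < u" "u < c" and blk: "\<beta> u = \<beta> a"
  shows "atom_for bl \<beta> y (rot (w u) \<circ> w)"
proof -
  define p where "p = w u"
  define w' where "w' = rot p \<circ> w"
  note D = atom_forD[OF at] and Y = partner_mapD[OF y]
  have wi: "w x = w v \<longleftrightarrow> x = v" for x v using w by (auto simp: inj_eq)
  have blp: "bl q = \<beta> u" if "p \<le> q" "q \<le> p + 2" for q
    using between_blocks[OF bl, of p q "p + 2"] that D(1)[of u] D(1)[of a] blk pos by (auto simp: p_def)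
  have bc: "\<beta> c = \<beta> u" using blp[of "w c"] D(1)[of c] pos by (simp add: p_def)
  have yc: "y c = a"
    by (rule atom_for_adjacent[OF y at]) (use bc blk less pos in auto)
  then have ya: "y a = c" using Y(1)[of c] by simp
  define v where "v = y u"
  have v: "y v = u" "\<beta> v = \<beta> u" using Y by (auto simp: v_def)
  have va: "v \<noteq> a" "v \<noteq> c" using v ya yc less by auto
  have pos': "w' u = p + 2" "w' c = p" "w' a = p + 1" "x \<notin> {u, c, a} \<Longrightarrow> w' x = w x" for x
    using pos wi[of x u] wi[of x c] wi[of x a] by (auto simp: w'_def p_def rot_def)
  have out: "int (w x) \<notin> {int p, int p + 1, int p + 2}" if "x \<notin> {u, c, a}" for x
    using pos that wi[of x u] wi[of x c] wi[of x a] by (auto simp: p_def)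
  have V: "int (w' v) = (if int v = int u then int p + 2 else int (w v))"
    using pos' va by auto
  have L: "int a < int u" "int u < int c" using less by auto
  have cu: "cycle_ok (int u) (int v) (int p) (int (w v))"
    using D(2)[of u] by (simp add: cyc_at_def v_def p_def)
  have pa: "cycles_ok (int u) (int v) (int p) (int (w v)) (int a) (int c) (int p + 2) (int p + 1)"
    using D(3)[of u a] blk va less pos ya by (simp add: cyc_pair_def v_def p_def add.commute)
  have "atom_for bl \<beta> y w'"
  proof (rule atom_for_update_reps[where R = "{u, a}" and z = y and \<beta>' = \<beta>, OF at Y(1) Y(1) Y(2)])
    fix x assume x: "x \<in> {u, a}"
    show "y x \<in> {u, a} \<union> y ` {u, a}" using x by auto
    show "y (y x) \<in> {u, a} \<union> y ` {u, a}" using x Y(1) by auto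
    show "cyc_at y w' x"
      using x rotate_inner(1)[OF L cu pa V] pos' ya less by (auto simp: cyc_at_def v_def cycle_ok_def)
  next
    fix x assume "x \<notin> {u, a} \<union> y ` {u, a}"
    then have "x \<notin> {u, c, a}" using ya by auto
    then show "y x = y x \<and> w' x = w x \<and> \<beta> x = \<beta> x" using pos' by blast
  next
    fix x assume "x \<in> {u, a} \<union> y ` {u, a}"
    show "bl (w' x) = \<beta> x"
    proof (cases "p \<le> w x \<and> w x \<le> p + 2")
      case True
      then show ?thesis using blp[of "w x"] blp[of "w' x"] rot_range[of p "w x"] D(1)[of x] by (auto simp: w'_def)
    next
      case False
      then show ?thesis using rot_outside D(1)[of x] by (simp add: w'_def)
    qed
  next
    fix x x' assume x: "x \<in> {u, a}" "x' \<in> {u, a}" "x' \<noteq> x"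
    have "cyc_pair y w' u a"
      using rotate_inner(2)[OF L cu pa V] pos' ya by (simp add: cyc_pair_def v_def add.commute)
    then show "cyc_pair y w' x x'" using x cyc_pair_sym by auto
  next
    fix x x' assume x: "x \<in> {u, a}" and x': "x' \<notin> {u, a} \<union> y ` {u, a}" "y x' \<notin> {u, a} \<union> y ` {u, a}" "\<beta> x = \<beta> x'"
    have ne: "x' \<notin> {u, c, a}" "y x' \<notin> {u, c, a}" "x' \<noteq> v" using x' ya by (auto simp: v_def)
    have bx: "\<beta> u = \<beta> x'" "\<beta> a = \<beta> x'" using x x'(3) blk by auto
    have 1: "cycles_ok (int u) (int v) (int p) (int (w v)) (int x') (int (y x')) (int (w x')) (int (w (y x')))"
      using D(3)[OF bx(1)] ne by (simp add: cyc_pair_def v_def p_def)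
    have 2: "cycles_ok (int a) (int c) (int p + 2) (int p + 1) (int x') (int (y x')) (int (w x')) (int (w (y x')))"
      using D(3)[OF bx(2)] ne ya pos by (simp add: cyc_pair_def p_def add.commute)
    have 3: "cycle_ok (int x') (int (y x')) (int (w x')) (int (w (y x')))"
      using D(2)[of x'] by (simp add: cyc_at_def)
    show "cycles_ok (int x) (int (y x)) (int (w' x)) (int (w' (y x))) (int x') (int (y x')) (int (w x')) (int (w (y x')))"
      using x rotate_outer[OF L cu pa V out[OF ne(1)] out[OF ne(2)] 3 1 2] pos'(1-3) ya
      by (auto simp: v_def add.commute)
  qed
  then show ?thesis by (simp add: w'_def p_def)
qed

text \<open>The bounds \<open>lo\<close> and \<open>hi\<close> confine the three positions that a
  move touches, so that one can tell which other letters keep their images.\<close>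

definition pattern_in :: "(nat \<Rightarrow> nat) \<Rightarrow> (nat \<Rightarrow> nat) \<Rightarrow> (nat \<Rightarrow> nat) \<Rightarrow> nat \<Rightarrow> nat \<Rightarrow> nat \<Rightarrow> nat \<Rightarrow> nat \<Rightarrow> bool" where
  "pattern_in \<beta> y w lo hi u c a \<longleftrightarrow> a < u \<and> u < c \<and> y a = c \<and> \<beta> u = \<beta> a \<and>
     w c = Suc (w u) \<and> w a = Suc (Suc (w u)) \<and> lo \<le> w u \<and> w a \<le> hi"

text \<open>Among the outer cycles whose larger point comes after that of an inner one, take the
  cycle with least \<open>w a\<close>, and let \<open>b = y a\<close>. A letter standing between
  \<open>b\<close> and \<open>a\<close> would belong to an enclosing cycle with smaller image, so
  \<open>b\<close> and \<open>a\<close> are adjacent. The letter directly before \<open>b\<close>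
  then lies between \<open>a\<close> and \<open>b\<close> in size, as otherwise its own cycle would
  contradict minimality.\<close>

lemma nested_pattern:
  assumes bl: "mono bl" and y: "partner_map \<beta> y" and w: "bij w" and at: "atom_for bl \<beta> y w"
    and nest: "a0 < c0" "c0 \<le> y c0" "y c0 < y a0" "\<beta> a0 = \<beta> c0" "w (y c0) < w (y a0)"
  shows "\<exists>u c a. pattern_in \<beta> y w (w (y c0)) (w a0) u c a"
proof -
  note D = atom_forD[OF at] and Y = partner_mapD[OF y]
  have wi: "w x = w v \<longleftrightarrow> x = v" for x v using bij_is_inj[OF w] by (auto simp: inj_eq)
  define P where "P a \<longleftrightarrow> (\<exists>c. a < c \<and> c \<le> y c \<and> y c < y a \<and> \<beta> a = \<beta> c \<and> w (y c0) \<le> w (y c) \<and> w (y c) < w (y a))" for a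
  have P0: "P a0" unfolding P_def using nest by (intro exI[of _ c0]) auto
  obtain a where a: "P a" and mi: "\<And>a'. P a' \<Longrightarrow> w a \<le> w a'"
    using ex_has_least_nat[of P a0 w] P0 by blast
  obtain c where c: "a < c" "c \<le> y c" "y c < y a" "\<beta> a = \<beta> c" "w (y c0) \<le> w (y c)" "w (y c) < w (y a)"
    using a unfolding P_def by blast
  define b where "b = y a"
  define d where "d = y c"
  have yb: "y b = a" "y d = c" "\<beta> b = \<beta> a" "\<beta> d = \<beta> a" using Y c(4) by (auto simp: b_def d_def)
  have ab: "a < b" using c by (simp add: b_def)
  have cyc: "cycle_ok (int v) (int (y v)) (int (w v)) (int (w (y v)))" for v
    using D(2)[of v] by (simp add: cyc_at_def)
  have pv: "\<beta> u = \<beta> v \<Longrightarrow> v \<noteq> u \<Longrightarrow> v \<noteq> y u \<Longrightarrow>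
      cycles_ok (int u) (int (y u)) (int (w u)) (int (w (y u))) (int v) (int (y v)) (int (w v)) (int (w (y v)))" for u v
    using D(3)[of u v] by (simp add: cyc_pair_def)
  have wba: "w b < w a" using cyc[of a] ab by (simp add: cycle_ok_def b_def)
  have adj: "w a = Suc (w b)"
  proof (rule ccontr)
    assume na: "w a \<noteq> Suc (w b)"
    obtain e where e: "w e = Suc (w b)" using bij_is_surj[OF w] by (metis surjD)
    have "bl (w e) = bl (w a)"
      by (rule between_blocks[OF bl, of "w b"]) (use e wba yb(3) in \<open>auto simp: D(1)\<close>)
    then have be: "\<beta> e = \<beta> a" by (simp only: D(1))
    have ne: "e \<noteq> a" "e \<noteq> b" using e na by auto
    have pe: "cycles_ok (int a) (int b) (int (w a)) (int (w b)) (int e) (int (y e)) (int (w e)) (int (w (y e)))"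
      using pv[of a e] be ne by (simp add: b_def)
    have ca: "cycle_ok (int a) (int b) (int (w a)) (int (w b))" using cyc[of a] by (simp add: b_def)
    have "(e < a \<and> b < y e \<and> w b < w (y e) \<and> w e < w a) \<or> (y e < a \<and> b < e \<and> w b < w e \<and> w (y e) < w a)"
      using between_encloses[OF _ ca cyc pe] ab e wba na by auto
    then obtain x where x: "x < a" "b < y x" "w b < w (y x)" "w x < w a" "\<beta> x = \<beta> a"
      using be Y(1)[of e] Y(2)[of e] by metis
    have "P x"
      unfolding P_def by (rule exI[of _ a]) (use x ab c in \<open>auto simp: b_def\<close>)
    then show False using mi[of x] x(4) by simp
  qed
  have wd: "w d < w b" using c by (simp add: b_def d_def)
  obtain u where u: "Suc (w u) = w b"
    using bij_is_surj[OF w] wd by (metis Suc_pred less_nat_zero_code neq0_conv surjD)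
  have "bl (w u) = bl (w b)"
    by (rule between_blocks[OF bl, of "w d"]) (use u wd yb(3,4) in \<open>auto simp: D(1)\<close>)
  then have bu: "\<beta> u = \<beta> a" using yb(3) by (simp only: D(1))
  have uab: "a < u \<and> u < b"
  proof (cases "u = c \<or> u = d")
    case True
    then show ?thesis using c by (auto simp: b_def d_def)
  next
    case False
    have une: "u \<noteq> a" "u \<noteq> b" using u adj by auto
    have "w u \<noteq> w d" using False wi by auto
    then have du: "w d < w u" using u wd by simp
    have 1: "cycles_ok (int a) (int b) (int (w a)) (int (w b)) (int c) (int d) (int (w c)) (int (w d))"
      using pv[of a c] c ab by (auto simp: b_def d_def)
    have 2: "cycles_ok (int a) (int b) (int (w a)) (int (w b)) (int u) (int (y u)) (int (w u)) (int (w (y u)))"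
      using pv[of a u] bu une by (simp add: b_def)
    have 3: "cycles_ok (int c) (int d) (int (w c)) (int (w d)) (int u) (int (y u)) (int (w u)) (int (w (y u)))"
      using pv[of c u] bu c(4) False by (simp add: d_def)
    have 4: "cycle_ok (int a) (int b) (int (w a)) (int (w b))" "cycle_ok (int c) (int d) (int (w c)) (int (w d))"
      using cyc[of a] cyc[of c] by (simp_all add: b_def d_def)
    have "a < u \<and> u < b \<or> (u < c \<and> d < y u \<and> w d < w (y u))"
      using before_outer[OF _ _ _ _ _ _ 4 cyc 1 2 3] c adj u du by (auto simp: b_def d_def)
    moreover have False if "u < c" "d < y u" "w d < w (y u)"
    proof -
      have "P u" unfolding P_def by (rule exI[of _ c]) (use that c bu in \<open>auto simp: d_def\<close>)
      then show False using mi[of u] u adj by simp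
    qed
    ultimately show ?thesis by blast
  qed
  have "w (y c0) \<le> w u" using c(5) wd u by (simp add: d_def)
  moreover have "w a \<le> w a0" using mi[OF P0] .
  ultimately have "pattern_in \<beta> y w (w (y c0)) (w a0) u b a"
    using uab bu adj u by (auto simp: pattern_in_def b_def)
  then show ?thesis by blast
qed

text \<open>A letter standing between \<open>y a\<close> and \<open>a\<close> belongs to a cycle
  that encloses this one, and the two are nested in the order required by
  \<open>nested_pattern\<close>. The clauses on the smallest letter \<open>x\<close> later keep the
  move away from the letters being exchanged.\<close>

lemma nonadjacent_pattern:
  assumes bl: "mono bl" and y: "partner_map \<beta> y" and w: "bij w" and at: "atom_for bl \<beta> y w"
    and a: "a < y a" and nadj: "w a \<noteq> Suc (w (y a))"
  shows "\<exists>u c x. pattern_in \<beta> y w (w (y a)) (w a) u c x \<and> w x < w a \<and> x < a"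
proof -
  note D = atom_forD[OF at] and Y = partner_mapD[OF y]
  define b where "b = y a"
  have cyc: "cycle_ok (int v) (int (y v)) (int (w v)) (int (w (y v)))" for v
    using D(2)[of v] by (simp add: cyc_at_def)
  have wba: "w b < w a" using cyc[of a] a by (simp add: cycle_ok_def b_def)
  have enc: "\<exists>x. x < a \<and> b < y x \<and> w b < w (y x) \<and> w x < w a \<and> \<beta> x = \<beta> a \<and> (e = x \<or> e = y x)"
    if e: "w b < w e" "w e < w a" for e
  proof -
    have "bl (w e) = bl (w a)"
      by (rule between_blocks[OF bl, of "w b"]) (use e Y(2)[of a] in \<open>auto simp: D(1) b_def\<close>)
    then have be: "\<beta> e = \<beta> a" by (simp only: D(1))
    have ne: "e \<noteq> a" "e \<noteq> b" using e by auto
    have pe: "cycles_ok (int a) (int b) (int (w a)) (int (w b)) (int e) (int (y e)) (int (w e)) (int (w (y e)))"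
      using D(3)[of a e] be ne by (simp add: b_def cyc_pair_def)
    have ca: "cycle_ok (int a) (int b) (int (w a)) (int (w b))" using cyc[of a] by (simp add: b_def)
    have "(e < a \<and> b < y e \<and> w b < w (y e) \<and> w e < w a) \<or> (y e < a \<and> b < e \<and> w b < w e \<and> w (y e) < w a)"
      using between_encloses[OF _ ca cyc pe] a e by (auto simp: b_def)
    then show ?thesis
    proof
      assume "e < a \<and> b < y e \<and> w b < w (y e) \<and> w e < w a"
      then show ?thesis using be by (intro exI[of _ e]) auto
    next
      assume "y e < a \<and> b < e \<and> w b < w e \<and> w (y e) < w a"
      then show ?thesis using be Y(1,2)[of e] by (intro exI[of _ "y e"]) auto
    qed
  qed
  obtain e where e: "w e = Suc (w b)" using bij_is_surj[OF w] by (metis surjD)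
  have "w e < w a" using e wba nadj by (simp add: b_def)
  then obtain x where x: "x < a" "b < y x" "w b < w (y x)" "w x < w a" "\<beta> x = \<beta> a"
    using enc[of e] e by auto
  obtain u c z where p: "pattern_in \<beta> y w (w b) (w x) u c z"
    using nested_pattern[OF bl y w at, of x a] x a by (auto simp: b_def)
  then have z: "w z < w a" "w b < w z" "z < y z" using x(4) by (auto simp: pattern_in_def)
  obtain x' where "x' < a" "b < y x'" "z = x' \<or> z = y x'" using enc[OF z(2,1)] by blast
  then have "z < a" using z(3) Y(1)[of x'] a by (auto simp: b_def)
  then show ?thesis using p z(1) x(4) by (intro exI[of _ u] exI[of _ c] exI[of _ z]) (auto simp: pattern_in_def b_def)
qed

lemma rot_permutes: "{p..p + 2} \<subseteq> S \<Longrightarrow> rot p permutes S"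
  unfolding rot_eq_simple_refl simple_refl_def
  by (intro permutes_compose permutes_swap_id) auto

text \<open>Every move \<open>b c a \<mapsto> c a b\<close> lowers the weight, and only one atom admits no such move.\<close>

definition weight :: "nat \<Rightarrow> (nat \<Rightarrow> nat) \<Rightarrow> nat" where
  "weight n w = (\<Sum>v = 1..n. w v * 2 ^ v)"

text \<open>The letter \<open>u\<close> moves up by two positions and gains
  \<open>2 * 2 ^ u\<close>, which is at most the loss \<open>2 ^ c\<close> because
  \<open>u < c\<close>; the loss \<open>2 ^ a\<close> makes the inequality strict.\<close>

lemma weight_rot:
  assumes w: "inj w" and pos: "w c = Suc (w u)" "w a = Suc (Suc (w u))" and less: "a < u" "u < c"
    and n: "a \<in> {1..n}" "c \<in> {1..n}"
  shows "weight n (rot (w u) \<circ> w) < weight n w"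
proof -
  have wi: "w x = w v \<longleftrightarrow> x = v" for x v using w by (auto simp: inj_eq)
  have u: "u \<in> {1..n}" using less n by auto
  let ?w = "rot (w u) \<circ> w"
  have "?w v * 2 ^ v + ((if v = c then 2 ^ c else 0) + (if v = a then 2 ^ a else 0))
      = w v * 2 ^ v + (if v = u then 2 * 2 ^ u else 0)" for v
    using pos less wi[of v u] wi[of v c] wi[of v a] by (auto simp: rot_def algebra_simps)
  then have "(\<Sum>v = 1..n. ?w v * 2 ^ v + ((if v = c then 2 ^ c else 0) + (if v = a then 2 ^ a else 0)))
      = (\<Sum>v = 1..n. w v * 2 ^ v + (if v = u then 2 * 2 ^ u else 0))"
    by (simp only:)
  then have "weight n ?w + (2 ^ c + 2 ^ a) = weight n w + 2 * 2 ^ u"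
    using n u by (simp add: weight_def sum.distrib del: o_apply)
  moreover have "(2 :: nat) * 2 ^ u \<le> 2 ^ c"
    using power_increasing[of "Suc u" c "2 :: nat"] less by simp
  moreover have "(0 :: nat) < 2 ^ a" by simp
  ultimately show ?thesis by linarith
qed

lemma pattern_rot:
  assumes bl: "mono bl" and y: "partner_map \<beta> y" "y permutes {1..n}" and w: "w permutes {1..n}"
    and at: "atom_for bl \<beta> y w" and pat: "pattern_in \<beta> y w lo hi u c a"
  shows "rot (w u) \<circ> w permutes {1..n}" "atom_for bl \<beta> y (rot (w u) \<circ> w)"
    "weight n (rot (w u) \<circ> w) < weight n w" "a \<in> {1..n}" "c \<in> {1..n}" "u \<in> {1..n}"
proof -
  note p = pat[unfolded pattern_in_def]
  have "y c = a" using p partner_mapD(1)[OF y(1), of a] by auto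
  then show n: "a \<in> {1..n}" "c \<in> {1..n}"
    using p permutes_not_in[OF y(2), of a] permutes_not_in[OF y(2), of c] by force+
  then show u: "u \<in> {1..n}" using p by auto
  have "w u \<in> {1..n}" "w a \<in> {1..n}" using permutes_in_image[OF w] n u by blast+
  then have "{w u..w u + 2} \<subseteq> {1..n}" using p by auto
  then show "rot (w u) \<circ> w permutes {1..n}" by (intro permutes_compose[OF w] rot_permutes)
  show "atom_for bl \<beta> y (rot (w u) \<circ> w)"
    by (rule atom_for_rot[OF bl y(1) permutes_inj[OF w] at]) (use p in auto)
  show "weight n (rot (w u) \<circ> w) < weight n w"
    by (rule weight_rot[OF permutes_inj[OF w]]) (use p n in auto)
qed

section \<open>Covers of an atom that are not atoms\<close>

lemma bad_swap_not_atom: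
  assumes bl: "mono bl" and y: "partner_map \<beta> y" "y permutes {1..n}" and z: "partner_map \<beta> z"
    and ij: "i < j" "\<beta> i = \<beta> j"
    and bad: "(j < y i \<and> y j < y i) \<or> (y j < i \<and> y j < y i)"
  shows "w permutes {1..n} \<Longrightarrow> atom_for bl \<beta> y w \<Longrightarrow> atom_for bl \<beta> z (w \<circ> transpose i j) \<Longrightarrow> w i < w j \<Longrightarrow>
    (\<And>v. i < v \<Longrightarrow> v < j \<Longrightarrow> \<not> (w i < w v \<and> w v < w j)) \<Longrightarrow> False"
\<comment> \<open>The bad configurations depend only on \<open>y\<close>, \<open>i\<close> and
  \<open>j\<close>. Hence a move available both before and after the exchange of \<open>i\<close>
  and \<open>j\<close> leads to an atom of smaller weight with the same defect. When the relevant
  letters are too close together for such a move, adjacent inversions force pairs of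
  \<open>z\<close> that contradict one another.\<close>
proof (induction "weight n w" arbitrary: w rule: less_induct)
  case less
  note w = less.prems(1) and at = less.prems(2) and at' = less.prems(3) and wij = less.prems(4) and cov = less.prems(5)
  define t where "t = transpose i j"
  define w' where "w' = w \<circ> t"
  note D = atom_forD[OF at] and D' = atom_forD[OF at'[folded t_def w'_def]]
  note Y = partner_mapD[OF y(1)] and Z = partner_mapD[OF z]
  have wb: "bij w" and wi: "w x = w v \<longleftrightarrow> x = v" for x v
    using permutes_bij[OF w] by (auto simp: bij_def inj_eq)
  have t: "t i = j" "t j = i" "v \<noteq> i \<Longrightarrow> v \<noteq> j \<Longrightarrow> t v = v" for v by (auto simp: t_def)
  have w': "w' i = w j" "w' j = w i" "v \<noteq> i \<Longrightarrow> v \<noteq> j \<Longrightarrow> w' v = w v" for v using t by (auto simp: w'_def)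
  \<comment> \<open>The side conditions say that the pattern survives the exchange of
    \<open>i\<close> and \<open>j\<close> and that the cover condition survives the move. The letter
    \<open>u\<close> may be \<open>j\<close>; it then becomes \<open>i\<close> in the pattern of
    \<open>w'\<close>, whence the demand \<open>a < i\<close>.\<close>
  have red: False if pat: "pattern_in \<beta> y w lo hi u c a" and ne: "u \<noteq> i" "c \<notin> {i, j}" "a \<notin> {i, j}" "u = j \<Longrightarrow> a < i"
    and ord: "rot (w u) (w i) < rot (w u) (w j)"
    and cov1: "\<And>v. i < v \<Longrightarrow> v < j \<Longrightarrow> rot (w u) (w i) < rot (w u) (w v) \<Longrightarrow> rot (w u) (w v) < rot (w u) (w j) \<Longrightarrow> False"
    for lo hi u c a
  proof -
    note p = pat[unfolded pattern_in_def]
    have wu: "w' (t u) = w u" using ne w' t by (cases "u = j") auto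
    have wca: "w' c = w c" "w' a = w a" using ne w'(3) by auto
    have "atom_for bl \<beta> z (rot (w' (t u)) \<circ> w')"
    proof (rule atom_for_rot[OF bl z _ at'[folded t_def w'_def]])
      show "inj w'"
        unfolding w'_def t_def using permutes_inj[OF w] by (intro inj_compose) auto
      have "t u = (if u = j then i else u)" using ne t by auto
      then have "a < t u \<and> t u < c \<and> \<beta> (t u) = \<beta> a"
        using p ne(4) ij by (cases "u = j") simp_all
      then show "a < t u" "t u < c" "\<beta> (t u) = \<beta> a" by blast+
    qed (use p wu wca in auto)
    then have "atom_for bl \<beta> z ((rot (w u) \<circ> w) \<circ> transpose i j)"
      unfolding wu unfolding w'_def t_def o_assoc .
    from less.hyps[OF pattern_rot(3)[OF bl y w at pat] pattern_rot(1,2)[OF bl y w at pat] this]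
    show False using ord cov1 by auto
  qed
  \<comment> \<open>The move only permutes positions strictly between those of \<open>i\<close> and
    \<open>j\<close>, so it leaves these two images alone and puts no new letter between
    them.\<close>
  have inner: False if e: "w i < w e" "w f < w j" "y f = e" "f < e" "w e < w f" "w f \<noteq> Suc (w e)" for e f
  proof -
    obtain u c x where p: "pattern_in \<beta> y w (w e) (w f) u c x" and x: "w x < w f"
      using nonadjacent_pattern[OF bl y(1) wb at, of f] e by auto
    note p' = p[unfolded pattern_in_def]
    have ri: "rot (w u) (w i) = w i" "rot (w u) (w j) = w j"
      using p' e x by (auto simp: rot_def)
    show False
    proof (rule red[OF p])
      fix v assume v: "i < v" "v < j" "rot (w u) (w i) < rot (w u) (w v)" "rot (w u) (w v) < rot (w u) (w j)"
      show False
      proof (cases "w u \<le> w v \<and> w v \<le> w u + 2")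
        case True
        then show ?thesis using cov[OF v(1,2)] p' e x by auto
      next
        case False
        then show ?thesis using cov[OF v(1,2)] v(3,4) ri rot_outside[OF False] by simp
      qed
    qed (use p' e x ri wij in auto)
  qed
  define a where "a = y i"
  define b where "b = y j"
  have cyc: "cycle_ok (int v) (int (y v)) (int (w v)) (int (w (y v)))" for v
    using D(2)[of v] by (simp add: cyc_at_def)
  have pv: "\<beta> u = \<beta> v \<Longrightarrow> v \<noteq> u \<Longrightarrow> v \<noteq> y u \<Longrightarrow>
      cycles_ok (int u) (int (y u)) (int (w u)) (int (w (y u))) (int v) (int (y v)) (int (w v)) (int (w (y v)))" for u v
    using D(3)[of u v] by (simp add: cyc_pair_def)
  have cyc': "cycle_ok (int v) (int (z v)) (int (w' v)) (int (w' (z v)))" for v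
    using D'(2)[of v] by (simp add: cyc_at_def)
  have pv': "\<beta> u = \<beta> v \<Longrightarrow> v \<noteq> u \<Longrightarrow> v \<noteq> z u \<Longrightarrow>
      cycles_ok (int u) (int (z u)) (int (w' u)) (int (w' (z u))) (int v) (int (z v)) (int (w' v)) (int (w' (z v)))" for u v
    using D'(3)[of u v] by (simp add: cyc_pair_def)
  have ya: "y a = i" "y b = j" "\<beta> a = \<beta> i" "\<beta> b = \<beta> i" using Y ij by (auto simp: a_def b_def)
  have aj: "a \<noteq> j"
  proof
    assume "a = j"
    then show False using cyc[of i] ij wij by (simp add: cycle_ok_def a_def)
  qed
  then have bi: "b \<noteq> i" using ya by (auto simp: a_def)
  have nb: "not_between (int i) (int j) (int (w i)) (int (w j)) (int x) (int (w x))" for x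
    using cov by (simp add: not_between_def)
  have pij: "cycles_ok (int i) (int a) (int (w i)) (int (w a)) (int j) (int b) (int (w j)) (int (w b))"
    using pv[of i j] ij aj by (auto simp: a_def b_def)
  have ca: "cycle_ok (int i) (int a) (int (w i)) (int (w a))" and cb: "cycle_ok (int j) (int b) (int (w j)) (int (w b))"
    using cyc[of i] cyc[of j] by (auto simp: a_def b_def)
  from bad show False
  proof
    assume bad: "j < y i \<and> y j < y i"
    then have ba: "j < a" "b < a" by (auto simp: a_def b_def)
    show False
    proof (cases "w i = Suc (w a)")
      case False
      then obtain u c x where p: "pattern_in \<beta> y w (w a) (w i) u c x" and x: "w x < w i"
        using nonadjacent_pattern[OF bl y(1) wb at, of i] ij ba by (auto simp: a_def)
      note p' = p[unfolded pattern_in_def]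
      have ri: "rot (w u) (w i) = w i" "rot (w u) (w j) = w j"
        using p' x wij by (auto simp: rot_def)
      show False
      proof (rule red[OF p])
        fix v assume v: "i < v" "v < j" "rot (w u) (w i) < rot (w u) (w v)" "rot (w u) (w v) < rot (w u) (w j)"
        show False
        proof (cases "w u \<le> w v \<and> w v \<le> w u + 2")
          case True
          then have "rot (w u) (w v) \<le> w u + 2" using rot_range by blast
          then show ?thesis using v(3) ri p' x by auto
        next
          case False
          then show ?thesis using cov[OF v(1,2)] v(3,4) ri rot_outside[OF False] by simp
        qed
      qed (use p' x ri wij in auto)
    next
      case adj: True
      \<comment> \<open>After the exchange the smaller letter \<open>j\<close> stands directly
        behind \<open>a\<close>. The partner \<open>e\<close> of \<open>i\<close> under
        \<open>z\<close> is then forced above \<open>a\<close> in size and between \<open>j\<close>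
        and \<open>i\<close> in position. In \<open>w\<close> its partner \<open>f\<close> under
        \<open>y\<close> lies below \<open>i\<close> and stands behind \<open>e\<close>: if directly
        behind, \<open>z\<close> would have to pair \<open>e\<close> with \<open>f\<close> instead
        of \<open>i\<close>; otherwise \<open>inner\<close> applies.\<close>
      have "z a = j"
        by (rule atom_for_adjacent[OF z at'[folded t_def w'_def]]) (use ba ya ij adj w' aj in auto)
      then have za: "z j = a" "z a = j" using Z(1)[of a] by auto
      define e where "e = z i"
      have ze: "z e = i" "\<beta> e = \<beta> i" using Z by (auto simp: e_def)
      have "e \<noteq> i \<Longrightarrow> e \<noteq> j" using za ze ba ij by auto
      have ei: "e \<noteq> j" using za ze ba ij by auto
      have "int a < int e \<and> int (w' j) < int (w' e) \<and> int (w' e) < int (w' i)"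
        using bad_left1[of "int i" "int j" "int a" "int (w' j)" "int (w' i)" "int (w' a)" "int e" "int (w' e)"]
          cyc'[of i] cyc'[of j] pv'[of j i] ij ba adj w' aj za wij by (auto simp: e_def)
      then have e: "a < e" "w' j < w' e" "w' e < w' i" by auto
      have "e \<noteq> i" using e by auto
      then have we: "w' e = w e" using w' ei by auto
      define f where "f = y e"
      have yf: "y f = e" using Y by (simp add: f_def)
      have ea: "e \<noteq> a" "e \<noteq> b" using e ba by auto
      have pe: "cycles_ok (int i) (int a) (int (w i)) (int (w a)) (int e) (int f) (int (w e)) (int (w f))"
        "cycles_ok (int j) (int b) (int (w j)) (int (w b)) (int e) (int f) (int (w e)) (int (w f))"
        using pv[of i e] pv[of j e] ze ij ea \<open>e \<noteq> i\<close> ei by (auto simp: a_def b_def f_def)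
      have ce: "cycle_ok (int e) (int f) (int (w e)) (int (w f))" using cyc[of e] by (simp add: f_def)
      have "int f < int i \<and> int (w e) < int (w f) \<and> int (w f) < int (w j)"
        using bad_left2[OF _ _ _ _ _ _ _ ca cb ce pij pe nb nb] ij ba adj e w' we by auto
      then have f: "f < i" "w e < w f" "w f < w j" by auto
      show False
      proof (cases "w f = Suc (w e)")
        case True
        have "w' f = w f" using f ij w' by auto
        then have "z e = f"
          by (intro atom_for_adjacent[OF z at'[folded t_def w'_def]]) (use f e ba ij ze True we Y(2)[of e] in \<open>auto simp: f_def\<close>)
        then show False using ze f by simp
      next
        case False
        show False
          by (rule inner[of e f]) (use f e we w' yf ba ij False in auto)
      qed
    qed
  next
    assume bad: "y j < i \<and> y j < y i"
    then have ba: "b < i" "b < a" by (auto simp: a_def b_def)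
    show False
    proof (cases "w b = Suc (w j)")
      case False
      then obtain u c x where p: "pattern_in \<beta> y w (w j) (w b) u c x" and x: "w x < w b" "x < b"
        using nonadjacent_pattern[OF bl y(1) wb at, of b] ij ba ya by auto
      note p' = p[unfolded pattern_in_def]
      have ri: "rot (w u) (w i) = w i"
        using p' wij by (auto simp: rot_def)
      have rj: "w j \<le> rot (w u) (w j)"
        using p' by (auto simp: rot_def)
      show False
      proof (rule red[OF p])
        fix v assume v: "i < v" "v < j" "rot (w u) (w i) < rot (w u) (w v)" "rot (w u) (w v) < rot (w u) (w j)"
        show False
        proof (cases "u = j")
          case True
          \<comment> \<open>The letter \<open>j\<close> itself moves up by two positions, but the
            letters it passes are \<open>c > j\<close> and \<open>x < i\<close>, neither of which
            lies between \<open>i\<close> and \<open>j\<close> in size.\<close>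
          have "rot (w u) (w j) = w j + 2" using True by (simp add: rot_def)
          moreover have "v \<noteq> u" "v \<noteq> c" "v \<noteq> x" using v p' True x ba by auto
          then have "w v \<noteq> w u" "w v \<noteq> w c" "w v \<noteq> w x" using wi by auto
          then have "rot (w u) (w v) = w v" using p' by (auto simp: rot_def)
          ultimately show ?thesis using cov[OF v(1,2)] v(3,4) ri \<open>w v \<noteq> w u\<close> \<open>w v \<noteq> w c\<close> p' True by auto
        next
          case False
          then have "w j < w u" using p' wi[of u j] by auto
          then have "rot (w u) (w j) = w j" by (simp add: rot_def)
          moreover have "w u \<le> w v \<and> w v \<le> w u + 2 \<Longrightarrow> w u \<le> rot (w u) (w v)" using rot_range by blast
          ultimately show ?thesis
            using cov[OF v(1,2)] v(3,4) ri \<open>w j < w u\<close> rot_outside[of "w u" "w v"]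
            by (cases "w u \<le> w v \<and> w v \<le> w u + 2") auto
        qed
      qed (use p' x ri rj wij ba in auto)
    next
      case adj: True
      \<comment> \<open>The mirror image of the first configuration: now \<open>i\<close> stands
        directly before the smaller letter \<open>b\<close>.\<close>
      have "z i = b"
        by (rule atom_for_adjacent[OF z at'[folded t_def w'_def]]) (use ba ya ij adj w' bi in auto)
      then have zb: "z i = b" "z b = i" using Z(1)[of i] by auto
      define f where "f = z j"
      have zf: "z f = j" "\<beta> f = \<beta> i" using Z ij by (auto simp: f_def)
      have fi: "f \<noteq> i" "f \<noteq> b" using zb zf ba ij by auto
      have "int f < int b \<and> int (w' j) < int (w' f) \<and> int (w' f) < int (w' i)"
        using bad_right1[of "int i" "int j" "int b" "int (w' j)" "int (w' i)" "int (w' b)" "int f" "int (w' f)"]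
          cyc'[of i] cyc'[of j] pv'[of i j] ij ba adj w' bi zb wij by (auto simp: f_def)
      then have f: "f < b" "w' j < w' f" "w' f < w' i" by auto
      then have wf: "w' f = w f" using w' fi ba ij by auto
      define e where "e = y f"
      have ye: "y e = f" using Y by (simp add: e_def)
      have fj: "f \<noteq> j" "f \<noteq> a" using f ba ij by auto
      have ne: "e \<noteq> i" "e \<noteq> a" "e \<noteq> j" "e \<noteq> b"
        using fj fi ye ya by (auto simp: a_def b_def)
      have pe: "cycles_ok (int i) (int a) (int (w i)) (int (w a)) (int e) (int f) (int (w e)) (int (w f))"
        "cycles_ok (int j) (int b) (int (w j)) (int (w b)) (int e) (int f) (int (w e)) (int (w f))"
        using pv[of i e] pv[of j e] zf(2) ij ne ye Y(2)[of f] by (auto simp: a_def b_def e_def)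
      have ce: "cycle_ok (int e) (int f) (int (w e)) (int (w f))" using cyc[of e] ye by (simp add: e_def)
      have "int j < int e \<and> int (w i) < int (w e) \<and> int (w e) < int (w f)"
        using bad_right2[OF _ _ _ _ _ _ _ ca cb ce pij pe nb nb] ij ba adj f w' wf by auto
      then have e: "j < e" "w i < w e" "w e < w f" by auto
      show False
      proof (cases "w f = Suc (w e)")
        case True
        have "w' e = w e" using f e wf w' ij by auto
        then have "z e = f"
          by (intro atom_for_adjacent[OF z at'[folded t_def w'_def]]) (use f e ba ij zf True wf Y(2)[of f] in \<open>auto simp: e_def\<close>)
        then have "z f = e" using Z(1)[of e] by auto
        then show False using zf e by simp
      next
        case False
        show False
          by (rule inner[of e f]) (use f e wf w' ye Y(1)[of f] ba ij False in \<open>auto simp: e_def\<close>)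
      qed
    qed
  qed
qed

definition outer_first :: "(nat \<Rightarrow> nat) \<Rightarrow> (nat \<Rightarrow> nat) \<Rightarrow> (nat \<Rightarrow> nat) \<Rightarrow> bool" where
  "outer_first \<beta> y w \<longleftrightarrow>
     (\<forall>a c. a < c \<and> c \<le> y c \<and> y c < y a \<and> \<beta> a = \<beta> c \<longrightarrow> w (y a) < w (y c))"

text \<open>The block map orders letters of different blocks, \<open>cycle_ok\<close> those of one
  cycle, and \<open>canonical_order\<close> all others. So the images are ordered in only one way,
  and the atom that admits no move is unique.\<close>

lemma outer_first_order:
  assumes bl: "mono bl" and y: "partner_map \<beta> y"
    and at: "atom_for bl \<beta> y w" "outer_first \<beta> y w" and at': "atom_for bl \<beta> y w'" "outer_first \<beta> y w'"
    and less: "w u < w v"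
  shows "w' u < w' v"
proof -
  note Y = partner_mapD[OF y] and D = atom_forD[OF at(1)] and D' = atom_forD[OF at'(1)]
  show ?thesis
  proof (cases "\<beta> u = \<beta> v")
    case False
    then show ?thesis
      using monoD[OF bl, of "w u" "w v"] less block_mono_less[OF bl, of "w' u" "w' v"] D(1) D'(1) by simp
  next
    case b: True
    have uv: "u \<noteq> v" using less by auto
    have cyc: "cycle_ok (int v) (int (y v)) (int (w v)) (int (w (y v)))"
        "cycle_ok (int v) (int (y v)) (int (w' v)) (int (w' (y v)))" for v
      using D(2)[of v] D'(2)[of v] by (simp_all add: cyc_at_def)
    show ?thesis
    proof (cases "v = y u")
      case True
      then show ?thesis using cyc[of u] uv less by (auto simp: cycle_ok_def)
    next
      case False
      have mm: "min (int x) (int (y x)) = int (min x (y x))" "max (int x) (int (y x)) = int (max x (y x))" for x by auto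
      have can: "min (int (w p)) (int (w (y p))) < min (int (w q)) (int (w (y q))) \<and> min (int (w' p)) (int (w' (y p))) < min (int (w' q)) (int (w' (y q)))"
        if "min (int p) (int (y p)) < min (int q) (int (y q))" "max (int q) (int (y q)) < max (int p) (int (y p))" "\<beta> p = \<beta> q" for p q
      proof -
        define p0 where "p0 = min p (y p)"
        define q0 where "q0 = min q (y q)"
        have pq: "y p0 = max p (y p)" "y q0 = max q (y q)" "\<beta> p0 = \<beta> q0"
          using Y(1)[of p] Y(1)[of q] Y(2)[of p] Y(2)[of q] that(3) by (auto simp: p0_def q0_def min_def max_def)
        have l: "p0 < q0" "y q0 < y p0" "q0 \<le> y q0"
          using that(1,2) unfolding mm pq by (auto simp: p0_def q0_def)
        have 1: "w (y p0) < w (y q0)" "w' (y p0) < w' (y q0)"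
          using at(2) at'(2) l pq(3) unfolding outer_first_def by blast+
        have 2: "w (max x (y x)) \<le> w (min x (y x))" "w' (max x (y x)) \<le> w' (min x (y x))" for x
          using cyc[of x] by (auto simp: cycle_ok_def min_def max_def)
        have 3: "min (int (w x)) (int (w (y x))) = int (w (max x (y x)))" "min (int (w' x)) (int (w' (y x))) = int (w' (max x (y x)))" for x
          using 2[of x] by (auto simp: min_def max_def split: if_splits)
        show ?thesis using 1 unfolding pq 3 by simp
      qed
      have "int (w' u) < int (w' v)"
      proof (rule canonical_order[OF cyc(1) cyc(1) cyc(2) cyc(2)])
        show "cycles_ok (int u) (int (y u)) (int (w u)) (int (w (y u))) (int v) (int (y v)) (int (w v)) (int (w (y v)))"
          using D(3)[OF b] uv False by (simp add: cyc_pair_def)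
        show "cycles_ok (int u) (int (y u)) (int (w' u)) (int (w' (y u))) (int v) (int (y v)) (int (w' v)) (int (w' (y v)))"
          using D'(3)[OF b] uv False by (simp add: cyc_pair_def)
      qed (use can[of u v] can[of v u] b less in auto)
      then show ?thesis by simp
    qed
  qed
qed

text \<open>The permutation \<open>w' \<circ> inv w\<close> is strictly increasing on all numbers.
  Once ahead of the identity it would stay ahead, but it fixes every number beyond
  \<open>n\<close>.\<close>

lemma permutes_same_order:
  assumes w: "w permutes {1..n :: nat}" "w' permutes {1..n}" and less: "\<And>u v. w u < w v \<Longrightarrow> w' u < w' v"
  shows "w = w'"
proof -
  define f where "f = w' \<circ> inv w"
  have f: "strict_mono f"
    by (rule strict_monoI) (use less permutes_inverses(1)[OF w(1)] in \<open>auto simp: f_def\<close>)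
  have fp: "f permutes {1..n}" using w by (auto simp: f_def intro: permutes_compose permutes_inv)
  have ge: "k \<le> f k" for k using f by (rule strict_mono_imp_increasing)
  have "f k = k" for k
  proof -
    obtain q where q: "f q = k" using permutes_surj[OF fp] by (metis surjD)
    have "q \<le> k" using ge[of q] q by simp
    moreover have "k \<le> q"
    proof (rule ccontr)
      assume "\<not> k \<le> q"
      obtain N where N: "N > n" "N > k" using that[of "Suc (n + k)"] by simp
      have gap: "f (q + d) \<ge> k + d" for d
      proof (induction d)
        case (Suc d)
        then show ?case using strict_monoD[OF f, of "q + d" "q + Suc d"] by auto
      qed (use q in simp)
      have "f (q + N) = q + N" using N by (intro permutes_not_in[OF fp]) auto
      then show False using gap[of N] \<open>\<not> k \<le> q\<close> by simp
    qed
    ultimately show ?thesis using q by simp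
  qed
  then have "w' (inv w (w x)) = w x" for x by (simp add: f_def)
  then show ?thesis using permutes_inverses(2)[OF w(1)] by (auto simp: fun_eq_iff)
qed

text \<open>Moves lower the weight until the canonical atom is reached, and they preserve
  \<open>P\<close>. The property is arbitrary because it is used twice: for the number of inversions
  and for the existence of subwords.\<close>

lemma atoms_connected:
  assumes bl: "mono bl" and y: "partner_map \<beta> y" "y permutes {1..n}"
    and w: "w permutes {1..n}" "atom_for bl \<beta> y w" and w': "w' permutes {1..n}" "atom_for bl \<beta> y w'"
    and step: "\<And>w u c a. w permutes {1..n} \<Longrightarrow> atom_for bl \<beta> y w \<Longrightarrow> pattern_in \<beta> y w 0 n u c a \<Longrightarrow>
      P w \<longleftrightarrow> P (rot (w u) \<circ> w)"
  shows "P w \<longleftrightarrow> P w'"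
proof -
  have *: "\<exists>w0. w0 permutes {1..n} \<and> atom_for bl \<beta> y w0 \<and> outer_first \<beta> y w0 \<and> (P w \<longleftrightarrow> P w0)"
    if "w permutes {1..n}" "atom_for bl \<beta> y w" for w
    using that
  proof (induction "weight n w" arbitrary: w rule: less_induct)
    case less
    show ?case
    proof (cases "outer_first \<beta> y w")
      case False
      then obtain a c where ac: "a < c" "c \<le> y c" "y c < y a" "\<beta> a = \<beta> c" "\<not> w (y a) < w (y c)"
        by (auto simp: outer_first_def)
      then have "w (y c) < w (y a)"
        using permutes_inj[OF less.prems(1)] by (metis inj_eq less_irrefl linorder_neqE_nat)
      from nested_pattern[OF bl y(1) permutes_bij[OF less.prems(1)] less.prems(2) ac(1-4) this]
      obtain u c' a' where p: "pattern_in \<beta> y w (w (y c)) (w a) u c' a'" by blast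
      note R = pattern_rot[OF bl y less.prems p]
      have "w a' \<le> n" using R(4) permutes_in_image[OF less.prems(1)] by (metis atLeastAtMost_iff)
      then have p0: "pattern_in \<beta> y w 0 n u c' a'" using p by (auto simp: pattern_in_def)
      from less.hyps[OF R(3,1,2)] step[OF less.prems p0] show ?thesis by blast
    qed (use less.prems in blast)
  qed
  obtain w0 w1 where "w0 permutes {1..n}" "atom_for bl \<beta> y w0" "outer_first \<beta> y w0" "P w \<longleftrightarrow> P w0"
    "w1 permutes {1..n}" "atom_for bl \<beta> y w1" "outer_first \<beta> y w1" "P w' \<longleftrightarrow> P w1"
    using *[OF w] *[OF w'] by blast
  moreover from this have "w0 = w1"
    using permutes_same_order outer_first_order[OF bl y(1)] by metis
  ultimately show ?thesis by simp
qed

lemma simple_refl_permutes: "m \<in> {1..<n} \<Longrightarrow> simple_refl m permutes {1..n}"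
  unfolding simple_refl_def by (intro permutes_swap_id) auto

lemma comp_simple_refl_permutes: "w permutes {1..n} \<Longrightarrow> m \<in> {1..<n} \<Longrightarrow> w \<circ> simple_refl m permutes {1..n}"
  by (intro permutes_compose simple_refl_permutes)

lemma inj_transpose_apply: "inj f \<Longrightarrow> f (transpose a b x) = transpose (f a) (f b) (f x)"
  by (auto simp: transpose_def inj_eq)

section \<open>Inversions and reduced words\<close>

definition Inv :: "(nat \<Rightarrow> nat) \<Rightarrow> (nat \<times> nat) set" where
  "Inv w = {(p, q). p < q \<and> w q < w p}"

lemma Inv_id [simp]: "Inv id = {}"
  by (auto simp: Inv_def)

lemma Inv_subset:
  assumes "w permutes {1..n}" shows "Inv w \<subseteq> {1..n} \<times> {1..n}"
proof
  fix x assume "x \<in> Inv w"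
  then obtain p q where x: "x = (p, q)" "p < q" "w q < w p" by (auto simp: Inv_def)
  have "p \<in> {1..n}"
  proof (rule ccontr)
    assume "p \<notin> {1..n}"
    then have "p = 0 \<or> n < p" "w p = p" using permutes_not_in[OF assms] by auto
    then show False using x permutes_not_in[OF assms, of q] by auto
  qed
  moreover have "q \<in> {1..n}"
  proof (rule ccontr)
    assume "q \<notin> {1..n}"
    then have "n < q" "w q = q" using x permutes_not_in[OF assms] by auto
    moreover have "w p \<in> {1..n}" using \<open>p \<in> {1..n}\<close> permutes_in_image[OF assms] by blast
    ultimately show False using x by auto
  qed
  ultimately show "x \<in> {1..n} \<times> {1..n}" using x by auto
qed

lemma finite_Inv: "w permutes {1..n} \<Longrightarrow> finite (Inv w)"
  using Inv_subset finite_subset by blast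

lemma simple_refl_less:
  "p < q \<Longrightarrow> (p, q) \<noteq> (m, Suc m) \<Longrightarrow> simple_refl m p < simple_refl m q"
  by (auto simp: simple_refl_def transpose_def)

lemma card_Inv_ascent:
  assumes w: "w permutes {1..n}" and less: "w m < w (Suc m)"
  shows "card (Inv (w \<circ> simple_refl m)) = Suc (card (Inv w))"
proof -
  let ?s = "map_prod (simple_refl m) (simple_refl m)"
  have "Inv (w \<circ> simple_refl m) = insert (m, Suc m) (?s ` Inv w)"
  proof (intro equalityI subsetI)
    fix x assume "x \<in> Inv (w \<circ> simple_refl m)"
    then obtain p q where x: "x = (p, q)" "p < q" "w (simple_refl m q) < w (simple_refl m p)"
      by (auto simp: Inv_def)
    show "x \<in> insert (m, Suc m) (?s ` Inv w)"
    proof (cases "x = (m, Suc m)")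
      case False
      then have "(simple_refl m p, simple_refl m q) \<in> Inv w"
        using simple_refl_less[of p q m] x by (auto simp: Inv_def)
      then have "?s (simple_refl m p, simple_refl m q) \<in> ?s ` Inv w" by (rule imageI)
      then show ?thesis using x by simp
    qed simp
  next
    fix x assume "x \<in> insert (m, Suc m) (?s ` Inv w)"
    then show "x \<in> Inv (w \<circ> simple_refl m)"
    proof
      assume "x \<in> ?s ` Inv w"
      then obtain p q where x: "x = (simple_refl m p, simple_refl m q)" "p < q" "w q < w p"
        by (auto simp: Inv_def)
      then have "(p, q) \<noteq> (m, Suc m)" using less by auto
      then show ?thesis using x simple_refl_less by (auto simp: Inv_def)
    qed (use less in \<open>auto simp: Inv_def\<close>)
  qed
  moreover have "(m, Suc m) \<notin> ?s ` Inv w"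
  proof
    assume "(m, Suc m) \<in> ?s ` Inv w"
    then obtain p q where pq: "m = simple_refl m p" "Suc m = simple_refl m q" "p < q" by (auto simp: Inv_def)
    have "p = Suc m" using arg_cong[OF pq(1), of "simple_refl m"] by simp
    moreover have "q = m" using arg_cong[OF pq(2), of "simple_refl m"] by simp
    ultimately show False using pq(3) by simp
  qed
  moreover have "inj_on ?s (Inv w)" by (auto simp: inj_on_def)
  ultimately show ?thesis using finite_Inv[OF w] by (simp add: card_image)
qed

lemma card_Inv_descent:
  assumes w: "w permutes {1..n}" "m \<in> {1..<n}" and less: "w (Suc m) < w m"
  shows "card (Inv w) = Suc (card (Inv (w \<circ> simple_refl m)))"
  using card_Inv_ascent[OF comp_simple_refl_permutes[OF w], of m] less by simp

lemma card_Inv_transpose: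
  assumes w: "w permutes {1..n}" and t: "w \<circ> transpose i j permutes {1..n}" and ij: "i < j" "w i < w j"
  shows "card (Inv w) < card (Inv (w \<circ> transpose i j))"
proof -
  define t where "t = transpose i j"
  have tt: "t (t x) = x" "t i = j" "t j = i" "x \<noteq> i \<Longrightarrow> x \<noteq> j \<Longrightarrow> t x = x" for x
    by (auto simp: t_def)
  \<comment> \<open>An inversion is relabelled by \<open>t\<close> unless that reverses its two
    entries. In the exceptional case one entry is \<open>i\<close> or \<open>j\<close>, the other
    lies between them, and the pair is an inversion of the product as it stands. The pair
    \<open>(i, j)\<close> is never hit, which makes the count strict.\<close>
  define g where "g = (\<lambda>(p, q). if t p < t q then (t p, t q) else (p, q))"
  have "g ` Inv w \<subseteq> Inv (w \<circ> t) - {(i, j)}"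
  proof
    fix x assume "x \<in> g ` Inv w"
    then obtain p q where pq: "p < q" "w q < w p" and x: "x = g (p, q)" by (auto simp: Inv_def)
    show "x \<in> Inv (w \<circ> t) - {(i, j)}"
    proof (cases "t p < t q")
      case True
      then have "t p \<noteq> i \<or> t q \<noteq> j" using tt(1)[of p] tt(1)[of q] tt(2,3) pq(1) ij by auto
      then show ?thesis using True pq x tt by (auto simp: g_def Inv_def)
    next
      case False
      then have x': "x = (p, q)" by (simp add: x g_def)
      have "(p = i \<and> i < q \<and> q < j) \<or> (q = j \<and> i < p \<and> p < j)"
        using False pq ij by (auto simp: t_def transpose_def split: if_splits)
      then show ?thesis using x' pq ij tt by (auto simp: Inv_def)
    qed
  qed
  moreover have "inj_on g (Inv w)"
  proof (rule inj_onI)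
    fix x x' assume "x \<in> Inv w" "x' \<in> Inv w" and g: "g x = g x'"
    then obtain p q p' q' where x: "x = (p, q)" "p < q" "w q < w p" "x' = (p', q')" "p' < q'" "w q' < w p'"
      by (auto simp: Inv_def)
    have *: False if "p < q" "p' < q'" "t p < t q" "\<not> t p' < t q'" "(p', q') = (t p, t q)" for p q p' q'
      using that tt(1)[of p] tt(1)[of q] by auto
    have tinj: "t y = t y' \<longleftrightarrow> y = y'" for y y' by (metis tt(1))
    show "x = x'"
    proof (cases "t p < t q"; cases "t p' < t q'")
      assume "t p < t q" "t p' < t q'"
      then have "t p = t p'" "t q = t q'" using g x by (simp_all add: g_def)
      then show ?thesis using x tinj by simp
    next
      assume "t p < t q" "\<not> t p' < t q'"
      then show ?thesis using g x *[of p q p' q'] by (simp add: g_def)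
    next
      assume "\<not> t p < t q" "t p' < t q'"
      then show ?thesis using g x *[of p' q' p q] by (simp add: g_def)
    next
      assume "\<not> t p < t q" "\<not> t p' < t q'"
      then show ?thesis using g x by (simp add: g_def)
    qed
  qed
  moreover have "finite (Inv (w \<circ> t))" using finite_Inv[OF t] by (simp add: t_def)
  moreover have "(i, j) \<in> Inv (w \<circ> t)" using ij tt by (simp add: Inv_def)
  ultimately have "card (g ` Inv w) \<le> card (Inv (w \<circ> t) - {(i, j)})" "card (g ` Inv w) = card (Inv w)"
      "card (Inv (w \<circ> t) - {(i, j)}) < card (Inv (w \<circ> t))"
    by (auto intro!: card_mono card_image card_Diff1_less simp del: card_Diff_insert)
  then show ?thesis by (simp add: t_def)
qed

lemma transpose_permutes: "i \<in> {1..n} \<Longrightarrow> j \<in> {1..n} \<Longrightarrow> w permutes {1..n} \<Longrightarrow> w \<circ> transpose i j permutes {1..n :: nat}"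
  by (intro permutes_compose permutes_swap_id)

lemma Inv_cover:
  assumes w: "w permutes {1..n}" and ij: "1 \<le> i" "i < j" "j \<le> n"
    and cov: "card (Inv (w \<circ> transpose i j)) = card (Inv w) + 1"
  shows "w i < w j" "i < v \<Longrightarrow> v < j \<Longrightarrow> \<not> (w i < w v \<and> w v < w j)"
proof -
  have wi: "w x = w v \<longleftrightarrow> x = v" for x v using permutes_inj[OF w] by (auto simp: inj_eq)
  have P: "w \<circ> transpose x v permutes {1..n}" if "w permutes {1..n}" "x \<in> {1..n}" "v \<in> {1..n}" for w x v
    using transpose_permutes that by blast
  have I: "i \<in> {1..n}" "j \<in> {1..n}" using ij by auto
  show "w i < w j"
  proof (rule ccontr)
    assume "\<not> w i < w j"
    then have "w j < w i" using wi[of i j] ij by auto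
    then have "card (Inv (w \<circ> transpose i j)) < card (Inv (w \<circ> transpose i j \<circ> transpose i j))"
      by (intro card_Inv_transpose[OF P[OF w I] P[OF P[OF w I] I]]) (use ij in auto)
    then show False using cov by (simp add: comp_assoc)
  qed
  show "\<not> (w i < w v \<and> w v < w j)" if v: "i < v" "v < j"
  proof
    assume *: "w i < w v \<and> w v < w j"
    have V: "v \<in> {1..n}" using v ij by auto
    \<comment> \<open>A letter between \<open>i\<close> and \<open>j\<close> in size and in position
      factors the transposition into those of \<open>(i, v)\<close>, \<open>(v, j)\<close> and
      \<open>(i, v)\<close>. Each factor raises the number of inversions, so the total rise would be
      at least three.\<close>
    define w1 where "w1 = w \<circ> transpose i v"
    define w2 where "w2 = w1 \<circ> transpose v j"
    have w1: "w1 permutes {1..n}" and w2: "w2 permutes {1..n}"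
      using P w I V by (auto simp: w1_def w2_def)
    have "w2 \<circ> transpose i v = w \<circ> transpose i j"
      using v by (auto simp: w1_def w2_def fun_eq_iff transpose_def)
    moreover have "card (Inv w) < card (Inv w1)"
      unfolding w1_def by (rule card_Inv_transpose[OF w P[OF w I(1) V]]) (use v * in auto)
    moreover have "card (Inv w1) < card (Inv w2)"
      unfolding w2_def by (rule card_Inv_transpose[OF w1 P[OF w1 V I(2)]]) (use v * in \<open>auto simp: w1_def\<close>)
    moreover have "card (Inv w2) < card (Inv (w2 \<circ> transpose i v))"
      by (rule card_Inv_transpose[OF w2 P[OF w2 I(1) V]]) (use v * in \<open>auto simp: w1_def w2_def\<close>)
    ultimately show False using cov by simp
  qed
qed

lemma word_prod_simps [simp]:
  "word_prod [] = id" "word_prod (m # a) = simple_refl m \<circ> word_prod a"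
  "word_prod (a @ b) = word_prod a \<circ> word_prod b"
proof -
  show "word_prod [] = id" "word_prod (m # a) = simple_refl m \<circ> word_prod a" for m a
    by (simp_all add: word_prod_def)
  then show "word_prod (a @ b) = word_prod a \<circ> word_prod b"
    by (induction a) (simp_all add: comp_assoc)
qed

lemma word_prod_snoc: "word_prod (a @ [m]) = word_prod a \<circ> simple_refl m"
  by (simp add: word_prod_simps)

lemma word_prod_permutes: "set a \<subseteq> {1..<n} \<Longrightarrow> word_prod a permutes {1..n}"
proof (induction a)
  case (Cons m a)
  then show ?case
    unfolding word_prod_simps by (intro permutes_compose simple_refl_permutes) auto
qed (simp add: permutes_id)

lemma no_descent_id:
  assumes w: "w permutes {1..n :: nat}" and asc: "\<And>m. m \<in> {1..<n} \<Longrightarrow> w m < w (Suc m)"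
  shows "w = id"
proof (rule permutes_same_order[OF _ permutes_id, symmetric, THEN sym])
  show "w permutes {1..n}" by (rule w)
  fix u v assume "w u < w v"
  have step: "w p < w (Suc p)" for p
  proof (cases "p \<in> {1..<n}")
    case False
    then consider "p = 0" | "p \<ge> n" "p > 0" by fastforce
    then show ?thesis
    proof cases
      case 1
      then show ?thesis
        using permutes_not_in[OF w, of 0] inj_eq[OF permutes_inj[OF w], of "Suc 0" 0] by simp
    next
      case 2
      then have "w (Suc p) = Suc p" by (intro permutes_not_in[OF w]) auto
      moreover have "w p \<le> p"
      proof (cases "p = n")
        case True
        then show ?thesis using 2 permutes_in_image[OF w, of n] by auto
      next
        case False
        then show ?thesis using 2 permutes_not_in[OF w, of p] by auto
      qed
      ultimately show ?thesis by simp
    qed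
  qed (use asc in auto)
  have "strict_mono w" using step by (simp add: strict_mono_Suc_iff)
  then show "id u < id v" using \<open>w u < w v\<close> by (simp add: strict_mono_less)
qed

lemma exists_reduced:
  assumes "w permutes {1..n}"
  shows "\<exists>a. set a \<subseteq> {1..<n} \<and> word_prod a = w \<and> length a = card (Inv w)"
  using assms
proof (induction "card (Inv w)" arbitrary: w rule: less_induct)
  case less
  show ?case
  proof (cases "\<exists>m \<in> {1..<n}. w (Suc m) < w m")
    case True
    then obtain m where m: "m \<in> {1..<n}" "w (Suc m) < w m" by blast
    note c = card_Inv_descent[OF less.prems m]
    then obtain a where "set a \<subseteq> {1..<n}" "word_prod a = w \<circ> simple_refl m" "length a = card (Inv (w \<circ> simple_refl m))"
      using less.hyps[OF _ comp_simple_refl_permutes[OF less.prems m(1)]] by auto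
    then show ?thesis using m(1) c by (intro exI[of _ "a @ [m]"]) auto
  next
    case False
    have "w = id"
    proof (rule no_descent_id[OF less.prems])
      fix m assume "m \<in> {1..<n}"
      then show "w m < w (Suc m)"
        using False permutes_inj[OF less.prems] by (metis inj_eq linorder_neqE_nat n_not_Suc_n)
    qed
    then show ?thesis by (intro exI[of _ "[]"]) (simp add: Inv_id)
  qed
qed

lemma card_Inv_word: "set a \<subseteq> {1..<n} \<Longrightarrow> card (Inv (word_prod a)) \<le> length a"
proof (induction a rule: rev_induct)
  case (snoc m a)
  then have w: "word_prod a permutes {1..n}" by (intro word_prod_permutes) auto
  have "word_prod a m \<noteq> word_prod a (Suc m)" using permutes_inj[OF w] by (auto simp: inj_eq)
  then consider "word_prod a m < word_prod a (Suc m)" | "word_prod a (Suc m) < word_prod a m" by linarith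
  then have "card (Inv (word_prod a \<circ> simple_refl m)) \<le> Suc (card (Inv (word_prod a)))"
    using card_Inv_ascent[OF w, of m] card_Inv_descent[OF w, of m] snoc.prems by cases simp_all
  moreover have "card (Inv (word_prod a)) \<le> length a" using snoc by simp
  moreover have l: "length (a @ [m]) = Suc (length a)" by simp
  ultimately show ?case unfolding word_prod_snoc l by linarith
qed (simp only: word_prod_simps Inv_id, simp)

lemma cox_length_eq:
  assumes "w permutes {1..n}"
  shows "cox_length n w = card (Inv w)"
  unfolding cox_length_def
proof (rule Least_equality)
  show "\<exists>a. set a \<subseteq> {1..<n} \<and> length a = card (Inv w) \<and> word_prod a = w"
    using exists_reduced[OF assms] by blast
qed (use card_Inv_word in blast)

lemma reduced_word_iff:
  "reduced_word n w a \<longleftrightarrow> set a \<subseteq> {1..<n} \<and> word_prod a = w \<and> length a = card (Inv w)"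
  using cox_length_eq[OF word_prod_permutes[of a n]] by (auto simp: reduced_word_def)

lemma reduced_word_exists: "w permutes {1..n} \<Longrightarrow> \<exists>a. reduced_word n w a"
  using exists_reduced[of w n] by (simp add: reduced_word_iff)

lemma reduced_word_permutes: "reduced_word n w a \<Longrightarrow> w permutes {1..n}"
  using word_prod_permutes by (auto simp: reduced_word_iff)

lemma comp_simple_refl_eq: "f \<circ> simple_refl m = g \<longleftrightarrow> f = g \<circ> simple_refl m"
  by auto

lemma reduced_word_snoc:
  "reduced_word n w (a @ [m]) \<longleftrightarrow> m \<in> {1..<n} \<and> w (Suc m) < w m \<and> reduced_word n (w \<circ> simple_refl m) a"
proof (cases "m \<in> {1..<n} \<and> set a \<subseteq> {1..<n} \<and> word_prod a = w \<circ> simple_refl m")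
  case True
  then have v: "w \<circ> simple_refl m permutes {1..n}" using word_prod_permutes[of a n] by auto
  have w: "w permutes {1..n}" using comp_simple_refl_permutes[OF v, of m] True by simp
  have le: "card (Inv (w \<circ> simple_refl m)) \<le> length a" using card_Inv_word[of a n] True by simp
  have "w m \<noteq> w (Suc m)" using permutes_inj[OF w] by (auto simp: inj_eq)
  then consider "w m < w (Suc m)" | "w (Suc m) < w m" by linarith
  then show ?thesis
    using card_Inv_ascent[OF w, of m] card_Inv_descent[OF w, of m] True le
    by cases (auto simp: reduced_word_iff)
next
  case False
  have "word_prod a = w \<circ> simple_refl m \<longleftrightarrow> word_prod a \<circ> simple_refl m = w"
    by (simp only: comp_simple_refl_eq)
  then show ?thesis using False by (auto simp: reduced_word_iff)
qed

section \<open>Exchange, deletion and subwords\<close>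

lemma exchange:
  assumes "set a \<subseteq> {1..<n}" "p < q" "word_prod a q < word_prod a p"
  shows "\<exists>a1 k a2. a = a1 @ k # a2 \<and> word_prod a \<circ> transpose p q = word_prod (a1 @ a2)"
  using assms
proof (induction a arbitrary: p q rule: rev_induct)
  case (snoc k a)
  show ?case
  proof (cases "(p, q) = (k, Suc k)")
    case True
    then have "word_prod (a @ [k]) \<circ> transpose p q = word_prod (a @ [])"
      by (simp flip: simple_refl_def)
    then show ?thesis by blast
  next
    case False
    then have "simple_refl k p < simple_refl k q" using snoc.prems simple_refl_less by auto
    moreover have "set a \<subseteq> {1..<n}" "word_prod a (simple_refl k q) < word_prod a (simple_refl k p)"
      using snoc.prems by simp_all
    ultimately obtain a1 l a2 where a: "a = a1 @ l # a2"
      "word_prod a \<circ> transpose (simple_refl k p) (simple_refl k q) = word_prod (a1 @ a2)"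
      using snoc.IH by blast
    have inj: "inj (simple_refl k)" by (auto simp: inj_def)
    have "word_prod (a @ [k]) \<circ> transpose p q = word_prod (a1 @ (a2 @ [k]))"
    proof
      fix x
      show "(word_prod (a @ [k]) \<circ> transpose p q) x = word_prod (a1 @ (a2 @ [k])) x"
        using fun_cong[OF a(2), of "simple_refl k x"] by (simp add: inj_transpose_apply[OF inj])
    qed
    moreover have "a @ [k] = a1 @ l # (a2 @ [k])" using a(1) by simp
    ultimately show ?thesis by blast
  qed
qed simp

text \<open>Conjugating the deleted reflection by the tail \<open>a2\<close> moves it to the right
  end, where it becomes the transposition of the preimages of \<open>k\<close> and
  \<open>Suc k\<close> under the tail.\<close>

lemma deletion_transpose:
  assumes "set (a1 @ k # a2) \<subseteq> {1..<n}"
  shows "\<exists>i j. 1 \<le> i \<and> i < j \<and> j \<le> n \<and> word_prod (a1 @ k # a2) = word_prod (a1 @ a2) \<circ> transpose i j"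
proof -
  let ?f = "word_prod a2"
  have f: "?f permutes {1..n}" using assms by (intro word_prod_permutes) auto
  define i where "i = inv ?f k"
  define j where "j = inv ?f (Suc k)"
  have fi: "?f i = k" "?f j = Suc k" using permutes_inverses(1)[OF f] by (auto simp: i_def j_def)
  have "?f i \<in> {1..n}" "?f j \<in> {1..n}" using fi assms by auto
  then have "i \<in> {1..n}" "j \<in> {1..n}" using permutes_in_image[OF f] by blast+
  moreover have "i \<noteq> j" using fi by auto
  moreover have *: "word_prod (a1 @ k # a2) = word_prod (a1 @ a2) \<circ> transpose i j"
    by (simp add: fun_eq_iff inj_transpose_apply[OF permutes_inj[OF f]] fi simple_refl_def)
  moreover have "word_prod (a1 @ k # a2) = word_prod (a1 @ a2) \<circ> transpose j i"
    using * by (simp only: transpose_commute)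
  ultimately consider "1 \<le> i \<and> i < j \<and> j \<le> n \<and> word_prod (a1 @ k # a2) = word_prod (a1 @ a2) \<circ> transpose i j"
    | "1 \<le> j \<and> j < i \<and> i \<le> n \<and> word_prod (a1 @ k # a2) = word_prod (a1 @ a2) \<circ> transpose j i"
    by (metis atLeastAtMost_iff linorder_neqE_nat)
  then show ?thesis by cases blast+
qed

lemma subseq_snoc:
  "subseq c (b @ [m]) \<longleftrightarrow> subseq c b \<or> (\<exists>c'. c = c' @ [m] \<and> subseq c' b)"
proof
  assume "subseq c (b @ [m])"
  then obtain c1 c2 where c: "c = c1 @ c2" "subseq c1 b" "subseq c2 [m]" by (elim subseq_appendE)
  from c(3) have "c2 = [] \<or> c2 = [m]" by (cases c2) (auto split: if_splits dest: list_emb_Nil2)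
  then show "subseq c b \<or> (\<exists>c'. c = c' @ [m] \<and> subseq c' b)" using c by auto
next
  assume "subseq c b \<or> (\<exists>c'. c = c' @ [m] \<and> subseq c' b)"
  then show "subseq c (b @ [m])" by (auto intro: subseq_rev_drop_many list_emb_append_mono)
qed

text \<open>The letters are read from the left: one that produces a descent is absorbed by deleting
  an earlier letter with \<open>exchange\<close>.\<close>

lemma reduced_subword:
  assumes "set c \<subseteq> {1..<n}"
  shows "\<exists>a. subseq a c \<and> reduced_word n (word_prod c) a"
  using assms
proof (induction c rule: rev_induct)
  case Nil
  have "reduced_word n (word_prod []) []"
    unfolding reduced_word_iff by (simp only: word_prod_simps Inv_id) simp
  then show ?case by blast
next
  case (snoc m c)
  then obtain a where a: "subseq a c" "reduced_word n (word_prod c) a" by auto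
  let ?v = "word_prod c"
  have v: "?v permutes {1..n}" using a(2) by (rule reduced_word_permutes)
  have "?v m \<noteq> ?v (Suc m)" using permutes_inj[OF v] by (auto simp: inj_eq)
  then consider "?v m < ?v (Suc m)" | "?v (Suc m) < ?v m" by linarith
  then show ?case
  proof cases
    case 1
    then have "reduced_word n (word_prod (c @ [m])) (a @ [m])"
      unfolding reduced_word_snoc using a(2) snoc.prems by simp
    moreover have "subseq (a @ [m]) (c @ [m])" using a(1) by (simp add: subseq_snoc)
    ultimately show ?thesis by blast
  next
    case 2
    have sa: "set a \<subseteq> {1..<n}" "word_prod a = ?v" "length a = card (Inv ?v)" using a(2) by (auto simp: reduced_word_iff)
    obtain a1 k a2 where e: "a = a1 @ k # a2" "word_prod a \<circ> transpose m (Suc m) = word_prod (a1 @ a2)"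
      using exchange[OF sa(1), of m "Suc m"] 2 sa(2) by auto
    have m: "m \<in> {1..<n}" using snoc.prems by simp
    have "reduced_word n (word_prod (c @ [m])) (a1 @ a2)"
      using m e sa card_Inv_descent[OF v m 2] by (auto simp: reduced_word_iff simple_refl_def)
    have "subseq (a1 @ a2) a" unfolding e(1)
      by (rule list_emb_append_mono[OF subseq_order.order_refl list_emb_Cons[OF subseq_order.order_refl]])
    then have "subseq (a1 @ a2) c" using a(1) by (rule subseq_order.order_trans)
    then have "subseq (a1 @ a2) (c @ [m])" by (simp add: subseq_snoc)
    then show ?thesis using \<open>reduced_word n (word_prod (c @ [m])) (a1 @ a2)\<close> by blast
  qed
qed

text \<open>For a reduced word this is the interval below its product in the Bruhat order of the
  symmetric group.\<close>

definition Sub :: "nat list \<Rightarrow> (nat \<Rightarrow> nat) set" where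
  "Sub b = word_prod ` {c. subseq c b}"

lemma Sub_snoc: "Sub (b @ [m]) = Sub b \<union> (\<lambda>x. x \<circ> simple_refl m) ` Sub b"
proof -
  have "{c. subseq c (b @ [m])} = {c. subseq c b} \<union> (\<lambda>c. c @ [m]) ` {c. subseq c b}"
    by (auto simp: subseq_snoc)
  then show ?thesis by (simp add: Sub_def image_Un image_image)
qed

lemma simple_refl_commute: "Suc i < j \<Longrightarrow> simple_refl i \<circ> simple_refl j = simple_refl j \<circ> simple_refl i"
  by (auto simp: fun_eq_iff simple_refl_def transpose_def)

lemma simple_refl_braid:
  "simple_refl i \<circ> simple_refl (Suc i) \<circ> simple_refl i = simple_refl (Suc i) \<circ> simple_refl i \<circ> simple_refl (Suc i)"
  by (auto simp: fun_eq_iff simple_refl_def transpose_def)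

text \<open>Induction as in Matsumoto's theorem, carried out for \<open>Sub\<close> directly. If two
  reduced words end in different letters \<open>i\<close> and \<open>j\<close>, both are descents of
  \<open>w\<close>, so \<open>w\<close> also has reduced words ending in either expression of the
  longest element generated by these two reflections. They serve as intermediate words.\<close>

lemma Sub_reduced_word:
  "reduced_word n w b \<Longrightarrow> reduced_word n w b' \<Longrightarrow> Sub b = Sub b'"
proof (induction "length b" arbitrary: w b b' rule: less_induct)
  case less
  have IH: "Sub c = Sub d" if "reduced_word n v c" "reduced_word n v d" "length c < length b" for v c d
    using less.hyps that by blast
  have len: "length b = length b'" using less.prems by (simp add: reduced_word_iff)
  have main: "Sub (c @ [i]) = Sub (c' @ [j])"
    if r: "reduced_word n w (c @ [i])" "reduced_word n w (c' @ [j])" and l: "length c < length b" "length c' < length b"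
      and ij: "i < j" for c i c' j
  proof -
    note r' = r[unfolded reduced_word_snoc]
    have w: "w permutes {1..n}" using r(1) by (rule reduced_word_permutes)
    have ip: "i \<in> {1..<n}" "j \<in> {1..<n}" using r' by auto
    show ?thesis
    proof (cases "j = Suc i")
      case False
      then have ij': "Suc i < j" using ij by simp
      let ?x = "w \<circ> simple_refl i \<circ> simple_refl j"
      have x: "?x permutes {1..n}" using w ip by (intro comp_simple_refl_permutes)
      then obtain d where d: "reduced_word n ?x d" using reduced_word_exists by blast
      have x': "?x = w \<circ> simple_refl j \<circ> simple_refl i"
        using simple_refl_commute[OF ij'] by (simp add: comp_assoc)
      have 1: "reduced_word n (w \<circ> simple_refl i) (d @ [j])"
        unfolding reduced_word_snoc using d r' ij' by (simp add: simple_refl_other)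
      have 2: "reduced_word n (w \<circ> simple_refl j) (d @ [i])"
        unfolding reduced_word_snoc using d r' ij' x' by (simp add: simple_refl_other)
      have "Sub c = Sub (d @ [j])" "Sub c' = Sub (d @ [i])"
        using IH 1 2 r' l by blast+
      then show ?thesis
        using simple_refl_commute[OF ij'] by (auto simp: Sub_snoc image_Un image_image comp_assoc)
    next
      case True
      let ?x = "w \<circ> simple_refl i \<circ> simple_refl j \<circ> simple_refl i"
      have x: "?x permutes {1..n}" using w ip by (intro comp_simple_refl_permutes)
      then obtain d where d: "reduced_word n ?x d" using reduced_word_exists by blast
      have x': "?x = w \<circ> simple_refl j \<circ> simple_refl i \<circ> simple_refl j"
        using simple_refl_braid[of i] True by (simp add: comp_assoc)
      have dec: "w (Suc i) < w i" "w (Suc (Suc i)) < w (Suc i)" using r' True by auto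
      have 1: "reduced_word n (w \<circ> simple_refl i) ((d @ [i]) @ [j])"
        unfolding reduced_word_snoc using d r' dec True by (simp add: simple_refl_other)
      have 2: "reduced_word n (w \<circ> simple_refl j) ((d @ [j]) @ [i])"
        unfolding reduced_word_snoc using d[unfolded x'] r' dec True by (simp add: simple_refl_other)
      have cd: "Sub c = Sub ((d @ [i]) @ [j])" "Sub c' = Sub ((d @ [j]) @ [i])"
        using IH 1 2 r' l by blast+
      \<comment> \<open>The six sets below correspond to the six elements generated by the two
        reflections; only the last is written differently on the two sides, and the braid relation
        identifies it.\<close>
      define R where "R = (\<lambda>f :: nat \<Rightarrow> nat. (\<lambda>x. x \<circ> f) ` Sub d)"
      have "Sub (c @ [i]) = Sub d \<union> R (simple_refl i) \<union> R (simple_refl j) \<union> R (simple_refl i \<circ> simple_refl j)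
          \<union> R (simple_refl j \<circ> simple_refl i) \<union> R (simple_refl i \<circ> (simple_refl j \<circ> simple_refl i))"
        unfolding Sub_snoc cd(1) R_def by (simp add: image_Un image_image comp_assoc) blast
      moreover have "Sub (c' @ [j]) = Sub d \<union> R (simple_refl i) \<union> R (simple_refl j) \<union> R (simple_refl i \<circ> simple_refl j)
          \<union> R (simple_refl j \<circ> simple_refl i) \<union> R (simple_refl j \<circ> (simple_refl i \<circ> simple_refl j))"
        unfolding Sub_snoc cd(2) R_def by (simp add: image_Un image_image comp_assoc) blast
      ultimately show ?thesis
        using simple_refl_braid[of i] True by (simp add: comp_assoc)
    qed
  qed
  show ?case
  proof (cases b rule: rev_cases)
    case Nil
    then show ?thesis using len by simp
  next
    case (snoc c i)
    then obtain c' j where b': "b' = c' @ [j]" using len by (cases b' rule: rev_cases) auto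
    have l: "length c < length b" "length c' < length b" using snoc b' len by auto
    consider "i < j" | "j < i" | "i = j" by linarith
    then show ?thesis
    proof cases
      case 3
      then have "Sub c = Sub c'"
        using IH[of "w \<circ> simple_refl i" c c'] less.prems l(1) by (simp add: snoc b' reduced_word_snoc)
      then show ?thesis by (simp add: snoc b' Sub_snoc 3)
    qed (use main less.prems snoc b' l in auto)
  qed
qed

section \<open>Ranks and blocks of positions\<close>

lemma rank_in_mono: "finite V \<Longrightarrow> u \<in> V \<Longrightarrow> v \<in> V \<Longrightarrow> u < v \<Longrightarrow> rank_in V u < rank_in V v"
proof -
  assume "finite V" "u \<in> V" "v \<in> V" "u < v"
  moreover from this have "v \<in> {y \<in> V. y \<le> v}" "v \<notin> {y \<in> V. y \<le> u}" "{y \<in> V. y \<le> u} \<subseteq> {y \<in> V. y \<le> v}" by auto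
  then have "{y \<in> V. y \<le> u} \<subset> {y \<in> V. y \<le> v}" by blast
  ultimately show ?thesis unfolding rank_in_def by (intro psubset_card_mono) auto
qed

lemma rank_in_less_iff: "finite V \<Longrightarrow> u \<in> V \<Longrightarrow> v \<in> V \<Longrightarrow> rank_in V u < rank_in V v \<longleftrightarrow> u < v"
  using rank_in_mono[of V u v] rank_in_mono[of V v u] by (cases u v rule: linorder_cases) auto

lemma rank_in_eq_iff: "finite V \<Longrightarrow> u \<in> V \<Longrightarrow> v \<in> V \<Longrightarrow> rank_in V u = rank_in V v \<longleftrightarrow> u = v"
  using rank_in_mono[of V u v] rank_in_mono[of V v u] by (cases u v rule: linorder_cases) auto

lemma rank_in_range:
  assumes "finite V" "v \<in> V"
  shows "rank_in V v \<in> {1..card V}"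
proof -
  have "card {y \<in> V. y \<le> v} \<le> card V" using assms by (intro card_mono) auto
  moreover have "card {y \<in> V. y \<le> v} > 0" using assms by (auto simp: card_gt_0_iff)
  ultimately show ?thesis by (simp add: rank_in_def)
qed

lemma sorted_list_nth_mem: "finite V \<Longrightarrow> k < card V \<Longrightarrow> sorted_list_of_set V ! k \<in> V"
  using sorted_list_of_set_nth_image by blast

lemma nth_rank_in:
  assumes "finite V" "v \<in> V"
  shows "sorted_list_of_set V ! (rank_in V v - 1) = v"
proof -
  have k: "rank_in V v - 1 < card V" "Suc (rank_in V v - 1) = rank_in V v"
    using rank_in_range[OF assms] by auto
  show ?thesis
    using rank_in_sorted_list_of_set[OF assms(1) k(1)] k(2)
      rank_in_eq_iff[OF assms(1) sorted_list_nth_mem[OF assms(1) k(1)] assms(2)] by simp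
qed

lemma rank_in_surj:
  assumes "finite V" "q \<in> {1..card V}"
  obtains v where "v \<in> V" "rank_in V v = q"
proof -
  have q: "q - 1 < card V" "Suc (q - 1) = q" using assms(2) by auto
  show ?thesis
    by (rule that[OF sorted_list_nth_mem[OF assms(1) q(1)]]) (use rank_in_sorted_list_of_set[OF assms(1) q(1)] q(2) in simp)
qed

lemma rank_in_Suc:
  assumes "finite V" "m \<in> V" "Suc m \<in> V"
  shows "rank_in V (Suc m) = Suc (rank_in V m)"
proof -
  have "{y \<in> V. y \<le> Suc m} = insert (Suc m) {y \<in> V. y \<le> m}" using assms by (auto simp: le_Suc_eq)
  then show ?thesis using assms by (simp add: rank_in_def)
qed

lemma rank_in_simple_refl:
  assumes V: "finite V" "m \<in> V" "Suc m \<in> V" and v: "v \<in> V"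
  shows "simple_refl m v \<in> V" "rank_in V (simple_refl m v) = simple_refl (rank_in V m) (rank_in V v)"
proof -
  consider "v = m" | "v = Suc m" | "v \<noteq> m" "v \<noteq> Suc m" by blast
  then have "simple_refl m v \<in> V \<and> rank_in V (simple_refl m v) = simple_refl (rank_in V m) (rank_in V v)"
  proof cases
    case 3
    then have "rank_in V v \<noteq> rank_in V m" "rank_in V v \<noteq> Suc (rank_in V m)"
      using rank_in_eq_iff[OF V(1) v V(2)] rank_in_eq_iff[OF V(1) v V(3)] rank_in_Suc[OF V] by auto
    then show ?thesis using 3 v by (simp add: simple_refl_other)
  qed (use V rank_in_Suc[OF V] in auto)
  then show "simple_refl m v \<in> V" "rank_in V (simple_refl m v) = simple_refl (rank_in V m) (rank_in V v)" by auto
qed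

lemma offset_Suc: "r < length \<mu> \<Longrightarrow> offset \<mu> (Suc r) = offset \<mu> r + \<mu> ! r"
  by (simp add: offset_def take_Suc_conv_app_nth)

lemma offset_0 [simp]: "offset \<mu> 0 = 0"
  by (simp add: offset_def)

lemma offset_mono: "r \<le> s \<Longrightarrow> offset \<mu> r \<le> offset \<mu> s"
proof -
  assume "r \<le> s"
  then have "take s \<mu> = take r \<mu> @ take (s - r) (drop r \<mu>)" by (metis le_add_diff_inverse take_add)
  then show ?thesis by (simp add: offset_def)
qed

lemma offset_le: "offset \<mu> r \<le> sum_list \<mu>"
proof -
  have "sum_list \<mu> = sum_list (take r \<mu>) + sum_list (drop r \<mu>)" by (metis append_take_drop_id sum_list_append)
  then show ?thesis by (simp add: offset_def)
qed

definition positions :: "nat list \<Rightarrow> nat \<Rightarrow> nat set" where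
  "positions \<mu> r = {offset \<mu> r + 1..offset \<mu> r + \<mu> ! r}"

text \<open>Counting the parts that end before \<open>p\<close> gives a function monotone on all
  numbers: 0 gets index 0, and every position beyond the last one gets index
  \<open>length \<mu>\<close>. Thus \<open>atom_for\<close> can be used without range
  conditions.\<close>

definition blk :: "nat list \<Rightarrow> nat \<Rightarrow> nat" where
  "blk \<mu> p = card {r. r < length \<mu> \<and> offset \<mu> (Suc r) < p}"

lemma mono_blk: "mono (blk \<mu>)"
proof (rule monoI)
  fix p q :: nat assume "p \<le> q"
  then show "blk \<mu> p \<le> blk \<mu> q" unfolding blk_def by (intro card_mono) auto
qed

lemma blk_positions:
  assumes "r < length \<mu>" "p \<in> positions \<mu> r"
  shows "blk \<mu> p = r"
proof -
  have "{s. s < length \<mu> \<and> offset \<mu> (Suc s) < p} = {..<r}"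
  proof (intro equalityI subsetI)
    fix s assume "s \<in> {s. s < length \<mu> \<and> offset \<mu> (Suc s) < p}"
    then have s: "s < length \<mu>" "offset \<mu> (Suc s) < p" by auto
    show "s \<in> {..<r}"
    proof (rule ccontr)
      assume "s \<notin> {..<r}"
      then have "offset \<mu> (Suc r) \<le> offset \<mu> (Suc s)" by (intro offset_mono) auto
      then show False using s assms offset_Suc[OF assms(1)] by (auto simp: positions_def)
    qed
  next
    fix s assume "s \<in> {..<r}"
    then have "s < length \<mu>" "offset \<mu> (Suc s) \<le> offset \<mu> r" using assms by (auto intro: offset_mono)
    then show "s \<in> {s. s < length \<mu> \<and> offset \<mu> (Suc s) < p}" using assms(2) by (auto simp: positions_def)
  qed
  then show ?thesis by (simp add: blk_def)
qed

lemma positions_blk: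
  assumes "p \<in> {1..sum_list \<mu>}"
  shows "blk \<mu> p < length \<mu>" "p \<in> positions \<mu> (blk \<mu> p)"
proof -
  define r where "r = (LEAST s. p \<le> offset \<mu> s)"
  have ex: "p \<le> offset \<mu> (length \<mu>)" using assms by (simp add: offset_def)
  have r: "p \<le> offset \<mu> r" unfolding r_def by (rule LeastI[of "\<lambda>s. p \<le> offset \<mu> s", OF ex])
  have rl: "r \<le> length \<mu>" unfolding r_def by (rule Least_le[of "\<lambda>s. p \<le> offset \<mu> s", OF ex])
  have "r \<noteq> 0" using r assms by (cases r) auto
  then obtain s where s: "r = Suc s" by (cases r) auto
  have "\<not> p \<le> offset \<mu> s" using not_less_Least[of s "\<lambda>s. p \<le> offset \<mu> s"] s by (simp add: r_def)
  then have p: "s < length \<mu>" "p \<in> positions \<mu> s"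
    using r rl s offset_Suc[of s \<mu>] by (auto simp: positions_def)
  then show "blk \<mu> p < length \<mu>" "p \<in> positions \<mu> (blk \<mu> p)" using blk_positions[OF p] by auto
qed

lemma positions_subset: "r < length \<mu> \<Longrightarrow> positions \<mu> r \<subseteq> {1..sum_list \<mu>}"
  using offset_Suc[of r \<mu>] offset_le[of \<mu> "Suc r"] by (auto simp: positions_def)

lemma set_block: "set (block \<mu> \<pi> r) = \<pi> ` positions \<mu> r"
proof -
  have "positions \<mu> r = (\<lambda>q. offset \<mu> r + q) ` {1..\<mu> ! r}" by (simp add: positions_def)
  then have "\<pi> ` positions \<mu> r = (\<lambda>q. \<pi> (offset \<mu> r + q)) ` {1..\<mu> ! r}" by (simp only: image_image)
  then show ?thesis
    by (simp add: block_def atLeastLessThanSuc_atLeastAtMost del: upt_Suc)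
qed

lemma length_block [simp]: "length (block \<mu> \<pi> r) = \<mu> ! r"
  by (simp add: block_def)

lemma nth_block: "q \<in> {1..\<mu> ! r} \<Longrightarrow> block \<mu> \<pi> r ! (q - 1) = \<pi> (offset \<mu> r + q)"
  unfolding block_def by (subst nth_map) (auto simp del: upt_Suc)

lemma in_block_iff:
  assumes "\<pi> permutes {1..sum_list \<mu>}" "v \<in> {1..sum_list \<mu>}" "r < length \<mu>"
  shows "v \<in> set (block \<mu> \<pi> r) \<longleftrightarrow> blk \<mu> (inv \<pi> v) = r"
proof
  assume "v \<in> set (block \<mu> \<pi> r)"
  then obtain p where p: "p \<in> positions \<mu> r" "v = \<pi> p" by (auto simp: set_block)
  then show "blk \<mu> (inv \<pi> v) = r" using permutes_inverses(2)[OF assms(1)] blk_positions[OF assms(3)] by simp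
next
  assume r: "blk \<mu> (inv \<pi> v) = r"
  have "inv \<pi> v \<in> {1..sum_list \<mu>}" using permutes_in_image[OF permutes_inv[OF assms(1)]] assms(2) by blast
  then have "inv \<pi> v \<in> positions \<mu> r" using positions_blk r by blast
  moreover have "v = \<pi> (inv \<pi> v)" using permutes_inverses(1)[OF assms(1)] by simp
  ultimately show "v \<in> set (block \<mu> \<pi> r)" unfolding set_block by (rule rev_image_eqI)
qed

lemma block_of_eq:
  assumes "\<pi> permutes {1..sum_list \<mu>}" "v \<in> {1..sum_list \<mu>}"
  shows "block_of \<mu> \<pi> v = blk \<mu> (inv \<pi> v)"
proof -
  have "inv \<pi> v \<in> {1..sum_list \<mu>}" using permutes_in_image[OF permutes_inv[OF assms(1)]] assms(2) by blast
  then have "blk \<mu> (inv \<pi> v) < length \<mu>" by (rule positions_blk)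
  then show ?thesis
    unfolding block_of_def by (intro the_equality) (use in_block_iff[OF assms] in blast)+
qed

lemma involution_permutes:
  assumes "\<And>x. x \<notin> S \<Longrightarrow> f x = x" "\<And>x. f (f x) = x"
  shows "f permutes S"
  unfolding permutes_def
proof (intro conjI allI impI)
  fix y show "\<exists>!x. f x = y"
  proof (rule ex1I[of _ "f y"])
    show "f (f y) = y" by (rule assms(2))
    fix x assume "f x = y" then show "x = f y" using assms(2)[of x] by simp
  qed
qed (use assms(1) in auto)

section \<open>Encoding a \<open>\<mu>\<close>-involution\<close>

text \<open>The pair \<open>(\<beta>, y)\<close> encodes \<open>\<pi> = u \<sigma>\<close>, with \<open>u\<close> increasing on each block and \<open>\<sigma>\<close> the
  standardized blocks, by the block index of each letter and the involution
  \<open>y = u \<sigma> u\<^sup>-\<^sup>1\<close> of the letters.\<close>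

definition encodes :: "nat list \<Rightarrow> (nat \<Rightarrow> nat) \<Rightarrow> (nat \<Rightarrow> nat) \<Rightarrow> (nat \<Rightarrow> nat) \<Rightarrow> bool" where
  "encodes \<mu> \<pi> \<beta> y \<longleftrightarrow>
     \<pi> permutes {1..sum_list \<mu>} \<and> \<beta> = blk \<mu> \<circ> inv \<pi> \<and> y permutes {1..sum_list \<mu>} \<and> partner_map \<beta> y \<and>
     (\<forall>u \<in> {1..sum_list \<mu>}. \<forall>v \<in> {1..sum_list \<mu>}. \<beta> u = \<beta> v \<longrightarrow> u < v \<longrightarrow> inv \<pi> (y u) < inv \<pi> (y v))"

lemma encodesD:
  assumes "encodes \<mu> \<pi> \<beta> y"
  shows "\<pi> permutes {1..sum_list \<mu>}" "\<beta> = blk \<mu> \<circ> inv \<pi>" "y permutes {1..sum_list \<mu>}" "partner_map \<beta> y"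
    "u \<in> {1..sum_list \<mu>} \<Longrightarrow> v \<in> {1..sum_list \<mu>} \<Longrightarrow> \<beta> u = \<beta> v \<Longrightarrow> u < v \<Longrightarrow> inv \<pi> (y u) < inv \<pi> (y v)"
  using assms by (auto simp: encodes_def)

text \<open>The map \<open>inv \<pi> \<circ> y\<close> is an increasing bijection from the letters
  of a block onto its interval of positions, hence determined by ranks.\<close>

lemma encodes_rank:
  assumes E: "encodes \<mu> \<pi> \<beta> y" and v: "v \<in> {1..sum_list \<mu>}"
  defines "V \<equiv> {u \<in> {1..sum_list \<mu>}. \<beta> u = \<beta> v}"
  shows "V = set (block \<mu> \<pi> (\<beta> v))" "card V = \<mu> ! \<beta> v" "\<beta> v < length \<mu>"
    "inv \<pi> (y v) = offset \<mu> (\<beta> v) + rank_in V v"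
proof -
  note D = encodesD[OF E] and Y = partner_mapD[OF encodesD(4)[OF E]]
  let ?n = "sum_list \<mu>" and ?r = "\<beta> v"
  have ip: "inv \<pi> permutes {1..?n}" using D(1) by (rule permutes_inv)
  have rl: "?r < length \<mu>"
    using positions_blk(1)[of "inv \<pi> v" \<mu>] permutes_in_image[OF ip, of v] v D(2) by simp
  then show "\<beta> v < length \<mu>" .
  show VB: "V = set (block \<mu> \<pi> ?r)"
  proof -
    have "set (block \<mu> \<pi> ?r) \<subseteq> {1..?n}"
      unfolding set_block using positions_subset[OF rl] permutes_image[OF D(1)] by blast
    then show ?thesis using in_block_iff[OF D(1) _ rl] D(2) by (auto simp: V_def)
  qed
  have VP: "V = \<pi> ` positions \<mu> ?r" by (simp add: VB set_block)
  show "card V = \<mu> ! ?r"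
    unfolding VP by (subst card_image) (auto simp: positions_def intro: inj_on_subset[OF permutes_inj[OF D(1)]])
  define g where "g = inv \<pi> \<circ> y"
  have yV: "y ` V = V"
  proof -
    have *: "y u \<in> V" if "u \<in> V" for u
      using that permutes_in_image[OF D(3), of u] Y(2)[of u] by (simp add: V_def)
    then have "y ` V \<subseteq> V" by blast
    moreover have "V \<subseteq> y ` V"
    proof
      fix u assume "u \<in> V"
      from *[OF this] show "u \<in> y ` V" by (rule rev_image_eqI) (rule Y(1)[symmetric])
    qed
    ultimately show ?thesis by (rule equalityI)
  qed
  have gV: "g ` V = positions \<mu> ?r"
  proof -
    have "g ` V = inv \<pi> ` y ` V" by (simp add: g_def image_image)
    also have "\<dots> = inv \<pi> ` \<pi> ` positions \<mu> ?r" unfolding yV by (subst VP) (rule refl)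
    also have "\<dots> = positions \<mu> ?r" by (simp add: image_image permutes_inverses(2)[OF D(1)])
    finally show ?thesis .
  qed
  have gmono: "g a \<le> g b \<longleftrightarrow> a \<le> b" if "a \<in> V" "b \<in> V" for a b
  proof -
    have "a \<in> {1..?n}" "b \<in> {1..?n}" "\<beta> a = \<beta> b" using that by (auto simp: V_def)
    then show ?thesis
      using D(5)[of a b] D(5)[of b a] by (cases a b rule: linorder_cases) (auto simp: g_def)
  qed
  have vV: "v \<in> V" using v by (simp add: V_def)
  have gv: "g v \<in> positions \<mu> ?r" using gV vV by blast
  have "g ` {u \<in> V. u \<le> v} = {p \<in> positions \<mu> ?r. p \<le> g v}"
    unfolding gV[symmetric] using gmono vV by auto
  also have "\<dots> = {offset \<mu> ?r + 1..g v}"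
    using gv by (auto simp: positions_def)
  finally have "card (g ` {u \<in> V. u \<le> v}) = g v - offset \<mu> ?r" by simp
  moreover have "inj_on g {u \<in> V. u \<le> v}"
    using gmono by (intro inj_onI) (metis (no_types, lifting) antisym mem_Collect_eq order_refl)
  moreover have "offset \<mu> ?r < g v" using gv by (auto simp: positions_def)
  ultimately have "g v = offset \<mu> ?r + card {u \<in> V. u \<le> v}" by (simp add: card_image)
  then show "inv \<pi> (y v) = offset \<mu> ?r + rank_in V v"
    by (simp add: rank_in_def g_def)
qed

lemma encodes_rank':
  assumes E: "encodes \<mu> \<pi> \<beta> y" and v: "v \<in> {1..sum_list \<mu>}"
  shows "\<pi> (offset \<mu> (\<beta> v) + rank_in {u \<in> {1..sum_list \<mu>}. \<beta> u = \<beta> v} v) = y v"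
  using arg_cong[OF encodes_rank(4)[OF assms], of \<pi>] permutes_inverses(1)[OF encodesD(1)[OF E]] by simp

lemma encodes_partner_unique:
  assumes E: "encodes \<mu> \<pi> \<beta> y" "encodes \<mu> \<pi> \<beta>' y'"
  shows "\<beta> = \<beta>'" "y = y'"
proof -
  show b: "\<beta> = \<beta>'" using encodesD(2)[OF E(1)] encodesD(2)[OF E(2)] by simp
  show "y = y'"
  proof
    fix v show "y v = y' v"
      using encodes_rank'[OF E(1), of v] encodes_rank'[OF E(2), of v] b
        permutes_not_in[OF encodesD(3)[OF E(1)], of v] permutes_not_in[OF encodesD(3)[OF E(2)], of v]
      by (cases "v \<in> {1..sum_list \<mu>}") auto
  qed
qed

lemma encodes_perm_unique:
  assumes E: "encodes \<mu> \<pi> \<beta> y" "encodes \<mu> \<pi>' \<beta> y"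
  shows "\<pi> = \<pi>'"
proof -
  note D = encodesD[OF E(1)] and D' = encodesD[OF E(2)]
  have "inv \<pi> v = inv \<pi>' v" for v
  proof (cases "v \<in> {1..sum_list \<mu>}")
    case True
    then have "y v \<in> {1..sum_list \<mu>}" using permutes_in_image[OF D(3)] by blast
    from encodes_rank(4)[OF E(1) this] encodes_rank(4)[OF E(2) this] partner_mapD(1)[OF D(4)]
    show ?thesis by simp
  next
    case False
    then show ?thesis using permutes_not_in[OF permutes_inv[OF D(1)]] permutes_not_in[OF permutes_inv[OF D'(1)]] by simp
  qed
  then have "inv \<pi> = inv \<pi>'" by blast
  then show ?thesis using permutes_inv_inv[OF D(1)] permutes_inv_inv[OF D'(1)] by metis
qed

text \<open>Inside a block, the monotonicity clause is applied to the letters \<open>y m\<close> and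
  \<open>y (Suc m)\<close>, whose partners are \<open>m\<close> and \<open>Suc m\<close>.\<close>

lemma encodes_ascent:
  assumes E: "encodes \<mu> \<pi> \<beta> y" and m: "m \<in> {1..<sum_list \<mu>}"
  shows "ascent \<beta> y m \<longleftrightarrow> inv \<pi> m < inv \<pi> (Suc m)"
proof -
  note D = encodesD[OF E] and Y = partner_mapD[OF encodesD(4)[OF E]]
  have M: "m \<in> {1..sum_list \<mu>}" "Suc m \<in> {1..sum_list \<mu>}" using m by auto
  have yM: "y m \<in> {1..sum_list \<mu>}" "y (Suc m) \<in> {1..sum_list \<mu>}"
    using M permutes_in_image[OF D(3)] by blast+
  show ?thesis
  proof (cases "\<beta> m = \<beta> (Suc m)")
    case False
    then show ?thesis
      using block_mono_less[OF mono_blk[of \<mu>], of "inv \<pi> m" "inv \<pi> (Suc m)"]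
        block_mono_less[OF mono_blk[of \<mu>], of "inv \<pi> (Suc m)" "inv \<pi> m"] D(2)
      by (cases "\<beta> m" "\<beta> (Suc m)" rule: linorder_cases) (auto simp: ascent_def)
  next
    case True
    have "y m \<noteq> y (Suc m)" using Y(3) by simp
    then show ?thesis
      using D(5)[OF yM] D(5)[OF yM(2,1)] True Y(1,2) by (cases "y m" "y (Suc m)" rule: linorder_cases) (auto simp: ascent_def)
  qed
qed

text \<open>Replacing letters by their ranks turns \<open>y\<close> into the standardization of the
  block, which therefore is an involution.\<close>

lemma standardization_block:
  assumes E: "encodes \<mu> \<pi> \<beta> y" and v: "v \<in> {1..sum_list \<mu>}"
  defines "V \<equiv> {u \<in> {1..sum_list \<mu>}. \<beta> u = \<beta> v}"
  shows "u \<in> V \<Longrightarrow> standardization (block \<mu> \<pi> (\<beta> v)) (rank_in V u) = rank_in V (y u)"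
    "standardization (block \<mu> \<pi> (\<beta> v)) \<circ> standardization (block \<mu> \<pi> (\<beta> v)) = id"
proof -
  note D = encodesD[OF E] and Y = partner_mapD[OF encodesD(4)[OF E]] and R = encodes_rank[OF E v, folded V_def]
  let ?s = "standardization (block \<mu> \<pi> (\<beta> v))"
  have fV: "finite V" by (simp add: V_def)
  have *: "?s (rank_in V u) = rank_in V (y u)" if u: "u \<in> V" for u
  proof -
    have q: "rank_in V u \<in> {1..\<mu> ! \<beta> v}" using rank_in_range[OF fV u] R(2) by simp
    have bu: "\<beta> u = \<beta> v" "u \<in> {1..sum_list \<mu>}" using u by (auto simp: V_def)
    have "block \<mu> \<pi> (\<beta> v) ! (rank_in V u - 1) = y u"
      unfolding nth_block[OF q] using encodes_rank'[OF E bu(2)] by (simp only: bu V_def)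
    then show ?thesis using q R(1) by (simp add: standardization_def)
  qed
  have yV: "y u \<in> V" if "u \<in> V" for u
    using that permutes_in_image[OF D(3), of u] Y(2)[of u] by (simp add: V_def)
  show "u \<in> V \<Longrightarrow> ?s (rank_in V u) = rank_in V (y u)" using * .
  show "?s \<circ> ?s = id"
  proof
    fix q show "(?s \<circ> ?s) q = id q"
    proof (cases "q \<in> {1..\<mu> ! \<beta> v}")
      case True
      then obtain u where u: "u \<in> V" "rank_in V u = q" using rank_in_surj[OF fV, of q] R(2) by auto
      then show ?thesis using * yV Y(1) by (simp flip: u(2))
    next
      case False
      then have "?s q = q" by (auto simp: standardization_def)
      then show ?thesis by simp
    qed
  qed
qed

lemma encodes_mu_involution:
  assumes E: "encodes \<mu> \<pi> \<beta> y"
  shows "\<pi> \<in> mu_involutions \<mu>"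
  unfolding mu_involutions_def
proof (intro CollectI conjI allI impI)
  note D = encodesD[OF E]
  show "\<pi> permutes {1..sum_list \<mu>}" by (rule D(1))
  fix r assume r: "r < length \<mu>"
  show "standardization (block \<mu> \<pi> r) \<circ> standardization (block \<mu> \<pi> r) = id"
  \<comment> \<open>An empty part contains no letter through which
    \<open>standardization_block\<close> could be applied; its standardization is the
    identity.\<close>
  proof (cases "\<mu> ! r = 0")
    case True
    then have "standardization (block \<mu> \<pi> r) = id" by (auto simp: standardization_def)
    then show ?thesis by simp
  next
    case False
    then have p: "offset \<mu> r + 1 \<in> positions \<mu> r" by (simp add: positions_def)
    define v where "v = \<pi> (offset \<mu> r + 1)"
    have "v \<in> {1..sum_list \<mu>}" using p positions_subset[OF r] permutes_in_image[OF D(1)] by (auto simp: v_def)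
    moreover have "\<beta> v = r" using blk_positions[OF r p] permutes_inverses(2)[OF D(1)] D(2) by (simp add: v_def)
    ultimately show ?thesis using standardization_block(2)[OF E, of v] by simp
  qed
qed

lemma mu_involution_encodes:
  assumes "\<pi> \<in> mu_involutions \<mu>"
  shows "\<exists>\<beta> y. encodes \<mu> \<pi> \<beta> y"
proof -
  let ?n = "sum_list \<mu>"
  have pi: "\<pi> permutes {1..?n}" and std: "\<And>r. r < length \<mu> \<Longrightarrow> standardization (block \<mu> \<pi> r) \<circ> standardization (block \<mu> \<pi> r) = id"
    using assms by (auto simp: mu_involutions_def)
  have ip: "inv \<pi> permutes {1..?n}" using pi by (rule permutes_inv)
  define \<beta> where "\<beta> = blk \<mu> \<circ> inv \<pi>"
  define V where "V = (\<lambda>r. set (block \<mu> \<pi> r))"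
  \<comment> \<open>By \<open>encodes_rank'\<close> this is the only possible value; the involutions
    in the blocks then make \<open>y\<close> an involution.\<close>
  define y where "y = (\<lambda>v. if v \<in> {1..?n} then \<pi> (offset \<mu> (\<beta> v) + rank_in (V (\<beta> v)) v) else v)"
  have fV: "finite (V r)" for r by (simp add: V_def)
  have cV: "card (V r) = \<mu> ! r" for r
    unfolding V_def set_block by (subst card_image) (auto simp: positions_def intro: inj_on_subset[OF permutes_inj[OF pi]])
  have \<beta>l: "\<beta> v < length \<mu>" and vV: "v \<in> V (\<beta> v)" if "v \<in> {1..?n}" for v
  proof -
    show l: "\<beta> v < length \<mu>" using positions_blk(1)[of "inv \<pi> v" \<mu>] permutes_in_image[OF ip, of v] that by (simp add: \<beta>_def)
    show "v \<in> V (\<beta> v)" using in_block_iff[OF pi that l] by (simp add: V_def \<beta>_def)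
  qed
  have yv: "y v \<in> {1..?n} \<and> \<beta> (y v) = \<beta> v \<and> y (y v) = v \<and> inv \<pi> (y v) = offset \<mu> (\<beta> v) + rank_in (V (\<beta> v)) v"
    if v: "v \<in> {1..?n}" for v
  proof -
    let ?r = "\<beta> v" and ?q = "rank_in (V (\<beta> v)) v"
    note l = \<beta>l[OF v]
    have q: "?q \<in> {1..\<mu> ! ?r}" using rank_in_range[OF fV vV[OF v]] cV by simp
    then have p: "offset \<mu> ?r + ?q \<in> positions \<mu> ?r" by (auto simp: positions_def)
    have e: "y v = \<pi> (offset \<mu> ?r + ?q)" using v by (simp add: y_def)
    have yn: "y v \<in> {1..?n}" using p positions_subset[OF l] permutes_in_image[OF pi] e by auto
    have i: "inv \<pi> (y v) = offset \<mu> ?r + ?q" using e permutes_inverses(2)[OF pi] by simp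
    have b: "\<beta> (y v) = ?r" using blk_positions[OF l p] i by (simp add: \<beta>_def)
    have s: "standardization (block \<mu> \<pi> ?r) q = rank_in (V ?r) (\<pi> (offset \<mu> ?r + q))" if "q \<in> {1..\<mu> ! ?r}" for q
      using that nth_block[OF that] by (simp add: standardization_def V_def)
    have q2: "rank_in (V ?r) (y v) \<in> {1..\<mu> ! ?r}" using rank_in_range[OF fV vV[OF yn]] cV b by simp
    have "rank_in (V ?r) (\<pi> (offset \<mu> ?r + rank_in (V ?r) (y v))) = ?q"
      using fun_cong[OF std[OF l], of ?q] s[OF q] s[OF q2] e by simp
    moreover have "y (y v) = \<pi> (offset \<mu> ?r + rank_in (V ?r) (y v))" using yn b by (simp add: y_def)
    moreover have "\<pi> (offset \<mu> ?r + rank_in (V ?r) (y v)) \<in> V ?r"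
      unfolding V_def set_block by (rule imageI) (use q2 in \<open>auto simp: positions_def V_def set_block\<close>)
    ultimately have "y (y v) = v" using rank_in_eq_iff[OF fV _ vV[OF v]] by simp
    then show ?thesis using yn b i by simp
  qed
  have yo: "y v = v" if "v \<notin> {1..?n}" for v using that unfolding y_def by (rule if_not_P)
  have yy: "y (y v) = v" "\<beta> (y v) = \<beta> v" for v using yv[of v] yo[of v] by (cases "v \<in> {1..?n}"; simp)+
  have "encodes \<mu> \<pi> \<beta> y"
    unfolding encodes_def
  proof (intro conjI ballI impI)
    show "y permutes {1..?n}" using yo yy(1) by (rule involution_permutes)
    show "partner_map \<beta> y" using yy by (simp add: partner_map_def)
    fix u v assume u: "u \<in> {1..?n}" "v \<in> {1..?n}" "\<beta> u = \<beta> v" "u < v"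
    then show "inv \<pi> (y u) < inv \<pi> (y v)"
      using yv[OF u(1)] yv[OF u(2)] rank_in_mono[OF fV[of "\<beta> v"], of u v] vV[OF u(1)] vV[OF u(2)] by simp
  qed (use pi \<beta>_def in auto)
  then show ?thesis by blast
qed

section \<open>The action in terms of the encoding\<close>

lemma card_Inv_inv:
  assumes "w permutes {1..n}"
  shows "card (Inv (inv w)) = card (Inv w)"
proof -
  have "Inv (inv w) = (\<lambda>(p, q). (w q, w p)) ` Inv w"
  proof (intro equalityI subsetI)
    fix x assume "x \<in> Inv (inv w)"
    then obtain p q where x: "x = (p, q)" "p < q" "inv w q < inv w p" by (auto simp: Inv_def)
    then have "(inv w q, inv w p) \<in> Inv w" using permutes_inverses(1)[OF assms] by (simp add: Inv_def)
    then show "x \<in> (\<lambda>(p, q). (w q, w p)) ` Inv w"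
      by (rule rev_image_eqI) (simp add: x permutes_inverses(1)[OF assms])
  next
    fix x assume "x \<in> (\<lambda>(p, q). (w q, w p)) ` Inv w"
    then show "x \<in> Inv (inv w)" by (auto simp: Inv_def permutes_inverses(2)[OF assms])
  qed
  moreover have "inj_on (\<lambda>(p, q). (w q, w p)) (Inv w)"
    using permutes_inj[OF assms] by (auto simp: inj_on_def)
  ultimately show ?thesis by (simp add: card_image)
qed

lemma inv_simple_refl: "inv (simple_refl m) = simple_refl m"
  by (rule inv_unique_comp) simp_all

lemma hecke_right_eq:
  assumes w: "w permutes {1..n}" and m: "m \<in> {1..<n}"
  shows "hecke_right n w m = (if w m < w (Suc m) then w \<circ> simple_refl m else w)"
proof -
  have "w m \<noteq> w (Suc m)" using permutes_inj[OF w] by (auto simp: inj_eq)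
  then show ?thesis
    using card_Inv_ascent[OF w, of m] card_Inv_descent[OF w m] cox_length_eq[OF w]
      cox_length_eq[OF comp_simple_refl_permutes[OF w m]]
    by (cases "w m" "w (Suc m)" rule: linorder_cases) (auto simp: hecke_right_def)
qed

lemma hecke_left_eq:
  assumes w: "w permutes {1..n}" and m: "m \<in> {1..<n}"
  shows "hecke_left n m w = (if inv w m < inv w (Suc m) then simple_refl m \<circ> w else w)"
proof -
  have iw: "inv w permutes {1..n}" using w by (rule permutes_inv)
  have sw: "simple_refl m \<circ> w permutes {1..n}" by (intro permutes_compose[OF w] simple_refl_permutes m)
  have "inv (simple_refl m \<circ> w) = inv w \<circ> simple_refl m"
    using o_inv_distrib[OF permutes_bij[OF simple_refl_permutes[OF m]] permutes_bij[OF w]] by (simp add: inv_simple_refl)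
  then have c: "cox_length n (simple_refl m \<circ> w) = card (Inv (inv w \<circ> simple_refl m))"
    using cox_length_eq[OF sw] card_Inv_inv[OF sw] by simp
  have c': "cox_length n w = card (Inv (inv w))" using cox_length_eq[OF w] card_Inv_inv[OF w] by simp
  have "inv w m \<noteq> inv w (Suc m)" using permutes_inj[OF iw] by (auto simp: inj_eq)
  then show ?thesis
    using card_Inv_ascent[OF iw, of m] card_Inv_descent[OF iw m] c c'
    by (cases "inv w m" "inv w (Suc m)" rule: linorder_cases) (auto simp: hecke_left_def)
qed

lemma replace_block_eqI:
  assumes "\<And>q. q \<in> {1..\<mu> ! r} \<Longrightarrow> b ! (q - 1) = f (offset \<mu> r + q)"
    and "\<And>p. p \<notin> positions \<mu> r \<Longrightarrow> \<pi> p = f p"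
  shows "replace_block \<mu> \<pi> r b = f"
proof
  fix p
  show "replace_block \<mu> \<pi> r b p = f p"
  proof (cases "p \<in> positions \<mu> r")
    case True
    then have "p - offset \<mu> r \<in> {1..\<mu> ! r}" "offset \<mu> r + (p - offset \<mu> r) = p" by (auto simp: positions_def)
    from assms(1)[OF this(1)] this(2) show ?thesis
      using True unfolding replace_block_def positions_def by simp
  next
    case False
    from assms(2)[OF False] show ?thesis using False unfolding replace_block_def positions_def by auto
  qed
qed

lemma nth_word_on: "q \<in> {1..card V} \<Longrightarrow> word_on V \<sigma> ! (q - 1) = sorted_list_of_set V ! (\<sigma> q - 1)"
  unfolding word_on_def by (subst nth_map) (auto simp del: upt_Suc)

text \<open>Let \<open>m\<close> have rank r in its block. Multiplying the standardization on the
  left exchanges the letters \<open>m\<close> and \<open>Suc m\<close>; multiplying on the right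
  exchanges the r-th and the next position of the block. By \<open>encodes_rank\<close> these two
  positions hold \<open>y m\<close> and \<open>y (Suc m)\<close>. The second factor is absorbed
  precisely when both letters are fixed by \<open>y\<close>.\<close>

lemma mu_step_eq:
  assumes E: "encodes \<mu> \<pi> \<beta> y" and m: "m \<in> {1..<sum_list \<mu>}"
  shows "mu_step \<mu> \<pi> m =
    (if \<not> ascent \<beta> y m then \<pi>
     else if \<beta> m \<noteq> \<beta> (Suc m) \<or> y m = m \<and> y (Suc m) = Suc m then simple_refl m \<circ> \<pi>
     else simple_refl m \<circ> \<pi> \<circ> simple_refl (inv \<pi> (y m)))"
    "\<beta> m = \<beta> (Suc m) \<Longrightarrow> inv \<pi> (y (Suc m)) = Suc (inv \<pi> (y m))"
proof -
  note D = encodesD[OF E] and Y = partner_mapD[OF encodesD(4)[OF E]]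
  let ?n = "sum_list \<mu>"
  have M: "m \<in> {1..?n}" "Suc m \<in> {1..?n}" using m by auto
  have bo: "block_of \<mu> \<pi> m = \<beta> m" "block_of \<mu> \<pi> (Suc m) = \<beta> (Suc m)"
    using block_of_eq[OF D(1) M(1)] block_of_eq[OF D(1) M(2)] D(2) by simp_all
  define V where "V = {u \<in> {1..?n}. \<beta> u = \<beta> m}"
  note R = encodes_rank[OF E M(1), folded V_def]
  have fV: "finite V" by (simp add: V_def)
  have mV: "m \<in> V" using M by (simp add: V_def)
  have pos: "inv \<pi> (y u) = offset \<mu> (\<beta> m) + rank_in V u" if "u \<in> V" for u
    using encodes_rank(4)[OF E, of u] that by (simp add: V_def)
  show *: "inv \<pi> (y (Suc m)) = Suc (inv \<pi> (y m))" if "\<beta> m = \<beta> (Suc m)"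
    using pos[OF mV] pos[of "Suc m"] rank_in_Suc[OF fV mV] that M by (simp add: V_def)
  show "mu_step \<mu> \<pi> m =
    (if \<not> ascent \<beta> y m then \<pi>
     else if \<beta> m \<noteq> \<beta> (Suc m) \<or> y m = m \<and> y (Suc m) = Suc m then simple_refl m \<circ> \<pi>
     else simple_refl m \<circ> \<pi> \<circ> simple_refl (inv \<pi> (y m)))"
  proof (cases "\<beta> m = \<beta> (Suc m)")
    case False
    then have "mu_step \<mu> \<pi> m = hecke_left ?n m \<pi>" by (simp add: mu_step_def bo)
    also have "\<dots> = (if ascent \<beta> y m then simple_refl m \<circ> \<pi> else \<pi>)"
      using hecke_left_eq[OF D(1) m] encodes_ascent[OF E m] by simp
    finally show ?thesis using False by simp
  next
    case True
    let ?r = "\<beta> m"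
    let ?k = "\<mu> ! ?r"
    define \<sigma> where "\<sigma> = standardization (block \<mu> \<pi> ?r)"
    define j where "j = rank_in V m"
    have SmV: "Suc m \<in> V" using True M by (simp add: V_def)
    have rS: "rank_in V (Suc m) = Suc j" using rank_in_Suc[OF fV mV SmV] by (simp add: j_def)
    have jk: "j \<in> {1..<?k}" using rank_in_range[OF fV mV] rank_in_range[OF fV SmV] rS R(2) by (simp add: j_def)
    have \<sigma>r: "\<sigma> (rank_in V u) = rank_in V (y u)" if "u \<in> V" for u
      using standardization_block(1)[OF E M(1), folded V_def \<sigma>_def, OF that] .
    have \<sigma>\<sigma>: "\<sigma> \<circ> \<sigma> = id" using standardization_block(2)[OF E M(1), folded \<sigma>_def] .
    have \<sigma>p: "\<sigma> permutes {1..?k}"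
      by (rule involution_permutes) (use fun_cong[OF \<sigma>\<sigma>] in \<open>auto simp: \<sigma>_def standardization_def\<close>)
    have \<sigma>i: "inv \<sigma> = \<sigma>" using \<sigma>\<sigma> by (intro inv_unique_comp)
    have yV: "y u \<in> V" if "u \<in> V" for u
      using that permutes_in_image[OF D(3), of u] Y(2)[of u] by (simp add: V_def)
    have \<sigma>j: "\<sigma> j < \<sigma> (Suc j) \<longleftrightarrow> y m < y (Suc m)"
      using \<sigma>r[OF mV] \<sigma>r[OF SmV] rank_in_less_iff[OF fV yV[OF mV] yV[OF SmV]] rS by (simp add: j_def)
    have asc: "ascent \<beta> y m \<longleftrightarrow> y m < y (Suc m)" using True by (simp add: ascent_def)
    have st: "mu_step \<mu> \<pi> m = replace_block \<mu> \<pi> ?r (word_on V (hecke_right ?k (hecke_left ?k j \<sigma>) j))"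
      using True R(1) by (simp add: mu_step_def bo Let_def j_def \<sigma>_def)
    have posr: "offset \<mu> ?r + rank_in V u = inv \<pi> (y u)" if "u \<in> V" for u using pos[OF that] by simp
    have \<pi>r: "\<pi> (offset \<mu> ?r + rank_in V u) = y u" if "u \<in> V" for u
      unfolding posr[OF that] by (rule permutes_inverses(1)[OF D(1)])
    have out: "\<pi> p \<notin> V" if "p \<notin> positions \<mu> ?r" for p
    proof
      assume "\<pi> p \<in> V"
      then obtain p' where "p' \<in> positions \<mu> ?r" "\<pi> p = \<pi> p'" unfolding R(1) set_block by blast
      then show False using that permutes_inj[OF D(1)] by (auto simp: inj_eq)
    qed
    have sout: "simple_refl m (\<pi> p) = \<pi> p" if "p \<notin> positions \<mu> ?r" for p
      using out[OF that] mV SmV by (intro simple_refl_other) auto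
    note sr = rank_in_simple_refl[OF fV mV SmV, folded j_def]
    have key: "replace_block \<mu> \<pi> ?r (word_on V \<sigma>') = f"
      if h1: "\<And>u. u \<in> V \<Longrightarrow> \<exists>v \<in> V. \<sigma>' (rank_in V u) = rank_in V v \<and> f (offset \<mu> ?r + rank_in V u) = v"
        and h2: "\<And>p. p \<notin> positions \<mu> ?r \<Longrightarrow> \<pi> p = f p" for \<sigma>' f
    proof (rule replace_block_eqI)
      fix q assume "q \<in> {1..?k}"
      then have q: "q \<in> {1..card V}" using R(2) by simp
      then obtain u where u: "u \<in> V" "rank_in V u = q" using rank_in_surj[OF fV] by blast
      obtain v where v: "v \<in> V" "\<sigma>' q = rank_in V v" "f (offset \<mu> ?r + q) = v" using h1[OF u(1)] u(2) by blast
      show "word_on V \<sigma>' ! (q - 1) = f (offset \<mu> ?r + q)"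
        unfolding nth_word_on[OF q] v(2,3) by (rule nth_rank_in[OF fV v(1)])
    qed (rule h2)
    show ?thesis
    proof (cases "ascent \<beta> y m")
      case False
      then have "\<not> \<sigma> j < \<sigma> (Suc j)" using \<sigma>j asc by simp
      then have "hecke_right ?k (hecke_left ?k j \<sigma>) j = \<sigma>"
        using hecke_left_eq[OF \<sigma>p jk] hecke_right_eq[OF \<sigma>p jk] \<sigma>i by simp
      moreover have "replace_block \<mu> \<pi> ?r (word_on V \<sigma>) = \<pi>"
        by (rule key) (use \<sigma>r \<pi>r yV in auto)
      ultimately show ?thesis using st False by simp
    next
      case a: True
      have l: "hecke_left ?k j \<sigma> = simple_refl j \<circ> \<sigma>"
        using a \<sigma>j asc hecke_left_eq[OF \<sigma>p jk] \<sigma>i by simp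
      have lp: "simple_refl j \<circ> \<sigma> permutes {1..?k}" by (intro permutes_compose[OF \<sigma>p] simple_refl_permutes jk)
      have sj: "(simple_refl j \<circ> \<sigma>) j = rank_in V (simple_refl m (y m))"
        "(simple_refl j \<circ> \<sigma>) (Suc j) = rank_in V (simple_refl m (y (Suc m)))"
        using \<sigma>r[OF mV] \<sigma>r[OF SmV] sr(2)[OF yV[OF mV]] sr(2)[OF yV[OF SmV]] rS by (simp_all add: j_def)
      have lt: "(simple_refl j \<circ> \<sigma>) j < (simple_refl j \<circ> \<sigma>) (Suc j) \<longleftrightarrow> simple_refl m (y m) < simple_refl m (y (Suc m))"
        unfolding sj by (rule rank_in_less_iff[OF fV sr(1)[OF yV[OF mV]] sr(1)[OF yV[OF SmV]]])
      show ?thesis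
      proof (cases "y m = m \<and> y (Suc m) = Suc m")
        case fx: True
        then have "hecke_right ?k (hecke_left ?k j \<sigma>) j = simple_refl j \<circ> \<sigma>"
          unfolding l using hecke_right_eq[OF lp jk] lt by simp
        moreover have "replace_block \<mu> \<pi> ?r (word_on V (simple_refl j \<circ> \<sigma>)) = simple_refl m \<circ> \<pi>"
        proof (rule key)
          fix u assume u: "u \<in> V"
          show "\<exists>v \<in> V. (simple_refl j \<circ> \<sigma>) (rank_in V u) = rank_in V v \<and> (simple_refl m \<circ> \<pi>) (offset \<mu> ?r + rank_in V u) = v"
            by (rule bexI[of _ "simple_refl m (y u)"]) (use sr[OF yV[OF u]] \<sigma>r[OF u] \<pi>r[OF u] in auto)
        qed (use sout in auto)
        ultimately show ?thesis using st a fx by simp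
      next
        case nfix: False
        have "y m < y (Suc m)" using a asc by simp
        moreover have "(y m, y (Suc m)) \<noteq> (m, Suc m)" using nfix by auto
        ultimately have "simple_refl m (y m) < simple_refl m (y (Suc m))" by (rule simple_refl_less)
        then have h: "hecke_right ?k (hecke_left ?k j \<sigma>) j = simple_refl j \<circ> \<sigma> \<circ> simple_refl j"
          unfolding l using hecke_right_eq[OF lp jk] lt by simp
        define T where "T = simple_refl (inv \<pi> (y m))"
        have im: "inv \<pi> (y m) = offset \<mu> ?r + j" using pos[OF mV] by (simp add: j_def)
        have T: "T (offset \<mu> ?r + q) = offset \<mu> ?r + simple_refl j q" for q
          by (auto simp: T_def im simple_refl_def transpose_def)
        have "replace_block \<mu> \<pi> ?r (word_on V (simple_refl j \<circ> \<sigma> \<circ> simple_refl j)) = simple_refl m \<circ> \<pi> \<circ> T"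
        proof (rule key)
          fix u assume u: "u \<in> V"
          let ?u = "simple_refl m u"
          have u': "?u \<in> V" "rank_in V ?u = simple_refl j (rank_in V u)" using sr[OF u] by auto
          have v: "simple_refl m (y ?u) \<in> V" "rank_in V (simple_refl m (y ?u)) = simple_refl j (rank_in V (y ?u))"
            using sr[OF yV[OF u'(1)]] by auto
          show "\<exists>v \<in> V. (simple_refl j \<circ> \<sigma> \<circ> simple_refl j) (rank_in V u) = rank_in V v
              \<and> (simple_refl m \<circ> \<pi> \<circ> T) (offset \<mu> ?r + rank_in V u) = v"
            by (rule bexI[OF _ v(1)]) (use v(2) \<sigma>r[OF u'(1)] \<pi>r[OF u'(1)] in \<open>simp add: T flip: u'(2)\<close>)
        next
          fix p assume p: "p \<notin> positions \<mu> ?r"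
          have "offset \<mu> ?r + j \<in> positions \<mu> ?r" "Suc (offset \<mu> ?r + j) \<in> positions \<mu> ?r"
            using jk by (auto simp: positions_def)
          then have "T p = p" unfolding T_def im using p by (intro simple_refl_other) auto
          then show "\<pi> p = (simple_refl m \<circ> \<pi> \<circ> T) p" using sout[OF p] by simp
        qed
        then show ?thesis using st a nfix True h by (auto simp: T_def)
      qed
    qed
  qed
qed

lemma flip_permutes: "y permutes {1..n} \<Longrightarrow> m \<in> {1..<n} \<Longrightarrow> flip \<beta> y m permutes {1..n}"
  unfolding flip_def by (simp only: split: if_split) (intro conjI impI permutes_compose simple_refl_permutes; assumption)

text \<open>The branches of \<open>mu_step_eq\<close> match those of \<open>flip\<close>. The point
  to check is the monotonicity clause, which is safe because \<open>simple_refl m\<close> reverses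
  the order of no pair except \<open>(m, Suc m)\<close>.\<close>

lemma encodes_step:
  assumes E: "encodes \<mu> \<pi> \<beta> y" and m: "m \<in> {1..<sum_list \<mu>}" and asc: "ascent \<beta> y m"
  shows "encodes \<mu> (mu_step \<mu> \<pi> m) (\<beta> \<circ> simple_refl m) (flip \<beta> y m)"
proof -
  note D = encodesD[OF E] and Y = partner_mapD[OF encodesD(4)[OF E]]
  let ?n = "sum_list \<mu>"
  define s where "s = simple_refl m"
  define \<pi>' where "\<pi>' = mu_step \<mu> \<pi> m"
  have sn: "s permutes {1..?n}" using simple_refl_permutes[OF m] by (simp add: s_def)
  have ss: "s (s v) = v" for v by (simp add: s_def)
  have isv: "inv s = s" by (simp add: s_def inv_simple_refl)
  have sv: "s v \<in> {1..?n}" if "v \<in> {1..?n}" for v using permutes_in_image[OF sn] that by blast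
  have M: "m \<in> {1..?n}" "Suc m \<in> {1..?n}" using m by auto
  have isp: "inv (s \<circ> \<pi>) = inv \<pi> \<circ> s"
    using o_inv_distrib[OF permutes_bij[OF sn] permutes_bij[OF D(1)]] isv by simp
  have sless: "s u < s v" if "u < v" "(u, v) \<noteq> (m, Suc m)" for u v
    using simple_refl_less[OF that] by (simp add: s_def)
  have "\<pi>' permutes {1..?n} \<and> \<beta> \<circ> s = blk \<mu> \<circ> inv \<pi>' \<and>
    (\<forall>u \<in> {1..?n}. \<forall>v \<in> {1..?n}. \<beta> (s u) = \<beta> (s v) \<longrightarrow> u < v \<longrightarrow> inv \<pi>' (flip \<beta> y m u) < inv \<pi>' (flip \<beta> y m v))"
  proof (cases "\<beta> m = \<beta> (Suc m)")
    case False
    then have p: "\<pi>' = s \<circ> \<pi>" using mu_step_eq(1)[OF E m] asc by (simp add: \<pi>'_def s_def)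
    have f: "flip \<beta> y m = s \<circ> y \<circ> s" using False by (simp add: flip_def s_def)
    show ?thesis
      unfolding p isp f
    proof (intro conjI ballI impI)
      show "s \<circ> \<pi> permutes {1..?n}" by (intro permutes_compose D(1) sn)
      show "\<beta> \<circ> s = blk \<mu> \<circ> (inv \<pi> \<circ> s)" using D(2) by (simp add: comp_assoc)
      fix u v assume u: "u \<in> {1..?n}" "v \<in> {1..?n}" "\<beta> (s u) = \<beta> (s v)" "u < v"
      have "(u, v) \<noteq> (m, Suc m)" using u(3) False by (auto simp: s_def)
      then have "s u < s v" using sless u(4) by simp
      then show "(inv \<pi> \<circ> s) ((s \<circ> y \<circ> s) u) < (inv \<pi> \<circ> s) ((s \<circ> y \<circ> s) v)"
        using D(5)[OF sv[OF u(1)] sv[OF u(2)] u(3)] by (simp add: ss)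
    qed
  next
    case same: True
    have \<beta>s: "\<beta> (s v) = \<beta> v" for v
      using same by (cases "v = m"; cases "v = Suc m") (auto simp: s_def simple_refl_other)
    have lt: "y m < y (Suc m)" using asc same by (simp add: ascent_def)
    show ?thesis
    proof (cases "y m = m \<and> y (Suc m) = Suc m")
      case True
      then have p: "\<pi>' = s \<circ> \<pi>" using mu_step_eq(1)[OF E m] asc by (simp add: \<pi>'_def s_def)
      have f: "flip \<beta> y m = s \<circ> y" using True same by (simp add: flip_def s_def)
      show ?thesis
        unfolding p isp f
      proof (intro conjI ballI impI)
        show "s \<circ> \<pi> permutes {1..?n}" by (intro permutes_compose D(1) sn)
        show "\<beta> \<circ> s = blk \<mu> \<circ> (inv \<pi> \<circ> s)" using D(2) by (simp add: comp_assoc)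
        fix u v assume u: "u \<in> {1..?n}" "v \<in> {1..?n}" "\<beta> (s u) = \<beta> (s v)" "u < v"
        then show "(inv \<pi> \<circ> s) ((s \<circ> y) u) < (inv \<pi> \<circ> s) ((s \<circ> y) v)"
          using D(5)[of u v] by (simp add: ss \<beta>s)
      qed
    next
      case False
      define T where "T = simple_refl (inv \<pi> (y m))"
      have TS: "T = transpose (inv \<pi> (y m)) (inv \<pi> (y (Suc m)))"
        using mu_step_eq(2)[OF E m same] by (simp add: T_def simple_refl_def)
      have p: "\<pi>' = s \<circ> \<pi> \<circ> T" using mu_step_eq(1)[OF E m] asc False same by (auto simp: \<pi>'_def s_def T_def)
      have "\<not> (y m \<in> {m, Suc m} \<and> y (Suc m) \<in> {m, Suc m})"
        using False lt by auto
      then have f: "flip \<beta> y m = s \<circ> y \<circ> s" by (auto simp: flip_def s_def)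
      have ip: "inv \<pi> permutes {1..?n}" using D(1) by (rule permutes_inv)
      have yM: "inv \<pi> (y m) \<in> {1..?n}" "inv \<pi> (y (Suc m)) \<in> {1..?n}"
        using M permutes_in_image[OF D(3)] permutes_in_image[OF ip] by blast+
      have Tn: "T permutes {1..?n}" unfolding TS by (rule permutes_swap_id[OF yM])
      have iT: "inv T = T" by (simp add: T_def inv_simple_refl)
      have ip': "inv \<pi>' = T \<circ> inv \<pi> \<circ> s"
        unfolding p using o_inv_distrib[OF permutes_bij[OF permutes_compose[OF D(1) sn]] permutes_bij[OF Tn]] isp iT
        by (simp add: comp_assoc)
      have blT: "blk \<mu> (T q) = blk \<mu> q" for q
        unfolding TS using fun_cong[OF D(2), of "y m"] fun_cong[OF D(2), of "y (Suc m)"] same Y(2)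
        by (auto simp: transpose_def)
      show ?thesis
        unfolding f ip'
      proof (intro conjI ballI impI)
        show "\<pi>' permutes {1..?n}" unfolding p by (intro permutes_compose D(1) sn Tn)
        show "\<beta> \<circ> s = blk \<mu> \<circ> (T \<circ> inv \<pi> \<circ> s)" using D(2) by (auto simp: fun_eq_iff blT)
        fix u v assume u: "u \<in> {1..?n}" "v \<in> {1..?n}" "\<beta> (s u) = \<beta> (s v)" "u < v"
        show "(T \<circ> inv \<pi> \<circ> s) ((s \<circ> y \<circ> s) u) < (T \<circ> inv \<pi> \<circ> s) ((s \<circ> y \<circ> s) v)"
        \<comment> \<open>For the one pair whose order is reversed by \<open>s\<close>, the partners
          stand at adjacent positions, and \<open>T\<close> exchanges these as well.\<close>
        proof (cases "(u, v) = (m, Suc m)")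
          case True
          then show ?thesis
            using mu_step_eq(2)[OF E m same] by (simp add: ss s_def T_def)
        next
          case ne: False
          then have "s u < s v" using sless u(4) by simp
          then have l: "inv \<pi> (y (s u)) < inv \<pi> (y (s v))"
            using D(5)[OF sv[OF u(1)] sv[OF u(2)] u(3)] by simp
          have "(inv \<pi> (y (s u)), inv \<pi> (y (s v))) \<noteq> (inv \<pi> (y m), Suc (inv \<pi> (y m)))"
          proof
            assume "(inv \<pi> (y (s u)), inv \<pi> (y (s v))) = (inv \<pi> (y m), Suc (inv \<pi> (y m)))"
            then have "inv \<pi> (y (s u)) = inv \<pi> (y m)" "inv \<pi> (y (s v)) = inv \<pi> (y (Suc m))"
              using mu_step_eq(2)[OF E m same] by auto
            then have "s u = m" "s v = Suc m" using permutes_inj[OF ip] Y(3) by (auto simp: inj_eq)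
            then have "s (s u) = Suc m" "s (s v) = m" by (auto simp: s_def)
            then show False using u(4) by (simp add: ss)
          qed
          from simple_refl_less[OF l this] show ?thesis by (simp add: ss T_def)
        qed
      qed
    qed
  qed
  then have A: "\<pi>' permutes {1..?n}" "\<beta> \<circ> s = blk \<mu> \<circ> inv \<pi>'"
    and B: "\<And>u v. u \<in> {1..?n} \<Longrightarrow> v \<in> {1..?n} \<Longrightarrow> \<beta> (s u) = \<beta> (s v) \<Longrightarrow> u < v \<Longrightarrow>
      inv \<pi>' (flip \<beta> y m u) < inv \<pi>' (flip \<beta> y m v)" by blast+
  have "encodes \<mu> \<pi>' (\<beta> \<circ> s) (flip \<beta> y m)"
    unfolding encodes_def
  proof (intro conjI ballI impI)
    show "flip \<beta> y m permutes {1..?n}" by (rule flip_permutes[OF D(3) m])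
    show "partner_map (\<beta> \<circ> s) (flip \<beta> y m)" unfolding s_def by (rule partner_map_flip[OF D(4)])
    fix u v assume "u \<in> {1..?n}" "v \<in> {1..?n}" "(\<beta> \<circ> s) u = (\<beta> \<circ> s) v" "u < v"
    then show "inv \<pi>' (flip \<beta> y m u) < inv \<pi>' (flip \<beta> y m v)" using B by simp
  qed (rule A)+
  then show ?thesis by (simp only: \<pi>'_def s_def)
qed

lemma mu_step_descent:
  "encodes \<mu> \<pi> \<beta> y \<Longrightarrow> m \<in> {1..<sum_list \<mu>} \<Longrightarrow> \<not> ascent \<beta> y m \<Longrightarrow> mu_step \<mu> \<pi> m = \<pi>"
  using mu_step_eq(1) by simp

lemma encodes_id: "encodes \<mu> id (blk \<mu>) id"
  by (auto simp: encodes_def permutes_id partner_map_def)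

lemma atom_for_id: "atom_for (blk \<mu>) (blk \<mu>) id id"
  by (auto simp: atom_for_def cyc_at_def cyc_pair_def ok_defs)

section \<open>Existence of atoms, and uniqueness of the encoding of an atom\<close>

lemma rank_permutation:
  fixes \<kappa> :: "nat \<Rightarrow> 'a :: linorder"
  assumes inj: "inj_on \<kappa> {1..n}"
  defines "w \<equiv> \<lambda>v. if v \<in> {1..n} then card {u \<in> {1..n}. \<kappa> u \<le> \<kappa> v} else v"
  shows "w permutes {1..n}" "u \<in> {1..n} \<Longrightarrow> v \<in> {1..n} \<Longrightarrow> \<kappa> u < \<kappa> v \<Longrightarrow> w u < w v"
proof -
  have less: "w u < w v" if "u \<in> {1..n}" "v \<in> {1..n}" "\<kappa> u < \<kappa> v" for u v
  proof -
    have "{x \<in> {1..n}. \<kappa> x \<le> \<kappa> u} \<subseteq> {x \<in> {1..n}. \<kappa> x \<le> \<kappa> v}" using that by auto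
    moreover have "v \<in> {x \<in> {1..n}. \<kappa> x \<le> \<kappa> v}" "v \<notin> {x \<in> {1..n}. \<kappa> x \<le> \<kappa> u}" using that by auto
    ultimately have "{x \<in> {1..n}. \<kappa> x \<le> \<kappa> u} \<subset> {x \<in> {1..n}. \<kappa> x \<le> \<kappa> v}" by blast
    then have "card {x \<in> {1..n}. \<kappa> x \<le> \<kappa> u} < card {x \<in> {1..n}. \<kappa> x \<le> \<kappa> v}" by (intro psubset_card_mono) auto
    then show ?thesis using that by (simp add: w_def)
  qed
  then show "u \<in> {1..n} \<Longrightarrow> v \<in> {1..n} \<Longrightarrow> \<kappa> u < \<kappa> v \<Longrightarrow> w u < w v" .
  have ran: "w ` {1..n} \<subseteq> {1..n}"
  proof
    fix p assume "p \<in> w ` {1..n}"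
    then obtain v where v: "v \<in> {1..n}" "p = card {u \<in> {1..n}. \<kappa> u \<le> \<kappa> v}" by (auto simp: w_def)
    have "card {u \<in> {1..n}. \<kappa> u \<le> \<kappa> v} \<le> card {1..n}" by (intro card_mono) auto
    moreover have "card {u \<in> {1..n}. \<kappa> u \<le> \<kappa> v} > 0" using v by (auto simp: card_gt_0_iff)
    ultimately show "p \<in> {1..n}" using v by auto
  qed
  have "inj_on w {1..n}"
  proof (rule inj_onI)
    fix u v assume uv: "u \<in> {1..n}" "v \<in> {1..n}" "w u = w v"
    then have "\<kappa> u = \<kappa> v" using less[of u v] less[of v u] by (cases "\<kappa> u" "\<kappa> v" rule: linorder_cases) auto
    then show "u = v" using inj uv by (auto dest: inj_onD)
  qed
  then have "bij_betw w {1..n} {1..n}" using ran by (simp add: bij_betw_def endo_inj_surj)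
  then show "w permutes {1..n}" by (intro bij_imp_permutes) (auto simp: w_def)
qed

text \<open>If cycles are kept together and arranged by their smaller points, no point stands inside
  a foreign cycle, and the order clauses hold as well.\<close>

lemma cycles_ok_consecutive:
  fixes a b c d A B C D :: int
  assumes "a \<noteq> c" "a \<noteq> d" "b \<noteq> c" "b \<noteq> d" "cycle_ok a b A B" "cycle_ok c d C D"
    and "min a b < min c d \<Longrightarrow> A < C \<and> A < D \<and> B < C \<and> B < D"
    and "min c d < min a b \<Longrightarrow> C < A \<and> C < B \<and> D < A \<and> D < B"
  shows "cycles_ok a b A B c d C D"
  using assms unfolding ok_defs min_def by (smt (verit))

lemma atom_exists:
  assumes g: "g permutes {1..sum_list \<mu>}" "\<beta> = blk \<mu> \<circ> g"
    and y: "y permutes {1..sum_list \<mu>}" "partner_map \<beta> y"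
  shows "\<exists>w. w permutes {1..sum_list \<mu>} \<and> atom_for (blk \<mu>) \<beta> y w"
proof -
  let ?n = "sum_list \<mu>"
  note Y = partner_mapD[OF y(2)]
  \<comment> \<open>Sorting by this key lists the blocks in order, the cycles of each block by their
    smaller points, and the larger point of each cycle first; the last effect is due to the entry
    \<open>?n - v\<close>.\<close>
  define \<kappa> where "\<kappa> = (\<lambda>v. (\<beta> v, min v (y v), ?n - v))"
  define w where "w = (\<lambda>v. if v \<in> {1..?n} then card {u \<in> {1..?n}. \<kappa> u \<le> \<kappa> v} else v)"
  have inj: "inj_on \<kappa> {1..?n}" by (auto simp: inj_on_def \<kappa>_def)
  note w = rank_permutation(1)[OF inj, folded w_def]
  have less: "w u < w v" if "u \<in> {1..?n}" "v \<in> {1..?n}" "\<kappa> u < \<kappa> v" for u v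
    using rank_permutation(2)[OF inj that] by (simp only: w_def)
  have wo: "w v = v" "y v = v" "g v = v" if "v \<notin> {1..?n}" for v
    using that permutes_not_in[OF w] permutes_not_in[OF y(1)] permutes_not_in[OF g(1)] by auto
  have wn: "w v \<in> {1..?n} \<longleftrightarrow> v \<in> {1..?n}" and yn: "y v \<in> {1..?n} \<longleftrightarrow> v \<in> {1..?n}" for v
    using permutes_in_image[OF w] permutes_in_image[OF y(1)] by blast+
  have cnt: "card {u \<in> {1..?n}. \<beta> u < r} = offset \<mu> r" if r: "r \<le> length \<mu>" for r
  proof -
    have "{p \<in> {1..?n}. blk \<mu> p < r} = {1..offset \<mu> r}"
    proof (intro equalityI subsetI)
      fix p assume "p \<in> {p \<in> {1..?n}. blk \<mu> p < r}"
      then have p: "p \<in> {1..?n}" "blk \<mu> p < r" by auto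
      have "p \<le> offset \<mu> (Suc (blk \<mu> p))"
        using positions_blk[OF p(1)] offset_Suc[of "blk \<mu> p" \<mu>] by (auto simp: positions_def)
      also have "\<dots> \<le> offset \<mu> r" using p(2) by (intro offset_mono) simp
      finally show "p \<in> {1..offset \<mu> r}" using p by simp
    next
      fix p assume p: "p \<in> {1..offset \<mu> r}"
      then have pn: "p \<in> {1..?n}" using offset_le[of \<mu> r] by auto
      have "\<not> r \<le> blk \<mu> p"
      proof
        assume "r \<le> blk \<mu> p"
        then have "offset \<mu> r \<le> offset \<mu> (blk \<mu> p)" by (rule offset_mono)
        then show False using positions_blk(2)[OF pn] p by (auto simp: positions_def)
      qed
      then show "p \<in> {p \<in> {1..?n}. blk \<mu> p < r}" using pn by simp
    qed
    moreover have "g ` {u \<in> {1..?n}. \<beta> u < r} = {p \<in> {1..?n}. blk \<mu> p < r}"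
    proof (intro equalityI subsetI)
      fix p assume p: "p \<in> {p \<in> {1..?n}. blk \<mu> p < r}"
      then have "inv g p \<in> {1..?n}" using permutes_in_image[OF permutes_inv[OF g(1)]] by blast
      then have "inv g p \<in> {u \<in> {1..?n}. \<beta> u < r}" using p permutes_inverses(1)[OF g(1)] by (simp add: g(2))
      then show "p \<in> g ` {u \<in> {1..?n}. \<beta> u < r}"
        by (rule rev_image_eqI) (simp add: permutes_inverses(1)[OF g(1)])
    next
      fix p assume "p \<in> g ` {u \<in> {1..?n}. \<beta> u < r}"
      then obtain u where "u \<in> {1..?n}" "\<beta> u < r" "p = g u" by blast
      then show "p \<in> {p \<in> {1..?n}. blk \<mu> p < r}" using permutes_in_image[OF g(1), of u] by (simp add: g(2))
    qed
    moreover have "card (g ` {u \<in> {1..?n}. \<beta> u < r}) = card {u \<in> {1..?n}. \<beta> u < r}"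
      by (intro card_image inj_on_subset[OF permutes_inj[OF g(1)]]) auto
    ultimately show ?thesis by simp
  qed
  have bl: "blk \<mu> (w v) = \<beta> v" for v
  proof (cases "v \<in> {1..?n}")
    case False
    then show ?thesis using wo[OF False] by (simp add: g(2))
  next
    case True
    then have gv: "g v \<in> {1..?n}" using permutes_in_image[OF g(1)] by blast
    have r: "\<beta> v < length \<mu>" using positions_blk(1)[OF gv] by (simp add: g(2))
    have wv: "w v = card {u \<in> {1..?n}. \<kappa> u \<le> \<kappa> v}" using True by (simp add: w_def)
    have "{u \<in> {1..?n}. \<kappa> u \<le> \<kappa> v} \<subseteq> {u \<in> {1..?n}. \<beta> u < Suc (\<beta> v)}" by (auto simp: \<kappa>_def)
    then have "w v \<le> card {u \<in> {1..?n}. \<beta> u < Suc (\<beta> v)}" unfolding wv by (intro card_mono) auto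
    then have 1: "w v \<le> offset \<mu> (Suc (\<beta> v))" using cnt[of "Suc (\<beta> v)"] r by simp
    have "{u \<in> {1..?n}. \<beta> u < \<beta> v} \<subseteq> {u \<in> {1..?n}. \<kappa> u \<le> \<kappa> v}" by (auto simp: \<kappa>_def)
    moreover have "v \<in> {u \<in> {1..?n}. \<kappa> u \<le> \<kappa> v}" "v \<notin> {u \<in> {1..?n}. \<beta> u < \<beta> v}" using True by auto
    ultimately have "{u \<in> {1..?n}. \<beta> u < \<beta> v} \<subset> {u \<in> {1..?n}. \<kappa> u \<le> \<kappa> v}" by blast
    then have "card {u \<in> {1..?n}. \<beta> u < \<beta> v} < w v" unfolding wv by (intro psubset_card_mono) auto
    then have 2: "offset \<mu> (\<beta> v) < w v" using cnt[of "\<beta> v"] r by simp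
    show ?thesis by (rule blk_positions[OF r]) (use 1 2 offset_Suc[OF r] in \<open>simp add: positions_def\<close>)
  qed
  \<comment> \<open>As \<open>atom_for\<close> speaks of all numbers, those outside
    \<open>{1..?n}\<close> must be placed too; in particular 0 has the index of the first
    block.\<close>
  have K: "w u < w v" if b: "\<beta> u = \<beta> v" and m: "min u (y u) < min v (y v)" for u v
  proof (cases "u \<in> {1..?n}")
    case u: True
    show ?thesis
    proof (cases "v \<in> {1..?n}")
      case True
      then show ?thesis using less[OF u True] b m by (simp add: \<kappa>_def)
    next
      case False
      then have "?n < v" using wo[OF False] m by auto
      then show ?thesis using wn[of u] u wo[OF False] by auto
    qed
  next
    case u: False
    show ?thesis
    proof (cases "v \<in> {1..?n}")
      case True
      have "u = 0"
      proof (rule ccontr)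
        assume "u \<noteq> 0"
        then have "?n < u" using u by auto
        then show False using m wo[OF u] yn[of v] True by auto
      qed
      then show ?thesis using wo(1)[OF u] wn[of v] True by auto
    next
      case False
      then show ?thesis using wo[OF False] wo[OF u] m by simp
    qed
  qed
  have C: "w (y u) < w u" if "u < y u" for u
  proof -
    have "y u \<noteq> u" using that by simp
    then have u: "u \<in> {1..?n}" "y u \<in> {1..?n}" using wo(2)[of u] yn[of u] by auto
    have "\<kappa> (y u) < \<kappa> u" using that u Y(1,2)[of u] by (auto simp: \<kappa>_def min_def)
    then show ?thesis using less u by blast
  qed
  have cyc: "cycle_ok (int u) (int (y u)) (int (w u)) (int (w (y u)))" for u
    using C[of u] C[of "y u"] Y(1)[of u] by (auto simp: cycle_ok_def)
  have "atom_for (blk \<mu>) \<beta> y w"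
    unfolding atom_for_def
  proof (intro conjI allI impI)
    fix u v assume uv: "\<beta> u = \<beta> v" "v \<noteq> u" "v \<noteq> y u"
    have mm: "min (int x) (int (y x)) = int (min x (y x))" "min (y x) (y (y x)) = min x (y x)" for x
      using Y(1)[of x] by (auto simp: min_def)
    show "cyc_pair y w u v"
      unfolding cyc_pair_def
    proof (rule cycles_ok_consecutive[OF _ _ _ _ cyc cyc])
      show "int u \<noteq> int v" "int u \<noteq> int (y v)" "int (y u) \<noteq> int v" "int (y u) \<noteq> int (y v)"
        using uv Y(1)[of v] Y(3)[of u v] by auto
      assume "min (int u) (int (y u)) < min (int v) (int (y v))"
      then have m: "min u (y u) < min v (y v)" unfolding mm by simp
      then show "int (w u) < int (w v) \<and> int (w u) < int (w (y v)) \<and> int (w (y u)) < int (w v) \<and> int (w (y u)) < int (w (y v))"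
        using K[of u v] K[of u "y v"] K[of "y u" v] K[of "y u" "y v"] uv(1) Y(2) unfolding mm(2) by simp
    next
      assume "min (int v) (int (y v)) < min (int u) (int (y u))"
      then have m: "min v (y v) < min u (y u)" unfolding mm by simp
      then show "int (w v) < int (w u) \<and> int (w v) < int (w (y u)) \<and> int (w (y v)) < int (w u) \<and> int (w (y v)) < int (w (y u))"
        using K[of v u] K[of v "y u"] K[of "y v" u] K[of "y v" "y u"] uv(1) Y(2) unfolding mm(2) by simp
    qed
  qed (use bl cyc in \<open>auto simp: cyc_at_def\<close>)
  then show ?thesis using w by blast
qed

text \<open>The block map can be read off from \<open>w\<close>. For the involution, remove a
  descent of \<open>w\<close> with \<open>atom_for_lower\<close> and undo the step by
  \<open>flip_flip\<close>; at \<open>w = id\<close> every cycle is a fixed point, because the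
  larger point of a 2-cycle would come first.\<close>

lemma atom_for_unique:
  assumes bl: "mono bl"
  shows "w permutes {1..n} \<Longrightarrow> partner_map \<beta> y \<Longrightarrow> partner_map \<beta>' y' \<Longrightarrow>
    atom_for bl \<beta> y w \<Longrightarrow> atom_for bl \<beta>' y' w \<Longrightarrow> \<beta> = \<beta>' \<and> y = y'"
proof (induction "card (Inv w)" arbitrary: w \<beta> y \<beta>' y' rule: less_induct)
  case less
  have b: "\<beta> = \<beta>'" using atom_forD(1)[OF less.prems(4)] atom_forD(1)[OF less.prems(5)] by (auto simp: fun_eq_iff)
  show ?case
  proof (cases "\<exists>m \<in> {1..<n}. w (Suc m) < w m")
    case True
    then obtain m where m: "m \<in> {1..<n}" "w (Suc m) < w m" by blast
    have "flip \<beta> y m = flip \<beta>' y' m"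
      using less.hyps[of "w \<circ> simple_refl m", OF _ comp_simple_refl_permutes[OF less.prems(1) m(1)]
          partner_map_flip[OF less.prems(2)] partner_map_flip[OF less.prems(3)]
          atom_for_lower[OF bl less.prems(2,4) m(2)] atom_for_lower[OF bl less.prems(3,5) m(2)]]
        card_Inv_descent[OF less.prems(1) m] by simp
    then have "flip (\<beta> \<circ> simple_refl m) (flip \<beta> y m) m = flip (\<beta>' \<circ> simple_refl m) (flip \<beta>' y' m) m"
      unfolding b by (rule arg_cong)
    then have "y = y'" unfolding flip_flip[OF less.prems(2)] flip_flip[OF less.prems(3)] .
    then show ?thesis using b by simp
  next
    case False
    have "w = id"
    proof (rule no_descent_id[OF less.prems(1)])
      fix m assume "m \<in> {1..<n}"
      then have "\<not> w (Suc m) < w m" using False by blast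
      moreover have "w m \<noteq> w (Suc m)" using permutes_inj[OF less.prems(1)] by (auto simp: inj_eq)
      ultimately show "w m < w (Suc m)" by simp
    qed
    then have le: "z u = u" if "partner_map \<beta>0 z" "atom_for bl \<beta>0 z w" for \<beta>0 z u
      using atom_forD(2)[OF that(2), of u] by (auto simp: cyc_at_def cycle_ok_def)
    show ?thesis using le[OF less.prems(2,4)] le[OF less.prems(3,5)] b by (auto simp: fun_eq_iff)
  qed
qed

section \<open>Agreement with the defined atoms and reduced words\<close>

definition is_atom :: "nat list \<Rightarrow> (nat \<Rightarrow> nat) \<Rightarrow> (nat \<Rightarrow> nat) \<Rightarrow> bool" where
  "is_atom \<mu> \<pi> w \<longleftrightarrow> w permutes {1..sum_list \<mu>} \<and> (\<exists>\<beta> y. encodes \<mu> \<pi> \<beta> y \<and> atom_for (blk \<mu>) \<beta> y w)"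

lemma mu_word_act_simps [simp]:
  "mu_word_act \<mu> \<pi> [] = \<pi>" "mu_word_act \<mu> \<pi> (a @ b) = mu_word_act \<mu> (mu_word_act \<mu> \<pi> a) b"
  "mu_word_act \<mu> \<pi> (m # a) = mu_word_act \<mu> (mu_step \<mu> \<pi> m) a"
  by (simp_all add: mu_word_act_def)

lemma is_atom_raise:
  assumes at: "is_atom \<mu> \<pi> w" and m: "m \<in> {1..<sum_list \<mu>}" and asc: "inv \<pi> m < inv \<pi> (Suc m)"
  shows "w m < w (Suc m)" "is_atom \<mu> (mu_step \<mu> \<pi> m) (w \<circ> simple_refl m)"
proof -
  obtain \<beta> y where E: "encodes \<mu> \<pi> \<beta> y" and w: "w permutes {1..sum_list \<mu>}" and A: "atom_for (blk \<mu>) \<beta> y w"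
    using at by (auto simp: is_atom_def)
  note Y = encodesD(4)[OF E]
  have asc': "ascent \<beta> y m" using asc encodes_ascent[OF E m] by simp
  have "w m \<noteq> w (Suc m)" using permutes_inj[OF w] by (auto simp: inj_eq)
  then show less: "w m < w (Suc m)"
    using atom_for_descent[OF mono_blk Y A, of m] asc' by linarith
  have "atom_for (blk \<mu>) (\<beta> \<circ> simple_refl m) (flip \<beta> y m) (w \<circ> simple_refl m)"
    by (rule atom_for_raise[OF mono_blk Y permutes_inj[OF w] A asc' less])
  then show "is_atom \<mu> (mu_step \<mu> \<pi> m) (w \<circ> simple_refl m)"
    unfolding is_atom_def using encodes_step[OF E m asc'] comp_simple_refl_permutes[OF w m] by blast
qed

lemma mu_step_not_asc:
  assumes "encodes \<mu> \<pi> \<beta> y" "m \<in> {1..<sum_list \<mu>}" "\<not> inv \<pi> m < inv \<pi> (Suc m)"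
  shows "mu_step \<mu> \<pi> m = \<pi>"
  using mu_step_descent[OF assms(1,2)] encodes_ascent[OF assms(1,2)] assms(3) by simp

text \<open>Letters that act trivially are dropped; each remaining letter raises the involution and,
  by \<open>is_atom_raise\<close>, an atom along with it.\<close>

lemma act_subword:
  assumes "set a \<subseteq> {1..<sum_list \<mu>}"
  shows "\<exists>a' w. subseq a' a \<and> reduced_word (sum_list \<mu>) w a' \<and> mu_word_act \<mu> id a' = mu_word_act \<mu> id a \<and>
    is_atom \<mu> (mu_word_act \<mu> id a) w"
  using assms
proof (induction a rule: rev_induct)
  case Nil
  have "reduced_word (sum_list \<mu>) id []" unfolding reduced_word_iff by simp
  moreover have "is_atom \<mu> id id" unfolding is_atom_def using encodes_id atom_for_id permutes_id by blast
  ultimately show ?case by (intro exI[of _ "[]"] exI[of _ id]) (simp del: id_apply)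
next
  case (snoc m a)
  then obtain a' w where a': "subseq a' a" "reduced_word (sum_list \<mu>) w a'" "mu_word_act \<mu> id a' = mu_word_act \<mu> id a"
      "is_atom \<mu> (mu_word_act \<mu> id a) w" by (auto simp del: id_apply)
  let ?\<pi> = "mu_word_act \<mu> id a"
  have m: "m \<in> {1..<sum_list \<mu>}" using snoc.prems by simp
  show ?case
  proof (cases "inv ?\<pi> m < inv ?\<pi> (Suc m)")
    case True
    note r = is_atom_raise[OF a'(4) m True]
    have "reduced_word (sum_list \<mu>) (w \<circ> simple_refl m) (a' @ [m])"
      unfolding reduced_word_snoc using m r(1) a'(2) by simp
    moreover have "subseq (a' @ [m]) (a @ [m])" using a'(1) by (simp add: subseq_snoc)
    ultimately show ?thesis using r(2) a'(3)
      by (intro exI[of _ "a' @ [m]"] exI[of _ "w \<circ> simple_refl m"]) (simp del: id_apply o_apply)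
  next
    case False
    obtain \<beta> y where E: "encodes \<mu> ?\<pi> \<beta> y" using a'(4) by (auto simp: is_atom_def)
    have "mu_word_act \<mu> id (a @ [m]) = ?\<pi>" using mu_step_not_asc[OF E m False] by simp
    moreover have "subseq a' (a @ [m])" using a'(1) by (simp add: subseq_snoc)
    ultimately show ?thesis using a' by (intro exI[of _ a'] exI[of _ w]) (simp del: id_apply)
  qed
qed

text \<open>No permutation encoded by \<open>(\<beta>, y)\<close> is given in advance: the word
  produces one. \<open>mu_step_down_word\<close> uses this to construct preimages.\<close>

lemma act_encodes:
  "reduced_word (sum_list \<mu>) w a \<Longrightarrow> partner_map \<beta> y \<Longrightarrow> atom_for (blk \<mu>) \<beta> y w \<Longrightarrow>
    encodes \<mu> (mu_word_act \<mu> id a) \<beta> y"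
proof (induction a arbitrary: w \<beta> y rule: rev_induct)
  case Nil
  have "w = id" using Nil(1) by (auto simp: reduced_word_iff)
  have "\<beta> = blk \<mu> \<and> y = id"
    by (rule atom_for_unique[OF mono_blk permutes_id Nil(2) _ Nil(3)[unfolded \<open>w = id\<close>] atom_for_id])
      (rule encodesD(4)[OF encodes_id])
  then show ?case using encodes_id by (simp del: id_apply)
next
  case (snoc m a)
  note r = snoc.prems(1)[unfolded reduced_word_snoc]
  have m: "m \<in> {1..<sum_list \<mu>}" and d: "w (Suc m) < w m" using r by auto
  have E: "encodes \<mu> (mu_word_act \<mu> id a) (\<beta> \<circ> simple_refl m) (flip \<beta> y m)"
    by (rule snoc.IH[OF _ partner_map_flip[OF snoc.prems(2)] atom_for_lower[OF mono_blk snoc.prems(2,3) d]]) (use r in blast)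
  have "ascent (\<beta> \<circ> simple_refl m) (flip \<beta> y m) m"
    unfolding ascent_flip[OF snoc.prems(2)] by (rule atom_for_descent[OF mono_blk snoc.prems(2,3) d])
  from encodes_step[OF E m this] show ?case by (simp add: flip_flip[OF snoc.prems(2)] del: id_apply)
qed

lemma is_atom_act:
  assumes "is_atom \<mu> \<pi> w" "reduced_word (sum_list \<mu>) w a"
  shows "mu_word_act \<mu> id a = \<pi>"
proof -
  obtain \<beta> y where E: "encodes \<mu> \<pi> \<beta> y" and A: "atom_for (blk \<mu>) \<beta> y w" using assms(1) by (auto simp: is_atom_def)
  show ?thesis by (rule encodes_perm_unique[OF act_encodes[OF assms(2) encodesD(4)[OF E] A] E])
qed

lemma is_atom_unique: "is_atom \<mu> \<pi> w \<Longrightarrow> is_atom \<mu> \<tau> w \<Longrightarrow> \<pi> = \<tau>"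
  using is_atom_act reduced_word_exists[of w "sum_list \<mu>"] by (metis is_atom_def)

lemma is_atom_encodes:
  assumes "is_atom \<mu> \<pi> w" "encodes \<mu> \<pi> \<beta> y"
  shows "atom_for (blk \<mu>) \<beta> y w" "w permutes {1..sum_list \<mu>}"
  using assms encodes_partner_unique by (auto simp: is_atom_def) metis

lemma is_atom_exists:
  assumes "\<pi> \<in> mu_involutions \<mu>"
  shows "\<exists>w. is_atom \<mu> \<pi> w"
proof -
  obtain \<beta> y where E: "encodes \<mu> \<pi> \<beta> y" using mu_involution_encodes[OF assms] by blast
  note D = encodesD[OF E]
  show ?thesis using atom_exists[OF permutes_inv[OF D(1)] D(2,3,4)] E by (auto simp: is_atom_def)
qed

lemma is_atom_mu_involution: "is_atom \<mu> \<pi> w \<Longrightarrow> \<pi> \<in> mu_involutions \<mu>"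
  using encodes_mu_involution by (auto simp: is_atom_def)

text \<open>Both permutations arise from one \<open>x\<close> by two left multiplications. In the
  inverse of \<open>x\<close> the positions \<open>p\<close>, \<open>p + 1\<close>,
  \<open>p + 2\<close> hold the increasing letters \<open>a\<close>, \<open>u\<close>,
  \<open>c\<close>, so all these multiplications raise the length.\<close>

lemma rot_words:
  assumes w: "w permutes {1..n}" and n: "u \<in> {1..n}" "a \<in> {1..n}"
    and pos: "w c = Suc (w u)" "w a = Suc (Suc (w u))" and less: "a < u" "u < c"
  defines "p \<equiv> w u"
  shows "\<exists>b. reduced_word n w ([Suc p, p] @ b) \<and> reduced_word n (rot p \<circ> w) ([p, Suc p] @ b)"
proof -
  have p: "p \<in> {1..<n}" "Suc p \<in> {1..<n}"
    using permutes_in_image[OF w, of u] permutes_in_image[OF w, of a] n pos by (auto simp: p_def)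
  let ?s = "simple_refl p" and ?t = "simple_refl (Suc p)"
  define x where "x = ?s \<circ> (?t \<circ> w)"
  define w1 where "w1 = rot p \<circ> w"
  have rp: "{p..p + 2} \<subseteq> {1..n}" using p by auto
  have w1: "w1 permutes {1..n}" unfolding w1_def by (intro permutes_compose[OF w] rot_permutes rp)
  have xp: "x permutes {1..n}" unfolding x_def by (intro permutes_compose[OF w] permutes_compose simple_refl_permutes p w)
  have wx: "w = ?t \<circ> (?s \<circ> x)" by (simp add: x_def)
  have w1x: "w1 = ?s \<circ> (?t \<circ> x)"
    unfolding w1_def rot_eq_simple_refl x_def by (simp add: comp_assoc del: simple_refl_comp)
  have iv: "inv w p = u" "inv w (Suc p) = c" "inv w (Suc (Suc p)) = a"
    using permutes_inverses(2)[OF w] pos by (metis p_def)+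
  have ii: "inv (simple_refl q \<circ> v) = inv v \<circ> simple_refl q" if "v permutes {1..n}" "q \<in> {1..<n}" for v q
    using o_inv_distrib[OF permutes_bij[OF simple_refl_permutes[OF that(2)]] permutes_bij[OF that(1)]] by (simp add: inv_simple_refl)
  have step: "card (Inv (simple_refl q \<circ> v)) = Suc (card (Inv v))" if "v permutes {1..n}" "q \<in> {1..<n}" "inv v q < inv v (Suc q)" for v q
  proof -
    have "simple_refl q \<circ> v permutes {1..n}" by (intro permutes_compose[OF that(1)] simple_refl_permutes that(2))
    from card_Inv_inv[OF this] card_Inv_inv[OF that(1)] card_Inv_ascent[OF permutes_inv[OF that(1)] that(3)]
    show ?thesis by (simp add: ii[OF that(1,2)])
  qed
  have ix: "inv x = inv w \<circ> ?t \<circ> ?s"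
    unfolding x_def using ii[OF permutes_compose[OF w simple_refl_permutes[OF p(2)]] p(1)] ii[OF w p(2)] by simp
  have xv: "inv x p = a" "inv x (Suc p) = u" "inv x (Suc (Suc p)) = c"
    using iv by (simp_all add: ix simple_refl_other)
  have sx: "?s \<circ> x permutes {1..n}" "?t \<circ> x permutes {1..n}"
    using permutes_compose[OF xp simple_refl_permutes[OF p(1)]] permutes_compose[OF xp simple_refl_permutes[OF p(2)]] by auto
  have c1: "card (Inv (?s \<circ> x)) = Suc (card (Inv x))" by (rule step[OF xp p(1)]) (use xv less in simp)
  have c2: "card (Inv (?t \<circ> x)) = Suc (card (Inv x))" by (rule step[OF xp p(2)]) (use xv less in simp)
  have c3: "card (Inv w) = Suc (card (Inv (?s \<circ> x)))"
    unfolding wx by (rule step[OF sx(1) p(2)]) (use xv less ii[OF xp p(1)] in \<open>simp add: simple_refl_other\<close>)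
  have c4: "card (Inv w1) = Suc (card (Inv (?t \<circ> x)))"
    unfolding w1x by (rule step[OF sx(2) p(1)]) (use xv less ii[OF xp p(2)] in \<open>simp add: simple_refl_other\<close>)
  obtain b where b: "reduced_word n x b" using reduced_word_exists[OF xp] by blast
  have "reduced_word n w ([Suc p, p] @ b)"
    using b p c1 c3 unfolding reduced_word_iff by (auto simp flip: wx)
  moreover have "reduced_word n w1 ([p, Suc p] @ b)"
    using b p c2 c4 unfolding reduced_word_iff by (auto simp flip: w1x)
  ultimately show ?thesis by (auto simp: w1_def)
qed

lemma rot_preserves:
  assumes E: "encodes \<mu> \<tau> \<beta> y" and w: "w permutes {1..sum_list \<mu>}" and at: "atom_for (blk \<mu>) \<beta> y w"
    and pat: "pattern_in \<beta> y w lo hi u c a"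
  shows "\<exists>b. reduced_word (sum_list \<mu>) w ([Suc (w u), w u] @ b) \<and>
    reduced_word (sum_list \<mu>) (rot (w u) \<circ> w) ([w u, Suc (w u)] @ b)"
  using rot_words[OF w pattern_rot(6,4)[OF mono_blk encodesD(4,3)[OF E] w at pat]] pat by (auto simp: pattern_in_def)

lemma card_Inv_atoms:
  assumes "is_atom \<mu> \<pi> w" "is_atom \<mu> \<pi> w'"
  shows "card (Inv w) = card (Inv w')"
proof -
  obtain \<beta> y where E: "encodes \<mu> \<pi> \<beta> y" using assms(1) by (auto simp: is_atom_def)
  note D = encodesD[OF E]
  have "card (Inv w) = card (Inv w') \<longleftrightarrow> card (Inv w') = card (Inv w')"
  proof (rule atoms_connected[OF mono_blk D(4,3) is_atom_encodes(2,1)[OF assms(1) E] is_atom_encodes(2,1)[OF assms(2) E],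
        where P = "\<lambda>v. card (Inv v) = card (Inv w')"])
    fix v u c a assume v: "v permutes {1..sum_list \<mu>}" "atom_for (blk \<mu>) \<beta> y v" "pattern_in \<beta> y v 0 (sum_list \<mu>) u c a"
    then show "card (Inv v) = card (Inv w') \<longleftrightarrow> card (Inv (rot (v u) \<circ> v)) = card (Inv w')"
      using rot_preserves[OF E v] by (auto simp: reduced_word_iff)
  qed
  then show ?thesis by simp
qed

text \<open>Every word for \<pi> contains a reduced word of some atom by \<open>act_subword\<close>,
  and all atoms have the same number of inversions.\<close>

lemma mu_length_eq:
  assumes "is_atom \<mu> \<pi> w"
  shows "mu_length \<mu> \<pi> = card (Inv w)"
  unfolding mu_length_def
proof (rule Least_equality)
  obtain a where a: "reduced_word (sum_list \<mu>) w a"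
    using reduced_word_exists assms by (auto simp: is_atom_def)
  then show "\<exists>a. set a \<subseteq> {1..<sum_list \<mu>} \<and> length a = card (Inv w) \<and> mu_word_act \<mu> id a = \<pi>"
    using is_atom_act[OF assms a] by (auto simp: reduced_word_iff)
next
  fix k assume "\<exists>a. set a \<subseteq> {1..<sum_list \<mu>} \<and> length a = k \<and> mu_word_act \<mu> id a = \<pi>"
  then obtain a where a: "set a \<subseteq> {1..<sum_list \<mu>}" "length a = k" "mu_word_act \<mu> id a = \<pi>" by blast
  obtain a' w' where a': "subseq a' a" "reduced_word (sum_list \<mu>) w' a'" "is_atom \<mu> \<pi> w'"
    using act_subword[OF a(1)] a(3) by blast
  have "card (Inv w) = length a'" using card_Inv_atoms[OF assms a'(3)] a'(2) by (simp add: reduced_word_iff)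
  also have "\<dots> \<le> k" using list_emb_length[OF a'(1)] a(2) by simp
  finally show "card (Inv w) \<le> k" .
qed

lemma minimal_word_atom:
  assumes a: "set a \<subseteq> {1..<sum_list \<mu>}" "mu_word_act \<mu> id a = \<pi>" "length a = mu_length \<mu> \<pi>"
  shows "is_atom \<mu> \<pi> (word_prod a)" "reduced_word (sum_list \<mu>) (word_prod a) a"
proof -
  obtain a' w' where a': "subseq a' a" "reduced_word (sum_list \<mu>) w' a'" "is_atom \<mu> \<pi> w'"
    using act_subword[OF a(1)] a(2) by blast
  have "length a' = length a" using mu_length_eq[OF a'(3)] a'(2) a(3) by (simp add: reduced_word_iff)
  then have "a' = a" using subseq_same_length[OF a'(1)] by simp
  moreover have "w' = word_prod a'" using a'(2) by (simp add: reduced_word_iff)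
  ultimately show "is_atom \<mu> \<pi> (word_prod a)" "reduced_word (sum_list \<mu>) (word_prod a) a" using a' by auto
qed

lemma reduced_mu_words_eq:
  "reduced_mu_words \<mu> \<pi> = {a. \<exists>w. is_atom \<mu> \<pi> w \<and> reduced_word (sum_list \<mu>) w a}"
proof (intro equalityI subsetI)
  fix a assume "a \<in> reduced_mu_words \<mu> \<pi>"
  then show "a \<in> {a. \<exists>w. is_atom \<mu> \<pi> w \<and> reduced_word (sum_list \<mu>) w a}"
    using minimal_word_atom[of a \<mu> \<pi>] by (auto simp: reduced_mu_words_def)
next
  fix a assume "a \<in> {a. \<exists>w. is_atom \<mu> \<pi> w \<and> reduced_word (sum_list \<mu>) w a}"
  then obtain w where w: "is_atom \<mu> \<pi> w" "reduced_word (sum_list \<mu>) w a" by blast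
  then show "a \<in> reduced_mu_words \<mu> \<pi>"
    using is_atom_act[OF w] mu_length_eq[OF w(1)] w(2) by (auto simp: reduced_mu_words_def reduced_word_iff)
qed

text \<open>It does not matter which reduced word \<open>SOME\<close> selects in
  \<open>mu_act\<close>: a word of minimal length has an atom as its product, and every reduced word
  of an atom produces \<pi>.\<close>

lemma atoms_eq: "atoms \<mu> \<pi> = {w. is_atom \<mu> \<pi> w}"
proof (intro equalityI subsetI)
  fix w assume "w \<in> atoms \<mu> \<pi>"
  then have w: "w permutes {1..sum_list \<mu>}" "mu_act \<mu> id w = \<pi>" "cox_length (sum_list \<mu>) w = mu_length \<mu> \<pi>"
    by (auto simp: atoms_def)
  define a where "a = (SOME a. reduced_word (sum_list \<mu>) w a)"
  have a: "reduced_word (sum_list \<mu>) w a" unfolding a_def by (rule someI_ex[OF reduced_word_exists[OF w(1)]])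
  have act: "mu_word_act \<mu> id a = \<pi>" using w(2) by (simp add: mu_act_def a_def)
  have "is_atom \<mu> \<pi> (word_prod a)"
    by (rule minimal_word_atom(1)[OF _ act]) (use a w(3) in \<open>auto simp: reduced_word_def\<close>)
  moreover have "word_prod a = w" using a by (simp add: reduced_word_def)
  ultimately show "w \<in> {w. is_atom \<mu> \<pi> w}" by simp
next
  fix w assume "w \<in> {w. is_atom \<mu> \<pi> w}"
  then have at: "is_atom \<mu> \<pi> w" by simp
  then have w: "w permutes {1..sum_list \<mu>}" by (simp add: is_atom_def)
  have "mu_act \<mu> id w = \<pi>"
    unfolding mu_act_def by (rule is_atom_act[OF at someI_ex[OF reduced_word_exists[OF w]]])
  then show "w \<in> atoms \<mu> \<pi>" using w cox_length_eq[OF w] mu_length_eq[OF at] by (simp add: atoms_def)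
qed

lemma reduced_mu_words_length: "a \<in> reduced_mu_words \<mu> \<pi> \<Longrightarrow> length a = mu_length \<mu> \<pi>"
  by (simp add: reduced_mu_words_def)

lemma reduced_mu_words_exist:
  assumes "\<pi> \<in> mu_involutions \<mu>"
  shows "\<exists>a. a \<in> reduced_mu_words \<mu> \<pi>"
proof -
  obtain w where w: "is_atom \<mu> \<pi> w" using is_atom_exists[OF assms] by blast
  then have "w permutes {1..sum_list \<mu>}" by (simp add: is_atom_def)
  then obtain a where "reduced_word (sum_list \<mu>) w a" using reduced_word_exists by blast
  then show ?thesis unfolding reduced_mu_words_eq using w by blast
qed

lemma Sub_reduced_mu_word:
  assumes b: "reduced_word (sum_list \<mu>) w b" and v: "is_atom \<mu> \<pi> v" "v \<in> Sub b"
  shows "\<exists>a \<in> reduced_mu_words \<mu> \<pi>. subseq a b"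
proof -
  obtain c where c: "subseq c b" "v = word_prod c" using v(2) by (auto simp: Sub_def)
  have "set c \<subseteq> set b" using c(1) by (induction rule: list_emb.induct) auto
  then have "set c \<subseteq> {1..<sum_list \<mu>}" using b by (auto simp: reduced_word_def)
  then obtain a where a: "subseq a c" "reduced_word (sum_list \<mu>) v a" using reduced_subword c(2) by blast
  have "subseq a b" using a(1) c(1) by (rule subseq_order.order_trans)
  then show ?thesis using a(2) v(1) by (auto simp: reduced_mu_words_eq)
qed

lemma reduced_mu_word_Sub:
  assumes "a \<in> reduced_mu_words \<mu> \<pi>" "subseq a b"
  shows "\<exists>v. is_atom \<mu> \<pi> v \<and> v \<in> Sub b"
  using assms by (auto simp: reduced_mu_words_eq reduced_word_iff Sub_def)

section \<open>Independence of the reduced word\<close>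

lemma act_adjacent_commute:
  assumes p: "p \<in> {1..<sum_list \<mu>}" "Suc p \<in> {1..<sum_list \<mu>}" and blk: "blk \<mu> p = blk \<mu> (Suc (Suc p))"
  shows "mu_word_act \<mu> id [p, Suc p] = mu_word_act \<mu> id [Suc p, p]"
proof -
  let ?b = "blk \<mu>"
  have b: "?b (Suc p) = ?b p" "?b (Suc (Suc p)) = ?b p"
    using between_blocks[OF mono_blk _ _ blk, of "Suc p"] blk by auto
  have bs: "?b \<circ> simple_refl p = ?b" "?b \<circ> simple_refl (Suc p) = ?b"
    using b by (auto simp: fun_eq_iff simple_refl_def transpose_def)
  have 1: "flip ?b id p = simple_refl p" "flip ?b id (Suc p) = simple_refl (Suc p)"
    using b by (simp_all add: flip_def)
  have 2: "flip ?b (simple_refl p) (Suc p) = simple_refl (Suc p) \<circ> simple_refl p \<circ> simple_refl (Suc p)"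
    "flip ?b (simple_refl (Suc p)) p = simple_refl p \<circ> simple_refl (Suc p) \<circ> simple_refl p"
    by (simp_all add: flip_def simple_refl_other)
  have E1: "encodes \<mu> (mu_step \<mu> id p) ?b (simple_refl p)" "encodes \<mu> (mu_step \<mu> id (Suc p)) ?b (simple_refl (Suc p))"
    using encodes_step[OF encodes_id p(1)] encodes_step[OF encodes_id p(2)] b by (simp_all add: 1 bs ascent_def)
  \<comment> \<open>Either order yields the transposition of \<open>p\<close> and
    \<open>p + 2\<close>, written in the two ways equated by the braid relation.\<close>
  have "encodes \<mu> (mu_step \<mu> (mu_step \<mu> id p) (Suc p)) ?b (simple_refl (Suc p) \<circ> simple_refl p \<circ> simple_refl (Suc p))"
    using encodes_step[OF E1(1) p(2)] b by (simp add: 2 bs ascent_def simple_refl_other)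
  moreover have "encodes \<mu> (mu_step \<mu> (mu_step \<mu> id (Suc p)) p) ?b (simple_refl (Suc p) \<circ> simple_refl p \<circ> simple_refl (Suc p))"
    using encodes_step[OF E1(2) p(1)] b by (simp add: 2 bs ascent_def simple_refl_other flip: simple_refl_braid)
  ultimately have "mu_step \<mu> (mu_step \<mu> id p) (Suc p) = mu_step \<mu> (mu_step \<mu> id (Suc p)) p"
    by (rule encodes_perm_unique)
  then show ?thesis by simp
qed

text \<open>A subword using at most one of the first two letters survives their exchange unchanged;
  one using both is corrected by \<open>act\<close>.\<close>

lemma switch_first_letters:
  assumes act: "mu_word_act \<mu> id [p, q] = mu_word_act \<mu> id [q, p]"
    and a: "a \<in> reduced_mu_words \<mu> \<pi>" "subseq a ([p, q] @ b)"
  shows "\<exists>a' \<in> reduced_mu_words \<mu> \<pi>. subseq a' ([q, p] @ b)"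
proof -
  obtain a1 a2 where s: "a = a1 @ a2" "subseq a1 [p, q]" "subseq a2 b" using a(2) by (elim subseq_appendE)
  have "a1 \<in> set (subseqs [p, q])" using s(2) by (simp only: in_set_subseqs)
  then have "a1 = [] \<or> a1 = [p] \<or> a1 = [q] \<or> a1 = [p, q]" by (auto simp: Let_def)
  then show ?thesis
  proof (elim disjE)
    assume a1: "a1 = [p, q]"
    have "[q, p] @ a2 \<in> reduced_mu_words \<mu> \<pi>"
      using a(1) act by (auto simp: reduced_mu_words_def s(1) a1)
    moreover have "subseq ([q, p] @ a2) ([q, p] @ b)" using s(3) by simp
    ultimately show ?thesis by blast
  next
    assume a1: "a1 = []"
    then show ?thesis using s a(1) by (intro bexI[of _ a]) (auto intro: list_emb_Cons)
  next
    assume a1: "a1 = [p]"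
    have "subseq [p] [q, p]" by simp
    then have "subseq ([p] @ a2) ([q, p] @ b)" using s(3) by (rule list_emb_append_mono)
    then show ?thesis using s(1) a1 a(1) by blast
  next
    assume a1: "a1 = [q]"
    have "subseq [q] [q, p]" by simp
    then have "subseq ([q] @ a2) ([q, p] @ b)" using s(3) by (rule list_emb_append_mono)
    then show ?thesis using s(1) a1 a(1) by blast
  qed
qed

text \<open>For one atom, \<open>Sub\<close> carries a subword from any reduced word to every other.
  Between atoms, each move has a pair of words differing in their first two letters. The auxiliary
  property \<open>P\<close> speaks of all reduced words of an atom so that these particular ones can
  be chosen.\<close>

lemma subword_independent:
  assumes a: "a \<in> reduced_mu_words \<mu> \<pi>" "subseq a b" and b: "b \<in> reduced_mu_words \<mu> \<tau>" "b' \<in> reduced_mu_words \<mu> \<tau>"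
  shows "\<exists>a' \<in> reduced_mu_words \<mu> \<pi>. subseq a' b'"
proof -
  let ?n = "sum_list \<mu>"
  define P where "P w \<longleftrightarrow> (\<forall>b. reduced_word ?n w b \<longrightarrow> (\<exists>a' \<in> reduced_mu_words \<mu> \<pi>. subseq a' b))" for w
  have PI: "P w" if th: "reduced_word ?n w b" "a \<in> reduced_mu_words \<mu> \<pi>" "subseq a b" for w a b
    unfolding P_def
  proof (intro allI impI)
    fix b' assume b': "reduced_word ?n w b'"
    obtain v where v: "is_atom \<mu> \<pi> v" "v \<in> Sub b" using reduced_mu_word_Sub[OF th(2,3)] by blast
    have "v \<in> Sub b'" using v(2) Sub_reduced_word[OF th(1) b'] by simp
    then show "\<exists>a' \<in> reduced_mu_words \<mu> \<pi>. subseq a' b'" by (rule Sub_reduced_mu_word[OF b' v(1)])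
  qed
  obtain w w' where w: "is_atom \<mu> \<tau> w" "reduced_word ?n w b" and w': "is_atom \<mu> \<tau> w'" "reduced_word ?n w' b'"
    using b by (auto simp: reduced_mu_words_eq)
  obtain \<beta> y where E: "encodes \<mu> \<tau> \<beta> y" using w(1) by (auto simp: is_atom_def)
  note D = encodesD[OF E]
  have "P w \<longleftrightarrow> P w'"
  proof (rule atoms_connected[OF mono_blk D(4,3) is_atom_encodes(2,1)[OF w(1) E] is_atom_encodes(2,1)[OF w'(1) E]])
    fix v u c x assume v: "v permutes {1..?n}" "atom_for (blk \<mu>) \<beta> y v" "pattern_in \<beta> y v 0 ?n u c x"
    define p where "p = v u"
    obtain d where d: "reduced_word ?n v ([Suc p, p] @ d)" "reduced_word ?n (rot p \<circ> v) ([p, Suc p] @ d)"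
      using rot_preserves[OF E v] unfolding p_def by blast
    have pn: "p \<in> {1..<?n}" "Suc p \<in> {1..<?n}" using d(1) by (auto simp: reduced_word_def)
    have "blk \<mu> (v u) = blk \<mu> (v x)" unfolding atom_forD(1)[OF v(2)] using v(3) by (simp add: pattern_in_def)
    then have "blk \<mu> p = blk \<mu> (Suc (Suc p))" using v(3) by (simp add: pattern_in_def p_def)
    note act = act_adjacent_commute[OF pn this]
    show "P v \<longleftrightarrow> P (rot (v u) \<circ> v)"
    proof
      assume "P v"
      then obtain a' where "a' \<in> reduced_mu_words \<mu> \<pi>" "subseq a' ([Suc p, p] @ d)" using d(1) unfolding P_def by blast
      then show "P (rot (v u) \<circ> v)"
        using switch_first_letters[OF act[symmetric]] PI[OF d(2)] unfolding p_def by blast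
    next
      assume "P (rot (v u) \<circ> v)"
      then obtain a' where "a' \<in> reduced_mu_words \<mu> \<pi>" "subseq a' ([p, Suc p] @ d)" using d(2) unfolding P_def p_def by blast
      then show "P v"
        using switch_first_letters[OF act] PI[OF d(1)] by blast
    qed
  qed
  then show ?thesis using PI[OF w(2) a] w'(2) unfolding P_def by blast
qed

section \<open>The \<open>\<mu>\<close>-Bruhat order is graded\<close>

lemma mu_bruhat_leI:
  assumes "\<pi> \<in> mu_involutions \<mu>" "\<tau> \<in> mu_involutions \<mu>"
    and "b \<in> reduced_mu_words \<mu> \<tau>" "a \<in> reduced_mu_words \<mu> \<pi>" "subseq a b"
  shows "mu_bruhat_le \<mu> \<pi> \<tau>"
  unfolding mu_bruhat_le_def using subword_independent assms by blast

lemma mu_bruhat_le_trans: "mu_bruhat_le \<mu> \<pi> \<rho> \<Longrightarrow> mu_bruhat_le \<mu> \<rho> \<tau> \<Longrightarrow> mu_bruhat_le \<mu> \<pi> \<tau>"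
  unfolding mu_bruhat_le_def using subseq_order.order_trans by meson

lemma mu_bruhat_le_same_length:
  assumes le: "mu_bruhat_le \<mu> \<pi> \<tau>" and len: "mu_length \<mu> \<tau> \<le> mu_length \<mu> \<pi>"
  shows "\<pi> = \<tau>"
proof -
  obtain b where b: "b \<in> reduced_mu_words \<mu> \<tau>" using reduced_mu_words_exist[of \<tau> \<mu>] le by (auto simp: mu_bruhat_le_def)
  then obtain a where a: "a \<in> reduced_mu_words \<mu> \<pi>" "subseq a b" using le by (auto simp: mu_bruhat_le_def)
  have "length a = length b"
    using list_emb_length[OF a(2)] reduced_mu_words_length[OF a(1)] reduced_mu_words_length[OF b] len by simp
  then have "a = b" using subseq_same_length[OF a(2)] by simp
  then show ?thesis using a(1) b by (auto simp: reduced_mu_words_def)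
qed

abbreviation asc :: "(nat \<Rightarrow> nat) \<Rightarrow> nat \<Rightarrow> bool" where
  "asc \<pi> m \<equiv> inv \<pi> m < inv \<pi> (Suc m)"

lemma mu_step_up:
  assumes \<pi>: "\<pi> \<in> mu_involutions \<mu>" and m: "m \<in> {1..<sum_list \<mu>}" and a: "asc \<pi> m"
  shows "mu_step \<mu> \<pi> m \<in> mu_involutions \<mu>"
    "mu_length \<mu> (mu_step \<mu> \<pi> m) = Suc (mu_length \<mu> \<pi>)"
    "b \<in> reduced_mu_words \<mu> \<pi> \<Longrightarrow> b @ [m] \<in> reduced_mu_words \<mu> (mu_step \<mu> \<pi> m)"
proof -
  obtain w where w: "is_atom \<mu> \<pi> w" using is_atom_exists[OF \<pi>] by blast
  note r = is_atom_raise[OF w m a]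
  show "mu_step \<mu> \<pi> m \<in> mu_involutions \<mu>" by (rule is_atom_mu_involution[OF r(2)])
  show len: "mu_length \<mu> (mu_step \<mu> \<pi> m) = Suc (mu_length \<mu> \<pi>)"
    using mu_length_eq[OF w] mu_length_eq[OF r(2)] card_Inv_ascent[OF _ r(1)] w by (auto simp: is_atom_def)
  show "b \<in> reduced_mu_words \<mu> \<pi> \<Longrightarrow> b @ [m] \<in> reduced_mu_words \<mu> (mu_step \<mu> \<pi> m)"
    using m len by (auto simp: reduced_mu_words_def)
qed

lemma mu_step_inj:
  assumes \<pi>: "\<pi> \<in> mu_involutions \<mu>" "\<rho> \<in> mu_involutions \<mu>" and m: "m \<in> {1..<sum_list \<mu>}"
    and a: "asc \<pi> m" "asc \<rho> m" and eq: "mu_step \<mu> \<pi> m = mu_step \<mu> \<rho> m"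
  shows "\<pi> = \<rho>"
proof -
  obtain \<beta> y where E: "encodes \<mu> \<pi> \<beta> y" using mu_involution_encodes[OF \<pi>(1)] by blast
  obtain \<beta>' y' where E': "encodes \<mu> \<rho> \<beta>' y'" using mu_involution_encodes[OF \<pi>(2)] by blast
  have "ascent \<beta> y m" "ascent \<beta>' y' m" using a encodes_ascent[OF E m] encodes_ascent[OF E' m] by auto
  note S = encodes_step[OF E m this(1)] encodes_step[OF E' m this(2)]
  note u = encodes_partner_unique[OF S(1) S(2)[folded eq]]
  have "\<beta> = \<beta>'" using u(1) by (metis simple_refl_comp(3))
  moreover have "y = y'"
    using flip_flip[OF encodesD(4)[OF E], of m] flip_flip[OF encodesD(4)[OF E'], of m] u by simp
  ultimately show ?thesis using encodes_perm_unique E E' by blast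
qed

text \<open>Here \<open>flip\<close> supplies only the encoding of the preimage; the permutation
  itself comes from letting a reduced word of one of its atoms act.\<close>

lemma mu_step_down_word:
  assumes \<pi>: "\<pi> \<in> mu_involutions \<mu>" and m: "m \<in> {1..<sum_list \<mu>}" and a: "\<not> asc \<pi> m"
  shows "\<exists>\<rho> \<in> mu_involutions \<mu>. asc \<rho> m \<and> mu_step \<mu> \<rho> m = \<pi>"
proof -
  obtain \<beta> y where E: "encodes \<mu> \<pi> \<beta> y" using mu_involution_encodes[OF \<pi>] by blast
  note D = encodesD[OF E]
  let ?\<beta> = "\<beta> \<circ> simple_refl m" and ?y = "flip \<beta> y m"
  have pm: "partner_map ?\<beta> ?y" by (rule partner_map_flip[OF D(4)])
  have g: "inv \<pi> \<circ> simple_refl m permutes {1..sum_list \<mu>}" by (rule comp_simple_refl_permutes[OF permutes_inv[OF D(1)] m])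
  obtain w where w: "w permutes {1..sum_list \<mu>}" "atom_for (blk \<mu>) ?\<beta> ?y w"
    using atom_exists[OF g _ flip_permutes[OF D(3) m] pm] D(2) by (auto simp: comp_assoc)
  obtain b where b: "reduced_word (sum_list \<mu>) w b" using reduced_word_exists[OF w(1)] by blast
  define \<rho> where "\<rho> = mu_word_act \<mu> id b"
  have E': "encodes \<mu> \<rho> ?\<beta> ?y" unfolding \<rho>_def by (rule act_encodes[OF b pm w(2)])
  have na: "\<not> ascent \<beta> y m" using a encodes_ascent[OF E m] by simp
  then have asc': "ascent ?\<beta> ?y m" using ascent_flip[OF D(4), of m] by simp
  have "encodes \<mu> (mu_step \<mu> \<rho> m) \<beta> y"
    using encodes_step[OF E' m asc'] by (simp add: flip_flip[OF D(4)])
  then have "mu_step \<mu> \<rho> m = \<pi>" using E by (rule encodes_perm_unique)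
  moreover have "asc \<rho> m" using asc' encodes_ascent[OF E' m] by simp
  ultimately show ?thesis using encodes_mu_involution[OF E'] by blast
qed

text \<open>If the prefix led to an involution without an ascent at \<open>m\<close>, the last
  letter would act trivially and the prefix would be a shorter word for \<pi>.\<close>

lemma reduced_mu_words_snoc:
  assumes "a @ [m] \<in> reduced_mu_words \<mu> \<pi>"
  shows "m \<in> {1..<sum_list \<mu>}" "\<not> asc \<pi> m"
    "\<exists>\<rho> \<in> mu_involutions \<mu>. asc \<rho> m \<and> mu_step \<mu> \<rho> m = \<pi> \<and> a \<in> reduced_mu_words \<mu> \<rho>"
proof -
  show m: "m \<in> {1..<sum_list \<mu>}" using assms by (auto simp: reduced_mu_words_def)
  obtain w where w: "is_atom \<mu> \<pi> w" "reduced_word (sum_list \<mu>) w (a @ [m])" using assms by (auto simp: reduced_mu_words_eq)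
  have d: "w (Suc m) < w m" "reduced_word (sum_list \<mu>) (w \<circ> simple_refl m) a" using w(2) by (auto simp: reduced_word_snoc)
  have sub: "set a \<subseteq> {1..<sum_list \<mu>}" using assms by (auto simp: reduced_mu_words_def)
  show "\<not> asc \<pi> m" using is_atom_raise(1)[OF w(1) m] d(1) by auto
  define \<rho> where "\<rho> = mu_word_act \<mu> id a"
  obtain w' where at: "is_atom \<mu> \<rho> w'" using act_subword[OF sub] unfolding \<rho>_def by blast
  have \<rho>: "\<rho> \<in> mu_involutions \<mu>" by (rule is_atom_mu_involution[OF at])
  have st: "mu_step \<mu> \<rho> m = \<pi>" using assms by (simp add: reduced_mu_words_def \<rho>_def)
  obtain \<beta> y where E: "encodes \<mu> \<rho> \<beta> y" using mu_involution_encodes[OF \<rho>] by blast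
  have len: "mu_length \<mu> \<rho> \<le> length a"
    unfolding mu_length_def by (rule Least_le) (use sub \<rho>_def in blast)
  have asc: "asc \<rho> m"
  proof (rule ccontr)
    assume "\<not> asc \<rho> m"
    then have "\<pi> = \<rho>" using mu_step_not_asc[OF E m] st by simp
    then show False using len reduced_mu_words_length[OF assms] by simp
  qed
  have "mu_length \<mu> \<rho> = length a"
    using mu_step_up(2)[OF \<rho> m asc] st reduced_mu_words_length[OF assms] by simp
  then have "a \<in> reduced_mu_words \<mu> \<rho>" using sub by (simp add: reduced_mu_words_def \<rho>_def)
  then show "\<exists>\<rho> \<in> mu_involutions \<mu>. asc \<rho> m \<and> mu_step \<mu> \<rho> m = \<pi> \<and> a \<in> reduced_mu_words \<mu> \<rho>"
    using \<rho> asc st by blast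
qed

lemma le_mu_step:
  assumes "\<pi> \<in> mu_involutions \<mu>" "m \<in> {1..<sum_list \<mu>}" "asc \<pi> m"
  shows "mu_bruhat_le \<mu> \<pi> (mu_step \<mu> \<pi> m)"
proof -
  obtain b where b: "b \<in> reduced_mu_words \<mu> \<pi>" using reduced_mu_words_exist[OF assms(1)] by blast
  show ?thesis
    by (rule mu_bruhat_leI[OF assms(1) mu_step_up(1)[OF assms] mu_step_up(3)[OF assms b] b]) (simp add: subseq_snoc)
qed

text \<open>No reduced word of \<pi> ends in an ascent of \<pi>, so the subword cannot use the
  appended letter \<open>m\<close>.\<close>

lemma lift_ascent:
  assumes le: "mu_bruhat_le \<mu> \<pi> (mu_step \<mu> \<tau> m)" and \<tau>: "\<tau> \<in> mu_involutions \<mu>"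
    and m: "m \<in> {1..<sum_list \<mu>}" and asc: "asc \<tau> m" "asc \<pi> m"
  shows "mu_bruhat_le \<mu> \<pi> \<tau>"
proof -
  have \<pi>: "\<pi> \<in> mu_involutions \<mu>" using le by (simp add: mu_bruhat_le_def)
  obtain b where b: "b \<in> reduced_mu_words \<mu> \<tau>" using reduced_mu_words_exist[OF \<tau>] by blast
  obtain a where a: "a \<in> reduced_mu_words \<mu> \<pi>" "subseq a (b @ [m])"
    using le mu_step_up(3)[OF \<tau> m asc(1) b] by (auto simp: mu_bruhat_le_def)
  have "\<nexists>a'. a = a' @ [m]" using reduced_mu_words_snoc(2) a(1) asc(2) by blast
  then have "subseq a b" using a(2) by (auto simp: subseq_snoc)
  then show ?thesis by (rule mu_bruhat_leI[OF \<pi> \<tau> b a(1)])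
qed

lemma lift_step:
  assumes le: "mu_bruhat_le \<mu> \<pi> \<tau>" and m: "m \<in> {1..<sum_list \<mu>}" and asc: "asc \<pi> m" "asc \<tau> m"
  shows "mu_bruhat_le \<mu> (mu_step \<mu> \<pi> m) (mu_step \<mu> \<tau> m)"
proof -
  have I: "\<pi> \<in> mu_involutions \<mu>" "\<tau> \<in> mu_involutions \<mu>" using le by (auto simp: mu_bruhat_le_def)
  obtain b where b: "b \<in> reduced_mu_words \<mu> \<tau>" using reduced_mu_words_exist[OF I(2)] by blast
  obtain a where a: "a \<in> reduced_mu_words \<mu> \<pi>" "subseq a b" using le b by (auto simp: mu_bruhat_le_def)
  show ?thesis
    by (rule mu_bruhat_leI[OF mu_step_up(1)[OF I(1) m asc(1)] mu_step_up(1)[OF I(2) m asc(2)]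
          mu_step_up(3)[OF I(2) m asc(2) b] mu_step_up(3)[OF I(1) m asc(1) a(1)]]) (use a(2) in \<open>simp add: subseq_snoc\<close>)
qed

text \<open>A subword that avoids the appended letter contains a reduced word of \<pi>, as \<pi>
  lies below its own step. One that uses the letter gives a reduced word of \<pi> when the letter is
  removed, by \<open>mu_step_inj\<close>.\<close>

lemma lift_descent:
  assumes le: "mu_bruhat_le \<mu> (mu_step \<mu> \<pi> m) (mu_step \<mu> \<tau> m)" and I: "\<pi> \<in> mu_involutions \<mu>" "\<tau> \<in> mu_involutions \<mu>"
    and m: "m \<in> {1..<sum_list \<mu>}" and asc: "asc \<pi> m" "asc \<tau> m"
  shows "mu_bruhat_le \<mu> \<pi> \<tau>"
proof -
  obtain b where b: "b \<in> reduced_mu_words \<mu> \<tau>" using reduced_mu_words_exist[OF I(2)] by blast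
  obtain a where a: "a \<in> reduced_mu_words \<mu> (mu_step \<mu> \<pi> m)" "subseq a (b @ [m])"
    using le mu_step_up(3)[OF I(2) m asc(2) b] by (auto simp: mu_bruhat_le_def)
  from a(2) have "\<exists>a' \<in> reduced_mu_words \<mu> \<pi>. subseq a' b"
    unfolding subseq_snoc
  proof (elim disjE exE conjE)
    assume "subseq a b"
    moreover obtain a' where "a' \<in> reduced_mu_words \<mu> \<pi>" "subseq a' a"
      using le_mu_step[OF I(1) m asc(1)] a(1) by (auto simp: mu_bruhat_le_def)
    ultimately show ?thesis using subseq_order.order_trans by blast
  next
    fix c assume c: "a = c @ [m]" "subseq c b"
    obtain \<rho> where \<rho>: "\<rho> \<in> mu_involutions \<mu>" "asc \<rho> m" "mu_step \<mu> \<rho> m = mu_step \<mu> \<pi> m" "c \<in> reduced_mu_words \<mu> \<rho>"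
      using reduced_mu_words_snoc(3) a(1) c(1) by blast
    have "\<rho> = \<pi>" by (rule mu_step_inj[OF \<rho>(1) I(1) m \<rho>(2) asc(1) \<rho>(3)])
    then show ?thesis using \<rho>(4) c(2) by blast
  qed
  then show ?thesis using mu_bruhat_leI[OF I b] by blast
qed

lemma exists_descent:
  assumes "\<tau> \<in> mu_involutions \<mu>" "mu_length \<mu> \<tau> > 0"
  shows "\<exists>m \<in> {1..<sum_list \<mu>}. \<not> asc \<tau> m"
proof -
  obtain b where b: "b \<in> reduced_mu_words \<mu> \<tau>" using reduced_mu_words_exist[OF assms(1)] by blast
  then have "b \<noteq> []" using assms(2) reduced_mu_words_length by fastforce
  then obtain c m where "b = c @ [m]" by (cases b rule: rev_cases) auto
  then show ?thesis using reduced_mu_words_snoc(1,2) b by blast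
qed

text \<open>The induction follows the lifting property, as for the Bruhat order of a Coxeter group.\<close>

lemma mu_bruhat_graded:
  "mu_bruhat_le \<mu> \<pi> \<tau> \<Longrightarrow> \<pi> \<noteq> \<tau> \<Longrightarrow>
    \<exists>\<rho>. mu_bruhat_le \<mu> \<pi> \<rho> \<and> mu_bruhat_le \<mu> \<rho> \<tau> \<and> Suc (mu_length \<mu> \<rho>) = mu_length \<mu> \<tau>"
proof (induction "mu_length \<mu> \<tau>" arbitrary: \<pi> \<tau> rule: less_induct)
  case less
  note le = less.prems(1)
  have I: "\<pi> \<in> mu_involutions \<mu>" "\<tau> \<in> mu_involutions \<mu>" using le by (auto simp: mu_bruhat_le_def)
  have "mu_length \<mu> \<tau> > 0"
    using mu_bruhat_le_same_length[OF le] less.prems(2) by (cases "mu_length \<mu> \<tau>") auto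
  then obtain m where m: "m \<in> {1..<sum_list \<mu>}" "\<not> asc \<tau> m" using exists_descent[OF I(2)] by blast
  obtain \<tau>' where \<tau>': "\<tau>' \<in> mu_involutions \<mu>" "asc \<tau>' m" "mu_step \<mu> \<tau>' m = \<tau>" using mu_step_down_word[OF I(2) m] by blast
  have len: "mu_length \<mu> \<tau> = Suc (mu_length \<mu> \<tau>')" using mu_step_up(2)[OF \<tau>'(1) m(1) \<tau>'(2)] \<tau>'(3) by simp
  have \<tau>'\<tau>: "mu_bruhat_le \<mu> \<tau>' \<tau>" using le_mu_step[OF \<tau>'(1) m(1) \<tau>'(2)] \<tau>'(3) by simp
  show ?case
  proof (cases "asc \<pi> m")
    case True
    then have "mu_bruhat_le \<mu> \<pi> \<tau>'" using lift_ascent[OF _ \<tau>'(1) m(1) \<tau>'(2)] le \<tau>'(3) by simp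
    then show ?thesis using \<tau>'\<tau> len by auto
  next
    case False
    obtain \<pi>' where \<pi>': "\<pi>' \<in> mu_involutions \<mu>" "asc \<pi>' m" "mu_step \<mu> \<pi>' m = \<pi>" using mu_step_down_word[OF I(1) m(1) False] by blast
    have le': "mu_bruhat_le \<mu> \<pi>' \<tau>'"
      by (rule lift_descent[OF _ \<pi>'(1) \<tau>'(1) m(1) \<pi>'(2) \<tau>'(2)]) (simp add: le \<pi>'(3) \<tau>'(3))
    have ne: "\<pi>' \<noteq> \<tau>'" using \<pi>'(3) \<tau>'(3) less.prems(2) by auto
    obtain \<rho> where \<rho>: "mu_bruhat_le \<mu> \<pi>' \<rho>" "mu_bruhat_le \<mu> \<rho> \<tau>'" "Suc (mu_length \<mu> \<rho>) = mu_length \<mu> \<tau>'"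
      using less.hyps[OF _ le' ne] len by auto
    have \<rho>I: "\<rho> \<in> mu_involutions \<mu>" using \<rho>(1) by (simp add: mu_bruhat_le_def)
    show ?thesis
    proof (cases "asc \<rho> m")
      case True
      have "mu_bruhat_le \<mu> \<pi> (mu_step \<mu> \<rho> m)" using lift_step[OF \<rho>(1) m(1) \<pi>'(2) True] \<pi>'(3) by simp
      moreover have "mu_bruhat_le \<mu> (mu_step \<mu> \<rho> m) \<tau>" using lift_step[OF \<rho>(2) m(1) True \<tau>'(2)] \<tau>'(3) by simp
      moreover have "Suc (mu_length \<mu> (mu_step \<mu> \<rho> m)) = mu_length \<mu> \<tau>" using mu_step_up(2)[OF \<rho>I m(1) True] \<rho>(3) len by simp
      ultimately show ?thesis by blast
    next
      case nasc: False
      \<comment> \<open>When \<open>\<rho>\<close> itself descends at \<open>m\<close>, it already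
        lies above \<pi>: lift \<pi>' \<le> \<rho> to \<pi>' \<le> \<sigma> and step up on both
        sides. Then \<open>\<tau>'\<close> is the intermediate element.\<close>
      obtain \<sigma> where \<sigma>: "\<sigma> \<in> mu_involutions \<mu>" "asc \<sigma> m" "mu_step \<mu> \<sigma> m = \<rho>" using mu_step_down_word[OF \<rho>I m(1) nasc] by blast
      have "mu_bruhat_le \<mu> \<pi>' \<sigma>" by (rule lift_ascent[OF _ \<sigma>(1) m(1) \<sigma>(2) \<pi>'(2)]) (simp add: \<sigma>(3) \<rho>(1))
      then have "mu_bruhat_le \<mu> \<pi> \<rho>" using lift_step[OF _ m(1) \<pi>'(2) \<sigma>(2)] \<pi>'(3) \<sigma>(3) by simp
      then have "mu_bruhat_le \<mu> \<pi> \<tau>'" using \<rho>(2) by (rule mu_bruhat_le_trans)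
      then show ?thesis using \<tau>'\<tau> len by auto
    qed
  qed
qed

lemma cover_length:
  assumes "mu_bruhat_covers \<mu> \<pi> \<tau>"
  shows "mu_length \<mu> \<tau> = Suc (mu_length \<mu> \<pi>)"
proof -
  obtain \<rho> where \<rho>: "mu_bruhat_le \<mu> \<pi> \<rho>" "mu_bruhat_le \<mu> \<rho> \<tau>" "Suc (mu_length \<mu> \<rho>) = mu_length \<mu> \<tau>"
    using mu_bruhat_graded[of \<mu> \<pi> \<tau>] assms by (auto simp: mu_bruhat_covers_def)
  have "\<rho> \<noteq> \<tau>" using \<rho>(3) by auto
  then have "\<rho> = \<pi>" using assms \<rho>(1,2) by (auto simp: mu_bruhat_covers_def)
  then show ?thesis using \<rho>(3) by simp
qed

section \<open>Covers of different atoms and the operators \<open>mu_transp\<close>\<close>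

lemma cover_transfer:
  assumes ij: "1 \<le> i" "i < j" "j \<le> sum_list \<mu>"
    and v: "is_atom \<mu> \<pi> v" and w: "is_atom \<mu> \<pi> w" and vt: "is_atom \<mu> \<tau> (v \<circ> transpose i j)"
    and cov: "card (Inv (v \<circ> transpose i j)) = card (Inv v) + 1" "card (Inv (w \<circ> transpose i j)) = card (Inv w) + 1"
  shows "is_atom \<mu> \<tau> (w \<circ> transpose i j)"
proof -
  let ?n = "sum_list \<mu>" and ?t = "transpose i j"
  obtain \<beta> y where E: "encodes \<mu> \<pi> \<beta> y" using v by (auto simp: is_atom_def)
  obtain \<beta>' y' where E': "encodes \<mu> \<tau> \<beta>' y'" using vt by (auto simp: is_atom_def)
  note Y = encodesD(4)[OF E] and Y' = encodesD(4)[OF E']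
  note V = is_atom_encodes[OF v E] and W = is_atom_encodes[OF w E] and VT = is_atom_encodes[OF vt E']
  note cv = Inv_cover[OF V(2) ij cov(1)] and cw = Inv_cover[OF W(2) ij cov(2)]
  have WT: "w \<circ> ?t permutes {1..?n}" by (rule transpose_permutes[OF _ _ W(2)]) (use ij in auto)
  have "atom_for (blk \<mu>) \<beta>' y' (w \<circ> ?t)"
  proof (cases "\<beta> i = \<beta> j")
    case True
    \<comment> \<open>Being bad is a property of \<open>y\<close>, \<open>i\<close> and
      \<open>j\<close>, so the single atom \<open>v\<close> with an atom above it shows that the
      pair is good for \<open>w\<close> too. The block map of \<open>\<tau>\<close> equals
      \<open>\<beta>\<close> here because \<open>i\<close> and \<open>j\<close> share a
      block.\<close>
    have good: "\<not> ((j < y i \<and> y j < y i) \<or> (y j < i \<and> y j < y i))"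
    proof
      assume bad: "(j < y i \<and> y j < y i) \<or> (y j < i \<and> y j < y i)"
      have "\<beta>' x = \<beta> x" for x
      proof -
        have "\<beta> (?t x) = \<beta> x" using True by (auto simp: transpose_def)
        then show ?thesis using atom_forD(1)[OF V(1), of "?t x"] atom_forD(1)[OF VT(1), of x] by simp
      qed
      then have "\<beta>' = \<beta>" by blast
      then show False
        using bad_swap_not_atom[OF mono_blk Y encodesD(3)[OF E] _ ij(2) True bad V(2,1) _ cv, of y'] Y' VT(1) by simp
    qed
    then have g: "\<not> (j < y i \<and> y j < y i)" "\<not> (y j < i \<and> y j < y i)" by auto
    \<comment> \<open>Through \<open>v\<close> the encoding of \<open>\<tau>\<close> is identified
      with the formula \<open>swap_partner\<close>, in which \<open>v\<close> does not occur; the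
      same formula describes the cover of \<open>w\<close>.\<close>
    note sv = atom_for_swap_same[OF mono_blk Y permutes_inj[OF V(2)] V(1) ij(2) cv True g]
    note sw = atom_for_swap_same[OF mono_blk Y permutes_inj[OF W(2)] W(1) ij(2) cw True g]
    show ?thesis using atom_for_unique[OF mono_blk VT(2) Y' sv(2) VT(1) sv(1)] sw(1) by simp
  next
    case False
    note sv = atom_for_swap_diff[OF mono_blk Y permutes_inj[OF V(2)] V(1) ij(2) cv False]
    note sw = atom_for_swap_diff[OF mono_blk Y permutes_inj[OF W(2)] W(1) ij(2) cw False]
    show ?thesis using atom_for_unique[OF mono_blk VT(2) Y' sv(2) VT(1) sv(1)] sw(1) by simp
  qed
  then show ?thesis using E' WT by (auto simp: is_atom_def)
qed

lemma mu_transp_rel_iff: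
  assumes ij: "1 \<le> i" "i < j" "j \<le> sum_list \<mu>"
  shows "mu_transp_rel \<mu> i j \<pi> \<tau> \<longleftrightarrow>
    (\<exists>v. is_atom \<mu> \<pi> v \<and> card (Inv (v \<circ> transpose i j)) = card (Inv v) + 1 \<and> is_atom \<mu> \<tau> (v \<circ> transpose i j))"
proof -
  have cl: "cox_length (sum_list \<mu>) v = card (Inv v)" if "is_atom \<mu> \<rho> v" for v \<rho>
    using that cox_length_eq by (simp add: is_atom_def)
  show ?thesis
    unfolding mu_transp_rel_def atoms_eq
    using cl[of \<pi>] cl[of \<tau>] is_atom_mu_involution[of \<mu> \<tau>] by auto
qed

text \<open>This well-definedness of the operator gives meaning to \<open>THE\<close> in
  \<open>mu_transp\<close>: the atom witnessing \<open>\<tau>\<close> is transferred to the one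
  witnessing \<open>\<tau>'\<close>.\<close>

lemma mu_transp_rel_unique:
  assumes ij: "1 \<le> i" "i < j" "j \<le> sum_list \<mu>"
    and "mu_transp_rel \<mu> i j \<pi> \<tau>" "mu_transp_rel \<mu> i j \<pi> \<tau>'"
  shows "\<tau> = \<tau>'"
  using assms(4,5) cover_transfer[OF ij] is_atom_unique unfolding mu_transp_rel_iff[OF ij] by meson

lemma mu_transp_eq:
  assumes ij: "1 \<le> i" "i < j" "j \<le> sum_list \<mu>" and rel: "mu_transp_rel \<mu> i j \<pi> \<tau>"
  shows "mu_transp \<mu> i j \<pi> = \<tau>"
  unfolding mu_transp_def using rel mu_transp_rel_unique[OF ij] by (auto intro: the_equality)

lemma subseq_delete_one:
  assumes "subseq a b" "length b = Suc (length a)"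
  shows "\<exists>b1 k b2. b = b1 @ k # b2 \<and> a = b1 @ b2"
  using assms
proof (induction b arbitrary: a rule: list.induct)
  case (Cons k b)
  show ?case
  proof (cases "length a = length b \<and> subseq a b")
    case True
    then have "a = b" using subseq_same_length by blast
    then show ?thesis by (intro exI[of _ "[]"]) auto
  next
    case False
    then obtain a' where a': "a = k # a'" "subseq a' b"
      using Cons.prems by (auto elim: list_emb.cases)
    obtain b1 l b2 where "b = b1 @ l # b2" "a' = b1 @ b2" using Cons.IH[OF a'(2)] Cons.prems(2) a'(1) by auto
    then show ?thesis using a'(1) by (intro exI[of _ "k # b1"] exI[of _ l] exI[of _ b2]) simp
  qed
qed simp

theorem theorem3p11:
  fixes \<mu> :: "nat list" and n :: nat and \<pi> \<tau> :: "nat \<Rightarrow> nat"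
  assumes "composition \<mu> n"
    and "\<pi> \<in> mu_involutions \<mu>" and "\<tau> \<in> mu_involutions \<mu>"
    and "mu_bruhat_covers \<mu> \<pi> \<tau>"
  shows "atoms \<mu> \<tau> =
    {w \<circ> transpose i j | w i j.
       w \<in> atoms \<mu> \<pi> \<and> 1 \<le> i \<and> i < j \<and> j \<le> n \<and>
       mu_transp \<mu> i j \<pi> = \<tau> \<and>
       cox_length n (w \<circ> transpose i j) = cox_length n w + 1}"
proof (intro equalityI subsetI)
  have n: "n = sum_list \<mu>" using assms(1) by (simp add: composition_def)
  have cl: "cox_length n w = card (Inv w)" if "is_atom \<mu> \<rho> w" for w \<rho>
    using cox_length_eq that by (auto simp: is_atom_def n)
  {
    fix x assume "x \<in> atoms \<mu> \<tau>"
    then have x: "is_atom \<mu> \<tau> x" by (simp add: atoms_eq)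
    then obtain b where b: "reduced_word n x b" using reduced_word_exists by (auto simp: is_atom_def n)
    then have bR: "b \<in> reduced_mu_words \<mu> \<tau>" using x by (auto simp: reduced_mu_words_eq n)
    then obtain a where a: "a \<in> reduced_mu_words \<mu> \<pi>" "subseq a b"
      using assms(4) by (auto simp: mu_bruhat_covers_def mu_bruhat_le_def)
    have "length b = Suc (length a)"
      using cover_length[OF assms(4)] reduced_mu_words_length[OF a(1)] reduced_mu_words_length[OF bR] by simp
    then obtain b1 k b2 where s: "b = b1 @ k # b2" "a = b1 @ b2" using subseq_delete_one[OF a(2)] by blast
    have xb: "word_prod b = x" "set b \<subseteq> {1..<n}" using b by (auto simp: reduced_word_iff)
    \<comment> \<open>The reduced words of \<tau> and \<pi> differ by one deleted letter, which
      amounts to a transposition on the right.\<close>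
    obtain i j where ij: "1 \<le> i" "i < j" "j \<le> n" "x = word_prod a \<circ> transpose i j"
      using deletion_transpose[of b1 k b2 n] xb s by auto
    obtain w where w: "is_atom \<mu> \<pi> w" "reduced_word n w a" using a(1) by (auto simp: reduced_mu_words_eq n)
    have wa: "word_prod a = w" using w(2) by (simp add: reduced_word_iff)
    have c: "card (Inv (w \<circ> transpose i j)) = card (Inv w) + 1"
      using b w(2) \<open>length b = Suc (length a)\<close> ij(4) wa by (simp add: reduced_word_iff)
    have "mu_transp_rel \<mu> i j \<pi> \<tau>"
      using mu_transp_rel_iff[of i j \<mu> \<pi> \<tau>] ij w(1) x c wa by (auto simp: n)
    then have "mu_transp \<mu> i j \<pi> = \<tau>" using mu_transp_eq ij(1-3) by (simp add: n)
    moreover have "cox_length n (w \<circ> transpose i j) = cox_length n w + 1"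
      using cl[OF w(1)] cl[OF x] c ij(4) wa by simp
    ultimately show "x \<in> {w \<circ> transpose i j | w i j.
       w \<in> atoms \<mu> \<pi> \<and> 1 \<le> i \<and> i < j \<and> j \<le> n \<and>
       mu_transp \<mu> i j \<pi> = \<tau> \<and>
       cox_length n (w \<circ> transpose i j) = cox_length n w + 1}"
      using ij w(1) wa by (auto simp: atoms_eq)
  }
  fix x assume "x \<in> {w \<circ> transpose i j | w i j.
       w \<in> atoms \<mu> \<pi> \<and> 1 \<le> i \<and> i < j \<and> j \<le> n \<and>
       mu_transp \<mu> i j \<pi> = \<tau> \<and>
       cox_length n (w \<circ> transpose i j) = cox_length n w + 1}"
  then obtain w i j where w: "is_atom \<mu> \<pi> w" "x = w \<circ> transpose i j" and ij: "1 \<le> i" "i < j" "j \<le> n"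
    and t: "mu_transp \<mu> i j \<pi> = \<tau>" and c: "cox_length n (w \<circ> transpose i j) = cox_length n w + 1"
    by (auto simp: atoms_eq)
  note ij' = ij[unfolded n]
  \<comment> \<open>The default value of \<open>mu_transp\<close> is \<pi>, so reaching a different
    \<open>\<tau>\<close> means that the operator is given by some atom \<open>v\<close>.\<close>
  have "\<pi> \<noteq> \<tau>" using assms(4) by (simp add: mu_bruhat_covers_def)
  then obtain \<tau>' where "mu_transp_rel \<mu> i j \<pi> \<tau>'" using t by (auto simp: mu_transp_def split: if_splits)
  moreover from this have "\<tau>' = \<tau>" using mu_transp_eq[OF ij'] t by simp
  ultimately obtain v where v: "is_atom \<mu> \<pi> v" "card (Inv (v \<circ> transpose i j)) = card (Inv v) + 1"
      "is_atom \<mu> \<tau> (v \<circ> transpose i j)"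
    unfolding mu_transp_rel_iff[OF ij'] by blast
  have wp: "w permutes {1..n}" using w(1) by (simp add: is_atom_def n)
  have "w \<circ> transpose i j permutes {1..n}" by (rule transpose_permutes[OF _ _ wp]) (use ij in auto)
  then have "card (Inv (w \<circ> transpose i j)) = card (Inv w) + 1"
    using c cox_length_eq[OF wp] cox_length_eq by simp
  from cover_transfer[OF ij' v(1) w(1) v(3,2) this] show "x \<in> atoms \<mu> \<tau>" using w(2) by (simp add: atoms_eq)
qed

end
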